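(* Let $\mathcal{D}$ be a biplane with parameters $(121,16,2)$, i.e. a symmetric $2$-$(121,16,2)$ design, and let $\mathrm{Aut}(\mathcal{D})$ be its full automorphism group. Then $|\mathrm{Aut}(\mathcal{D})|$ divides $2^7\cdot 3^2\cdot 5\cdot 7$. Moreover, if $G$ is a subgroup of $\mathrm{Aut}(\mathcal{D})$, then: 1. $|G|\notin\{14,35\}$; 2. if $|G|=21$, then $G\cong \mathrm{Frob}_{21}$; 3. if $|G|=10$, then $G\cong D_{10}$.
   Context: An incidence structure $\mathcal{D}=(\mathcal{P},\mathcal{B},\mathcal{I})$ with point set $\mathcal{P}$, block set $\mathcal{B}$ and incidence $\mathcal{I}$ is a $t$-$(v,k,\lambda)$ design if $|\mathcal{P}|=v$, every block is incident with exactly $k$ points, and every $t$ distinct points are together incident with exactly $\lambda$ blocks. A design is symmetric if it has the same number of points and blocks; in a symmetric $2$-$(v,k,\lambda)$ design every point lies on exactly $k$ blocks and every two distinct blocks have exactly $\lambda$ points in common. A biplane with parameters $(v,k,2)$ is a symmetric $2$-$(v,k,2)$ design. It is not known whether a biplane with parameters $(121,16,2)$ exists. An automorphism of $\mathcal{D}$ is a permutation of $\mathcal{P}$ which sends blocks to blocks; the group of all automorphisms is the full automorphism group $\mathrm{Aut}(\mathcal{D})$. $\mathrm{Frob}_{21}$ denotes the Frobenius group of order $21$, i.e. the nonabelian semidirect product $\mathbb{Z}_7:\mathbb{Z}_3$. $D_{10}$ denotes the dihedral group of order $10$, i.e. the nonabelian semidirect product $\mathbb{Z}_5:\mathbb{Z}_2$.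 *)

theory Defs
  imports "HOL-Algebra.Bij" "HOL-Algebra.Elementary_Groups"
begin

record ('p, 'b) incidence_structure =
  points :: "'p set"
  blocks :: "'b set"
  incidence :: "('p \<times> 'b) set"

definition finite_incidence_structure :: "('p, 'b) incidence_structure \<Rightarrow> bool" where
  "finite_incidence_structure D \<longleftrightarrow>
     finite (points D) \<and> finite (blocks D) \<and> incidence D \<subseteq> points D \<times> blocks D"

definition block_points :: "('p, 'b) incidence_structure \<Rightarrow> 'b \<Rightarrow> 'p set" where
  "block_points D b = {p \<in> points D. (p, b) \<in> incidence D}"

definition t_design ::
  "nat \<Rightarrow> nat \<Rightarrow> nat \<Rightarrow> nat \<Rightarrow> ('p, 'b) incidence_structure \<Rightarrow> bool" where
  "t_design t v k l D \<longleftrightarrow>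
     finite_incidence_structure D \<and>
     card (points D) = v \<and>
     (\<forall>b \<in> blocks D. card (block_points D b) = k) \<and>
     (\<forall>T. T \<subseteq> points D \<and> card T = t \<longrightarrow>
        card {b \<in> blocks D. \<forall>p \<in> T. (p, b) \<in> incidence D} = l)"

definition symmetric_design ::
  "nat \<Rightarrow> nat \<Rightarrow> nat \<Rightarrow> nat \<Rightarrow> ('p, 'b) incidence_structure \<Rightarrow> bool" where
  "symmetric_design t v k l D \<longleftrightarrow>
     t_design t v k l D \<and> card (points D) = card (blocks D)"

definition biplane :: "nat \<Rightarrow> nat \<Rightarrow> ('p, 'b) incidence_structure \<Rightarrow> bool" where
  "biplane v k D \<longleftrightarrow> symmetric_design 2 v k 2 D"

text \<open>
  Blocks are abstract objects, so a permutation of the points sends a block to a block if the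
  image of its point set is the point set of some block. As in \<^const>\<open>Bij\<close>, permutations
  are extensional functions, so that each permutation of the points is counted once.
\<close>

definition automorphisms :: "('p, 'b) incidence_structure \<Rightarrow> ('p \<Rightarrow> 'p) set" where
  "automorphisms D =
     {\<alpha> \<in> Bij (points D). \<forall>b \<in> blocks D. \<exists>b' \<in> blocks D. \<alpha> ` block_points D b = block_points D b'}"

definition automorphism_group :: "('p, 'b) incidence_structure \<Rightarrow> ('p \<Rightarrow> 'p) monoid" where
  "automorphism_group D = BijGroup (points D) \<lparr>carrier := automorphisms D\<rparr>"

lemma automorphisms_subgroup:
  assumes fin: "finite (points D)"
  shows "subgroup (automorphisms D) (BijGroup (points D))"
proof -
  let ?P = "points D"
  let ?F = "block_points D ` blocks D"
  interpret B: group "BijGroup ?P" by (rule group_BijGroup)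
  have sub: "?F \<subseteq> Pow ?P" by (auto simp: block_points_def)
  hence finF: "finite ?F" using fin finite_subset by blast
  have aut: "\<alpha> \<in> automorphisms D \<longleftrightarrow> \<alpha> \<in> Bij ?P \<and> (`) \<alpha> ` ?F \<subseteq> ?F" for \<alpha>
    by (auto simp: automorphisms_def image_subset_iff image_iff)
  have bpP: "block_points D b \<subseteq> ?P" for b by (auto simp: block_points_def)
  have idP: "(\<lambda>x\<in>?P. x) ` X = X" if "X \<subseteq> ?P" for X
    using that by (force simp: image_def)
  have cimg: "compose ?P f g ` X = f ` g ` X" if "X \<subseteq> ?P" for f g :: "'a \<Rightarrow> 'a" and X
    using that by (force simp: compose_def image_def)
  show ?thesis
  proof (rule B.subgroupI)
    show "automorphisms D \<subseteq> carrier (BijGroup ?P)"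
      by (auto simp: automorphisms_def BijGroup_def)
    have "(\<lambda>x\<in>?P. x) \<in> automorphisms D"
      unfolding aut using idP[OF bpP] by (simp add: id_Bij image_subset_iff)
    thus "automorphisms D \<noteq> {}" by blast
  next
    fix a assume "a \<in> automorphisms D"
    hence a: "a \<in> Bij ?P" and aF: "(`) a ` ?F \<subseteq> ?F" by (auto simp: aut)
    have bij: "bij_betw a ?P ?P" using a by (simp add: Bij_def)
    have "inj_on ((`) a) (Pow ?P)"
      using bij by (simp add: bij_betw_def inj_on_image_Pow)
    hence "inj_on ((`) a) ?F" using sub inj_on_subset by blast
    hence eq: "(`) a ` ?F = ?F" using aF finF by (simp add: endo_inj_surj)
    have inv: "inv\<^bsub>BijGroup ?P\<^esub> a = restrict (inv_into ?P a) ?P"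
      using a by (rule inv_BijGroup)
    have "restrict (inv_into ?P a) ?P ` X \<in> ?F" if "X \<in> ?F" for X
    proof -
      have "X \<in> (`) a ` ?F" unfolding eq by (rule that)
      then obtain Y where Y: "Y \<in> ?F" "X = a ` Y" by (elim imageE[where f = "(`) a"]) simp
      have YP: "Y \<subseteq> ?P" using Y sub by blast
      have "X \<subseteq> ?P" using that sub by blast
      hence "restrict (inv_into ?P a) ?P ` X = inv_into ?P a ` X" by (force simp: image_def)
      also have "\<dots> = Y" using Y YP bij by (simp add: bij_betw_def inv_into_image_cancel)
      finally show ?thesis using Y by simp
    qed
    hence "(`) (restrict (inv_into ?P a) ?P) ` ?F \<subseteq> ?F" by (rule image_subsetI)
    thus "inv\<^bsub>BijGroup ?P\<^esub> a \<in> automorphisms D"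
      unfolding inv aut using restrict_inv_into_Bij[OF a] by blast
  next
    fix a b assume "a \<in> automorphisms D" "b \<in> automorphisms D"
    hence a: "a \<in> Bij ?P" "(`) a ` ?F \<subseteq> ?F" and b: "b \<in> Bij ?P" "(`) b ` ?F \<subseteq> ?F"
      by (auto simp: aut)
    have "compose ?P a b ` X \<in> ?F" if "X \<in> ?F" for X
    proof -
      have "X \<subseteq> ?P" using that sub by blast
      moreover have "a ` b ` X \<in> ?F"
        by (rule subsetD[OF a(2) imageI[OF subsetD[OF b(2) imageI[OF that]]]])
      ultimately show ?thesis by (simp add: cimg)
    qed
    hence "(`) (compose ?P a b) ` ?F \<subseteq> ?F" by (rule image_subsetI)
    hence "compose ?P a b \<in> automorphisms D"
      unfolding aut using compose_Bij[OF a(1) b(1)] by blast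
    thus "a \<otimes>\<^bsub>BijGroup ?P\<^esub> b \<in> automorphisms D"
      using a b by (simp add: BijGroup_def)
  qed
qed

lemma group_automorphism_group:
  "finite (points D) \<Longrightarrow> group (automorphism_group D)"
  unfolding automorphism_group_def
  by (rule subgroup.subgroup_is_group[OF automorphisms_subgroup group_BijGroup])

definition semidirect_product ::
  "('a, 'c) monoid_scheme \<Rightarrow> ('b, 'd) monoid_scheme \<Rightarrow> ('b \<Rightarrow> 'a \<Rightarrow> 'a) \<Rightarrow> ('a \<times> 'b) monoid" where
  "semidirect_product N H \<phi> =
     \<lparr>carrier = carrier N \<times> carrier H,
      mult = (\<lambda>(n, h) (n', h'). (n \<otimes>\<^bsub>N\<^esub> \<phi> h n', h \<otimes>\<^bsub>H\<^esub> h')),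
      one = (\<one>\<^bsub>N\<^esub>, \<one>\<^bsub>H\<^esub>)\<rparr>"

lemma group_semidirect_product:
  assumes "group N" "group H" and \<phi>: "\<phi> \<in> hom H (AutoGroup N)"
  shows "group (semidirect_product N H \<phi>)"
proof -
  interpret N: group N by fact
  interpret H: group H by fact
  have au: "\<phi> h \<in> auto N" if "h \<in> carrier H" for h
    using \<phi> that by (auto simp: hom_def AutoGroup_def)
  have cl: "\<phi> h n \<in> carrier N" if "h \<in> carrier H" "n \<in> carrier N" for h n
    using au[OF that(1)] that(2) by (auto simp: auto_def hom_def)
  have mu: "\<phi> h (m \<otimes>\<^bsub>N\<^esub> n) = \<phi> h m \<otimes>\<^bsub>N\<^esub> \<phi> h n"
    if "h \<in> carrier H" "m \<in> carrier N" "n \<in> carrier N" for h m n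
    using au[OF that(1)] that(2,3) by (auto simp: auto_def hom_def)
  have co: "\<phi> (g \<otimes>\<^bsub>H\<^esub> h) n = \<phi> g (\<phi> h n)"
    if "g \<in> carrier H" "h \<in> carrier H" "n \<in> carrier N" for g h n
  proof -
    have "\<phi> (g \<otimes>\<^bsub>H\<^esub> h) = compose (carrier N) (\<phi> g) (\<phi> h)"
      using \<phi> that au by (auto simp: hom_def AutoGroup_def BijGroup_def auto_def)
    thus ?thesis using that by (simp add: compose_def)
  qed
  have "group_hom H (AutoGroup N) \<phi>"
    using \<phi> by (simp add: group_hom_def group_hom_axioms_def H.is_group N.AutoGroup)
  hence "\<phi> \<one>\<^bsub>H\<^esub> = \<one>\<^bsub>AutoGroup N\<^esub>" by (rule group_hom.hom_one)
  hence on: "\<phi> \<one>\<^bsub>H\<^esub> n = n" if "n \<in> carrier N" for n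
    using that by (simp add: AutoGroup_def BijGroup_def)
  show ?thesis
  proof (rule groupI)
    fix x assume "x \<in> carrier (semidirect_product N H \<phi>)"
    then obtain n h where x: "x = (n, h)" "n \<in> carrier N" "h \<in> carrier H"
      by (auto simp: semidirect_product_def)
    have "(\<phi> (inv\<^bsub>H\<^esub> h) (inv\<^bsub>N\<^esub> n), inv\<^bsub>H\<^esub> h) \<otimes>\<^bsub>semidirect_product N H \<phi>\<^esub> x
            = \<one>\<^bsub>semidirect_product N H \<phi>\<^esub>"
    proof -
      have z: "\<phi> g \<one>\<^bsub>N\<^esub> = \<one>\<^bsub>N\<^esub>" if "g \<in> carrier H" for g
        using mu[OF that N.one_closed N.one_closed] cl[OF that N.one_closed]
        by (simp add: N.l_cancel_one)
      show ?thesis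
        using x mu[of "inv\<^bsub>H\<^esub> h" "inv\<^bsub>N\<^esub> n" n, symmetric] z
        by (simp add: semidirect_product_def)
    qed
    thus "\<exists>y \<in> carrier (semidirect_product N H \<phi>).
            y \<otimes>\<^bsub>semidirect_product N H \<phi>\<^esub> x = \<one>\<^bsub>semidirect_product N H \<phi>\<^esub>"
      by (rule bexI) (use x cl in \<open>simp add: semidirect_product_def\<close>)
  qed (auto simp: semidirect_product_def cl mu co on N.m_assoc H.m_assoc)
qed

text \<open>
  The generator of \<open>\<int>/3\<close> acts on \<open>\<int>/7\<close> as multiplication by 2, which has multiplicative
  order 3 modulo 7. The other nontrivial choice, 4, is obtained by replacing the generator of
  \<open>\<int>/3\<close> by its inverse, so the nonabelian semidirect product is unique up to isomorphism.
\<close>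

definition Frob21 :: "(int \<times> int) monoid" where
  "Frob21 = semidirect_product (integer_mod_group 7) (integer_mod_group 3)
     (\<lambda>h. \<lambda>n \<in> carrier (integer_mod_group 7). 2 ^ nat h * n mod 7)"

definition D10 :: "(int \<times> int) monoid" where
  "D10 = semidirect_product (integer_mod_group 5) (integer_mod_group 2)
     (\<lambda>h. \<lambda>n \<in> carrier (integer_mod_group 5). (- 1) ^ nat h * n mod 5)"

lemma mult_mod_in_hom_AutoGroup:
  fixes m r :: nat and a :: int
  assumes m: "0 < m" and r: "0 < r" and ar: "a ^ r mod int m = 1 mod int m"
  shows "(\<lambda>h. \<lambda>n \<in> carrier (integer_mod_group m). a ^ nat h * n mod int m)
           \<in> hom (integer_mod_group r) (AutoGroup (integer_mod_group m))"
proof -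
  let ?Z = "carrier (integer_mod_group m)"
  define \<phi> where "\<phi> = (\<lambda>k::nat. \<lambda>n \<in> ?Z. a ^ k * n mod int m)"
  have Z: "?Z = {0..<int m}" using m by (simp add: carrier_integer_mod_group)
  have per: "\<phi> (k mod r) = \<phi> k" for k
  proof -
    have "a ^ k mod int m = a ^ (k mod r) mod int m"
    proof -
      have "a ^ k = (a ^ r) ^ (k div r) * a ^ (k mod r)"
        by (metis div_mult_mod_eq mult.commute power_add power_mult)
      also have "\<dots> mod int m = ((a ^ r mod int m) ^ (k div r) mod int m) * a ^ (k mod r) mod int m"
        by (simp add: power_mod mod_mult_left_eq)
      also have "\<dots> = a ^ (k mod r) mod int m"
        by (simp add: ar power_mod mod_mult_left_eq)
      finally show ?thesis .
    qed
    hence "a ^ (k mod r) * n mod int m = a ^ k * n mod int m" for n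
      by (metis mod_mult_left_eq)
    thus ?thesis by (simp add: \<phi>_def)
  qed
  have comp: "\<phi> (j + k) = compose ?Z (\<phi> j) (\<phi> k)" for j k
    unfolding \<phi>_def using m
    by (auto simp: compose_def Z fun_eq_iff power_add mult.assoc mod_mult_right_eq)
  have id: "\<phi> 0 = (\<lambda>n \<in> ?Z. n)" by (auto simp: \<phi>_def Z fun_eq_iff)
  have maps: "\<phi> k n \<in> ?Z" if "n \<in> ?Z" for k n
    using that m by (simp add: \<phi>_def Z)
  have inverse: "\<phi> j (\<phi> k n) = n" if "(j + k) mod r = 0" "n \<in> ?Z" for j k n
  proof -
    have "\<phi> (j + k) = \<phi> 0" by (rule per[of "j + k", unfolded that(1), symmetric])
    hence "compose ?Z (\<phi> j) (\<phi> k) n = (\<lambda>n \<in> ?Z. n) n" by (simp only: comp id)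
    thus ?thesis using that(2) by (simp only: compose_def restrict_apply if_True)
  qed
  have bij: "\<phi> k \<in> Bij ?Z" for k
  proof -
    obtain q where q: "r = Suc q" using r by (cases r) auto
    have "k * (r - 1) + k = k * r" "k + k * (r - 1) = k * r" by (simp_all add: q)
    hence "(k * (r - 1) + k) mod r = 0" "(k + k * (r - 1)) mod r = 0"
      by (simp_all only: mod_mult_self2_is_0)
    note inv = inverse[OF this(1)] inverse[OF this(2)]
    have "bij_betw (\<phi> k) ?Z ?Z"
      by (rule bij_betw_byWitness[where f' = "\<phi> (k * (r - 1))"])
        (use inv maps in \<open>blast+\<close>)
    thus ?thesis by (simp add: Bij_def \<phi>_def)
  qed
  have au: "\<phi> k \<in> auto (integer_mod_group m)" for k
  proof -
    have "\<phi> k \<in> hom (integer_mod_group m) (integer_mod_group m)"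
    proof (rule homI)
      fix x y assume "x \<in> ?Z" "y \<in> ?Z"
      moreover have "(x + y) mod int m \<in> ?Z" using m by (simp add: Z)
      ultimately show "\<phi> k (x \<otimes>\<^bsub>integer_mod_group m\<^esub> y)
          = \<phi> k x \<otimes>\<^bsub>integer_mod_group m\<^esub> \<phi> k y"
        using m
        by (simp add: \<phi>_def mult_integer_mod_group mod_mult_right_eq mod_add_eq distrib_left)
    qed (rule maps)
    thus ?thesis using bij by (simp add: auto_def)
  qed
  have "(\<lambda>h. \<phi> (nat h)) \<in> hom (integer_mod_group r) (AutoGroup (integer_mod_group m))"
  proof (rule homI)
    fix x y assume "x \<in> carrier (integer_mod_group r)" "y \<in> carrier (integer_mod_group r)"
    hence "nat (x \<otimes>\<^bsub>integer_mod_group r\<^esub> y) = (nat x + nat y) mod r"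
      using r by (auto simp: carrier_integer_mod_group mult_integer_mod_group nat_add_distrib
          nat_mod_distrib)
    thus "\<phi> (nat (x \<otimes>\<^bsub>integer_mod_group r\<^esub> y))
        = \<phi> (nat x) \<otimes>\<^bsub>AutoGroup (integer_mod_group m)\<^esub> \<phi> (nat y)"
      using bij by (simp add: per comp AutoGroup_def BijGroup_def)
  qed (simp add: au AutoGroup_def)
  thus ?thesis by (simp add: \<phi>_def)
qed

lemma group_Frob21: "group Frob21"
proof -
  have "(2::int) ^ 3 mod int 7 = 1 mod int 7" by simp
  from mult_mod_in_hom_AutoGroup[OF _ _ this] show ?thesis
    unfolding Frob21_def by (intro group_semidirect_product) simp_all
qed

lemma group_D10: "group D10"
proof -
  have "(- 1::int) ^ 2 mod int 5 = 1 mod int 5" by simp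
  from mult_mod_in_hom_AutoGroup[OF _ _ this] show ?thesis
    unfolding D10_def by (intro group_semidirect_product) simp_all
qed

lemma order_Frob21: "order Frob21 = 21"
  by (simp add: order_def Frob21_def semidirect_product_def carrier_integer_mod_group
      card_cartesian_product)

lemma order_D10: "order D10 = 10"
  by (simp add: order_def D10_def semidirect_product_def carrier_integer_mod_group
      card_cartesian_product)

lemma Frob21_nonabelian: "\<not> comm_group Frob21"
proof
  assume "comm_group Frob21"
  then interpret comm_group Frob21 .
  have "(0, 1) \<otimes>\<^bsub>Frob21\<^esub> (1, 0) = (1, 0) \<otimes>\<^bsub>Frob21\<^esub> (0, 1)"
    by (rule m_comm)
       (auto simp: Frob21_def semidirect_product_def carrier_integer_mod_group)
  thus False
    by (simp add: Frob21_def semidirect_product_def carrier_integer_mod_group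
        mult_integer_mod_group)
qed

lemma D10_nonabelian: "\<not> comm_group D10"
proof
  assume "comm_group D10"
  then interpret comm_group D10 .
  have "(0, 1) \<otimes>\<^bsub>D10\<^esub> (1, 0) = (1, 0) \<otimes>\<^bsub>D10\<^esub> (0, 1)"
    by (rule m_comm)
       (auto simp: D10_def semidirect_product_def carrier_integer_mod_group)
  thus False
    by (simp add: D10_def semidirect_product_def carrier_integer_mod_group
        mult_integer_mod_group)
qed

end

theory Submission
  imports Defs "HOL-Algebra.Group_Action" "HOL-Algebra.Sylow" "HOL-Algebra.Multiplicative_Group"
    "Jordan_Normal_Form.Determinant"
begin

text \<open>
  A block \<open>B\<close> fixed by a group of prime order \<open>p\<close> determines the number of fixed points, because the
  other blocks correspond to the pairs of points of \<open>B\<close>; a block that is not fixed contains at most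
  two fixed points, so counting flags leaves very few possibilities. They give the bounds on the
  Sylow subgroups and exclude elements of order 35, 21 and 10.
  Elements of order 11 and 13 act on the rational functions that are constant on their orbits,
  where \<open>\<Sum>\<^sub>b (\<Sum>\<^sub>p\<^sub>\<in>\<^sub>b x\<^sub>p)\<^sup>2 = 14 \<Sum>\<^sub>p x\<^sub>p\<^sup>2 + 2 (\<Sum>\<^sub>p x\<^sub>p)\<^sup>2\<close> leads, as in the Bruck--Ryser theorem,
  to a quadratic equation without solutions modulo 7.
  In a dihedral group of order 14 the functions that are invariant under the rotations and negated by
  a reflection carry a similitude with factor 14 in odd dimension, whose determinant is not a square.
  In a cyclic group of order 14 the blocks fixed by the involution \<open>g\<close> carry too few distinct
  patterns of fixed points: the binary code of the blocks would have at least \<open>2\<^sup>6\<^sup>3\<close> words, although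
  it is contained in its dual code of length 121.
\<close>


hide_const (open) Polynomial.order
hide_fact (open) Polynomial.order_def

section \<open>Biplanes with 121 points\<close>

text \<open>Counting alone falls short in three places. An element of order 11 fixes no block, and
  since 11 divides 121 this is no contradiction. Order 13 passes the counts, with four fixed points,
  three of them on each fixed block. An involution may have 9 = 2 + 7 fixed points, which fits an
  element of order 7 that commutes with it. What is left to exploit is the factor 14 in A^T A = 14 I
  + 2 J, with A the incidence matrix. It contains 7 exactly once, which drives the descent modulo 7.
  It contains 2 exactly once, which gives an odd exponent of 2 in a determinant of odd size, and
  allows the equation to be halved and then inverted modulo 2. The constant of the code argument
  comes from 121 = 9 + 2 * 56: the involution leaves 2 ^ 65 sets of points invariant, the patterns
  of dual words on its nine fixed points cost at most a factor 4, and a code contained in its dual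
  has at most 2 ^ 60 words.\<close>

lemma sum_card_swap:
  assumes "finite A" "finite B"
  shows "(\<Sum>a\<in>A. card {b\<in>B. R a b}) = (\<Sum>b\<in>B. card {a\<in>A. R a b})"
proof -
  have "(\<Sum>a\<in>A. card {b\<in>B. R a b}) = (\<Sum>a\<in>A. \<Sum>b\<in>B. if R a b then 1 else 0)"
    using assms by (simp add: sum.If_cases Int_def)
  also have "\<dots> = (\<Sum>b\<in>B. \<Sum>a\<in>A. if R a b then 1 else 0)" by (rule sum.swap)
  also have "\<dots> = (\<Sum>b\<in>B. card {a\<in>A. R a b})"
    using assms by (simp add: sum.If_cases Int_def)
  finally show ?thesis .
qed

text \<open>If r blocks pass through x, counting the further points on them gives 15 r = 2 * 120.
  For the intersections with a given block \<open>S i\<close>, the first two moments are 256 and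
  736; without the term of the block itself they are 240 and 480, so the sum of
  \<open>(m k - 2)^2\<close> is 480 - 4 * 240 + 4 * 120 = 0. Blocks enter through an index set
  because a priori two of them might have the same points.\<close>

lemma biplane_dual:
  fixes S :: "'b \<Rightarrow> 'p set"
  assumes finP: "finite P" and cardP: "card P = 121" and finJ: "finite J" and cardJ: "card J = 121"
    and sub: "\<And>j. j \<in> J \<Longrightarrow> S j \<subseteq> P" and c16: "\<And>j. j \<in> J \<Longrightarrow> card (S j) = 16"
    and two: "\<And>x y. x \<in> P \<Longrightarrow> y \<in> P \<Longrightarrow> x \<noteq> y \<Longrightarrow> card {j \<in> J. x \<in> S j \<and> y \<in> S j} = 2"
  shows "x \<in> P \<Longrightarrow> card {j \<in> J. x \<in> S j} = 16"
    and "i \<in> J \<Longrightarrow> j \<in> J \<Longrightarrow> i \<noteq> j \<Longrightarrow> card (S i \<inter> S j) = 2"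
proof -
  have finS: "finite (S j)" if "j \<in> J" for j using sub[OF that] finP finite_subset by blast
  have r: "card {j \<in> J. x \<in> S j} = 16" if x: "x \<in> P" for x
  proof -
    let ?J = "{j \<in> J. x \<in> S j}"
    have "(\<Sum>y\<in>P - {x}. card {j\<in>?J. y \<in> S j}) = (\<Sum>j\<in>?J. card {y\<in>P - {x}. y \<in> S j})"
      by (rule sum_card_swap) (use finP finJ in auto)
    moreover have "card {j\<in>?J. y \<in> S j} = 2" if "y \<in> P - {x}" for y
      using two[of x y] that x by auto
    moreover have "card {y\<in>P - {x}. y \<in> S j} = 15" if "j \<in> ?J" for j
    proof -
      have "{y\<in>P - {x}. y \<in> S j} = S j - {x}" using sub that by auto
      thus ?thesis using that c16[of j] finS by simp
    qed
    ultimately have "2 * card (P - {x}) = 15 * card ?J" by (simp add: mult.commute)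
    thus ?thesis using x finP cardP by simp
  qed
  show "x \<in> P \<Longrightarrow> card {j \<in> J. x \<in> S j} = 16" by (rule r)
  assume i: "i \<in> J" and j: "j \<in> J" "i \<noteq> j"
  let ?J = "J - {i}"
  define m where "m k = card (S i \<inter> S k)" for k
  have mi: "m i = 16" using c16[OF i] by (simp add: m_def)
  have Pi: "x \<in> P" if "x \<in> S i" for x using that sub[OF i] by auto
  have "(\<Sum>k\<in>J. card {x\<in>S i. x \<in> S k}) = (\<Sum>x\<in>S i. card {k\<in>J. x \<in> S k})"
    by (rule sum_card_swap) (use finJ finS i in auto)
  hence m1: "(\<Sum>k\<in>J. m k) = 256" using c16[OF i] r[OF Pi] by (simp add: m_def Int_def)
  have "(\<Sum>k\<in>J. card {z\<in>S i \<times> S i. fst z \<in> S k \<and> snd z \<in> S k})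
      = (\<Sum>z\<in>S i \<times> S i. card {k\<in>J. fst z \<in> S k \<and> snd z \<in> S k})"
    by (rule sum_card_swap) (use finJ finS i in auto)
  also have "\<dots> = (\<Sum>(x, y)\<in>S i \<times> S i. 2 + (if x = y then 14 else 0))"
  proof (rule sum.cong[OF refl], clarify)
    fix x y assume "x \<in> S i" "y \<in> S i"
    hence "x \<in> P" "y \<in> P" using Pi by auto
    thus "card {k\<in>J. fst (x, y) \<in> S k \<and> snd (x, y) \<in> S k} = 2 + (if x = y then 14 else 0)"
      using two[of x y] r[of x] by (cases "x = y") auto
  qed
  also have "\<dots> = (\<Sum>x\<in>S i. \<Sum>y\<in>S i. 2 + (if x = y then 14 else 0))" by (rule sum.cartesian_product[symmetric])
  \<comment> \<open>For each x the 16 points y contribute 2 each, and y = x contributes 14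
    more.\<close>
  also have "\<dots> = (\<Sum>x\<in>S i. 46)"
    by (rule sum.cong[OF refl], subst sum.distrib) (use finS[OF i] c16[OF i] in simp)
  also have "\<dots> = 736" using c16[OF i] by simp
  finally have "(\<Sum>k\<in>J. card {z\<in>S i \<times> S i. fst z \<in> S k \<and> snd z \<in> S k}) = 736" .
  moreover have "{z\<in>S i \<times> S i. fst z \<in> S k \<and> snd z \<in> S k} = (S i \<inter> S k) \<times> (S i \<inter> S k)" for k by auto
  ultimately have m2: "(\<Sum>k\<in>J. m k * m k) = 736" by (simp add: m_def card_cartesian_product)
  have fJ: "finite ?J" using finJ by simp
  have "(\<Sum>k\<in>?J. (int (m k) - 2)^2) = (\<Sum>k\<in>?J. int (m k * m k) - 4 * int (m k) + 4)"
    by (rule sum.cong[OF refl]) (simp add: power2_eq_square algebra_simps)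
  also have "\<dots> = int (\<Sum>k\<in>?J. m k * m k) - 4 * int (\<Sum>k\<in>?J. m k) + 4 * int (card ?J)"
    by (simp add: sum.distrib sum_subtractf sum_distrib_left)
  also have "\<dots> = 0"
    using m1 m2 mi i cardJ unfolding sum.remove[OF finJ i] by (simp add: finJ)
  finally have "\<forall>k\<in>?J. (int (m k) - 2)^2 = 0" using fJ by (subst (asm) sum_nonneg_eq_0_iff) auto
  thus "card (S i \<inter> S j) = 2" using j by (auto simp: m_def)
qed

text \<open>Blocks are identified with their point sets; the axioms are self-dual.\<close>

locale biplane121 =
  fixes P :: "'p set" and BB :: "'p set set"
  assumes card_points: "card P = 121" and card_blocks: "card BB = 121"
    and block_subset: "b \<in> BB \<Longrightarrow> b \<subseteq> P"
    and block_card: "b \<in> BB \<Longrightarrow> card b = 16"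
    and point_card: "x \<in> P \<Longrightarrow> card {b \<in> BB. x \<in> b} = 16"
    and two_points: "x \<in> P \<Longrightarrow> y \<in> P \<Longrightarrow> x \<noteq> y \<Longrightarrow> card {b \<in> BB. x \<in> b \<and> y \<in> b} = 2"
    and two_blocks: "b \<in> BB \<Longrightarrow> c \<in> BB \<Longrightarrow> b \<noteq> c \<Longrightarrow> card (b \<inter> c) = 2"
begin

lemma finite_points [simp]: "finite P" and finite_blocks [simp]: "finite BB"
  using card_points card_blocks by (auto intro: card_ge_0_finite)

lemma finite_block: "b \<in> BB \<Longrightarrow> finite b"
  using block_card by (auto intro: card_ge_0_finite)

lemma common_blocks_card:
  "x \<in> P \<Longrightarrow> y \<in> P \<Longrightarrow> card {b \<in> BB. x \<in> b \<and> y \<in> b} = (if x = y then 16 else 2)"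
  using point_card two_points by auto

lemma common_points_card:
  "b \<in> BB \<Longrightarrow> c \<in> BB \<Longrightarrow> card (b \<inter> c) = (if b = c then 16 else 2)"
  using block_card two_blocks by auto

lemma three_blocks:
  assumes "x \<in> P" "y \<in> P" "x \<noteq> y" "b \<in> BB" "c \<in> BB" "d \<in> BB"
    "{x, y} \<subseteq> b" "{x, y} \<subseteq> c" "{x, y} \<subseteq> d"
  shows "b = c \<or> c = d \<or> b = d"
proof (rule ccontr)
  assume "\<not> ?thesis"
  hence "card {b, c, d} = 3" by auto
  moreover have "{b, c, d} \<subseteq> {b \<in> BB. x \<in> b \<and> y \<in> b}" using assms by auto
  hence "card {b, c, d} \<le> 2" using two_points[OF assms(1-3)] card_mono[of "{b \<in> BB. x \<in> b \<and> y \<in> b}"]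
    by fastforce
  ultimately show False by simp
qed

text \<open>The bilinear form of A^T A = 14 I + 2 J: a point lies on 16 = 14 + 2 blocks, two points
  on 2. The ring is arbitrary because the Bruck-Ryser argument needs rationals, while determinants
  and parities need integers.\<close>

lemma block_form:
  fixes x y :: "'p \<Rightarrow> 'r::comm_ring_1"
  shows "(\<Sum>b\<in>BB. (\<Sum>p\<in>b. x p) * (\<Sum>p\<in>b. y p)) = 14 * (\<Sum>p\<in>P. x p * y p) + 2 * (\<Sum>p\<in>P. x p) * (\<Sum>p\<in>P. y p)"
proof -
  have "(\<Sum>b\<in>BB. (\<Sum>p\<in>b. x p) * (\<Sum>p\<in>b. y p))
      = (\<Sum>b\<in>BB. \<Sum>p\<in>P. \<Sum>q\<in>P. if p \<in> b \<and> q \<in> b then x p * y q else 0)"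
  proof (rule sum.cong[OF refl])
    fix b assume b: "b \<in> BB"
    have *: "(\<Sum>p\<in>b. f p) = (\<Sum>p\<in>P. if p \<in> b then f p else 0)" for f :: "'p \<Rightarrow> 'r"
      using block_subset[OF b] by (simp add: sum.If_cases Int_absorb1)
    show "(\<Sum>p\<in>b. x p) * (\<Sum>p\<in>b. y p) = (\<Sum>p\<in>P. \<Sum>q\<in>P. if p \<in> b \<and> q \<in> b then x p * y q else 0)"
      unfolding * sum_product by (intro sum.cong refl) auto
  qed
  also have "\<dots> = (\<Sum>p\<in>P. \<Sum>q\<in>P. \<Sum>b\<in>BB. if p \<in> b \<and> q \<in> b then x p * y q else 0)"
    by (subst sum.swap) (intro sum.cong refl sum.swap)
  also have "\<dots> = (\<Sum>p\<in>P. \<Sum>q\<in>P. 2 * (x p * y q) + (if p = q then 14 * (x p * y q) else 0))"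
  proof (intro sum.cong refl)
    fix p q assume pq: "p \<in> P" "q \<in> P"
    have "(\<Sum>b\<in>BB. if p \<in> b \<and> q \<in> b then x p * y q else 0) = of_nat (card {b \<in> BB. p \<in> b \<and> q \<in> b}) * (x p * y q)"
      by (simp add: sum.If_cases Int_def)
    thus "(\<Sum>b\<in>BB. if p \<in> b \<and> q \<in> b then x p * y q else 0) = 2 * (x p * y q) + (if p = q then 14 * (x p * y q) else 0)"
      using common_blocks_card[OF pq] by (simp flip: distrib_right)
  qed
  also have "\<dots> = 14 * (\<Sum>p\<in>P. x p * y p) + 2 * (\<Sum>p\<in>P. x p) * (\<Sum>p\<in>P. y p)"
    by (simp add: sum.distrib sum_product mult.assoc flip: sum_distrib_left)
  finally show ?thesis .
qed

text \<open>\<open>block_form\<close> with the indicator of p as one argument, that is, row p of the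
  matrix equation.\<close>

lemma point_form:
  fixes y :: "'p \<Rightarrow> 'r::comm_ring_1"
  assumes "p \<in> P"
  shows "(\<Sum>b\<in>{b\<in>BB. p \<in> b}. \<Sum>q\<in>b. y q) = 14 * y p + 2 * (\<Sum>q\<in>P. y q)"
proof -
  have one: "(\<Sum>q\<in>b. if q = p then 1 else 0) = (if p \<in> b then 1 else 0 :: 'r)" if "finite b" for b
    using that by simp
  have "(\<Sum>b\<in>{b\<in>BB. p \<in> b}. \<Sum>q\<in>b. y q) = (\<Sum>b\<in>BB. if p \<in> b then \<Sum>q\<in>b. y q else 0)"
    by (rule sum.inter_filter) simp
  also have "\<dots> = (\<Sum>b\<in>BB. (\<Sum>q\<in>b. if q = p then 1 else 0) * (\<Sum>q\<in>b. y q))"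
    by (intro sum.cong refl) (simp only: one[OF finite_block] if_distrib[of "\<lambda>u. u * _"], simp)
  also have "\<dots> = 14 * (\<Sum>q\<in>P. (if q = p then 1 else 0) * y q)
      + 2 * (\<Sum>q\<in>P. if q = p then 1 else 0) * (\<Sum>q\<in>P. y q)"
    by (rule block_form)
  also have "(\<Sum>q\<in>P. (if q = p then 1 else 0) * y q) = (\<Sum>q\<in>P. if q = p then y q else 0)"
    by (rule sum.cong) auto
  also have "\<dots> = y p" using assms by simp
  also have "(\<Sum>q\<in>P. if q = p then 1 else 0) = (1 :: 'r)" using assms by simp
  finally have "(\<Sum>b\<in>{b\<in>BB. p \<in> b}. \<Sum>q\<in>b. y q) = 14 * y p + 2 * 1 * (\<Sum>q\<in>P. y q)" .
  thus ?thesis by simp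
qed

end

section \<open>Finite group actions\<close>

lemma (in group) subgroup_of_prime_power_order:
  assumes "finite (carrier G)" "subgroup H G" "prime p" "p ^ k dvd card H"
  obtains K where "subgroup K G" "K \<subseteq> H" "card K = p ^ k"
proof -
  let ?H = "G\<lparr>carrier := H\<rparr>"
  have grp: "group ?H" using assms(2) by (rule subgroup_imp_group)
  have fin: "finite H" using assms(1,2) finite_subset subgroup.subset by blast
  obtain m where "order ?H = p ^ k * m" using assms(4) by (auto simp: order_def dvd_def)
  then obtain K where K: "subgroup K ?H" "card K = p ^ k"
    using sylow_thm[OF assms(3) grp] fin by auto
  from that[OF incl_subgroup[OF assms(2) K(1)] _ K(2)] show thesis
    using subgroup.subset[OF K(1)] by simp
qed

lemma (in group) card_subgroup_dvd:
  assumes "subgroup H G" "subgroup K G" "K \<subseteq> H"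
  shows "card K dvd card H"
proof -
  let ?H = "G\<lparr>carrier := H\<rparr>"
  interpret H: group ?H using assms(1) by (rule subgroup_imp_group)
  have "subgroup K ?H" using assms by (simp add: subgroup_incl)
  from H.lagrange[OF this] have "card (rcosets\<^bsub>?H\<^esub> K) * card K = card H" by (simp add: order_def)
  thus ?thesis by (metis dvd_triv_right)
qed

lemma prime_power_trivial_or_dvd:
  fixes p :: nat
  assumes "prime p" "n dvd p ^ a"
  shows "n = 1 \<or> p dvd n"
proof -
  obtain i where "n = p ^ i" using assms by (auto simp: divides_primepow_nat)
  thus ?thesis by (cases i) auto
qed

text \<open>The maps \<open>act g\<close> need not be extensional, so one function serves for the
  points and, through its image map, for the blocks. Orbits, stabilizers and fixed sets take a
  subset of the group as argument because several subgroups of one group are compared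
  throughout.\<close>

locale fin_action = group G for G (structure) +
  fixes E :: "'e set" and act :: "'a \<Rightarrow> 'e \<Rightarrow> 'e"
  assumes finite_carrier: "finite (carrier G)" and finite_E: "finite E"
    and act_closed: "g \<in> carrier G \<Longrightarrow> x \<in> E \<Longrightarrow> act g x \<in> E"
    and act_one: "x \<in> E \<Longrightarrow> act \<one> x = x"
    and act_mult: "g \<in> carrier G \<Longrightarrow> h \<in> carrier G \<Longrightarrow> x \<in> E \<Longrightarrow> act (g \<otimes> h) x = act g (act h x)"
begin

definition orb :: "'a set \<Rightarrow> 'e \<Rightarrow> 'e set" where "orb H x = (\<lambda>g. act g x) ` H"
definition stab :: "'a set \<Rightarrow> 'e \<Rightarrow> 'a set" where "stab H x = {g \<in> H. act g x = x}"
definition fixed :: "'a set \<Rightarrow> 'e set" where "fixed H = {x \<in> E. \<forall>g\<in>H. act g x = x}"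
definition invariant :: "'a set \<Rightarrow> 'e set \<Rightarrow> bool" where
  "invariant H A \<longleftrightarrow> A \<subseteq> E \<and> (\<forall>g\<in>H. \<forall>x\<in>A. act g x \<in> A)"

lemma act_inv:
  assumes "g \<in> carrier G" "x \<in> E"
  shows "act (inv g) (act g x) = x" "act g (act (inv g) x) = x"
  using assms act_mult[of "inv g" g x] act_mult[of g "inv g" x] act_one by auto

lemma act_inj: "g \<in> carrier G \<Longrightarrow> x \<in> E \<Longrightarrow> y \<in> E \<Longrightarrow> act g x = act g y \<Longrightarrow> x = y"
  by (metis act_inv(1))

lemma act_eq_iff_inv: "g \<in> carrier G \<Longrightarrow> x \<in> E \<Longrightarrow> act (inv g) x = x \<longleftrightarrow> act g x = x"
  by (metis act_inv)

lemma act_bij: "g \<in> carrier G \<Longrightarrow> bij_betw (act g) E E"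
  by (rule bij_betw_byWitness[where f' = "act (inv g)"]) (auto simp: act_inv act_closed)

lemma fixed_subset: "fixed H \<subseteq> E" and fixed_antimono: "K \<subseteq> H \<Longrightarrow> fixed H \<subseteq> fixed K"
  by (auto simp: fixed_def)

lemma finite_fixed [simp]: "finite (fixed H)"
  using fixed_subset finite_E finite_subset by blast

lemma finite_invariant: "invariant H A \<Longrightarrow> finite A"
  using finite_E finite_subset by (auto simp: invariant_def)

lemma invariant_E: "subgroup H G \<Longrightarrow> invariant H E"
  using subgroup.subset by (fastforce simp: invariant_def act_closed)

lemma finite_subgroup: "subgroup H G \<Longrightarrow> finite H"
  using finite_carrier finite_subset subgroup.subset by blast

lemma card_invariant:
  "invariant H A \<Longrightarrow> card A = card (A \<inter> fixed H) + card (A - fixed H)"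
  by (metis card_Diff_subset_Int card_mono finite_Int finite_invariant inf_le1 le_add_diff_inverse)

lemma stab_subgroup:
  assumes "subgroup H G" "x \<in> E"
  shows "subgroup (stab H x) G"
proof (rule subgroupI)
  note s = subgroup.mem_carrier[OF assms(1)]
  show "stab H x \<subseteq> carrier G" using s by (auto simp: stab_def)
  have "\<one> \<in> stab H x" using assms subgroup.one_closed act_one by (auto simp: stab_def)
  thus "stab H x \<noteq> {}" by auto
  show "inv a \<in> stab H x" if "a \<in> stab H x" for a
    using that s assms subgroup.m_inv_closed[OF assms(1)] by (auto simp: stab_def act_eq_iff_inv)
  show "a \<otimes> b \<in> stab H x" if "a \<in> stab H x" "b \<in> stab H x" for a b
    using that s assms subgroup.m_closed[OF assms(1)] by (auto simp: stab_def act_mult)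
qed

lemma stab_subset: "stab H x \<subseteq> H" by (auto simp: stab_def)

lemma orbit_stabilizer:
  assumes "subgroup H G" "x \<in> E"
  shows "card (orb H x) * card (stab H x) = card H"
proof -
  let ?H = "G\<lparr>carrier := H\<rparr>" and ?\<phi> = "\<lambda>g. restrict (act g) E"
  note s = subgroup.mem_carrier[OF assms(1)]
  have bij: "?\<phi> g \<in> Bij E" if "g \<in> carrier G" for g
    using act_bij[OF that] by (auto simp: Bij_def intro: bij_betw_cong[THEN iffD1])
  have "?\<phi> \<in> hom ?H (BijGroup E)"
  proof (rule homI)
    fix g h assume gh: "g \<in> carrier ?H" "h \<in> carrier ?H"
    hence "?\<phi> (g \<otimes> h) = compose E (?\<phi> g) (?\<phi> h)"
      using s by (auto simp: compose_def act_mult act_closed fun_eq_iff restrict_def)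
    thus "?\<phi> (g \<otimes>\<^bsub>?H\<^esub> h) = ?\<phi> g \<otimes>\<^bsub>BijGroup E\<^esub> ?\<phi> h"
      using gh bij s by (simp add: BijGroup_def)
  qed (use bij s in \<open>auto simp: BijGroup_def\<close>)
  then interpret A: group_action ?H E ?\<phi>
    using assms(1) by (simp add: group_action_def group_hom_def group_hom_axioms_def subgroup_imp_group group_BijGroup)
  have "Group_Action.orbit ?H ?\<phi> x = orb H x"
    using assms(2) by (auto simp: Group_Action.orbit_def orb_def)
  moreover have "Group_Action.stabilizer ?H ?\<phi> x = stab H x"
    using assms(2) by (auto simp: Group_Action.stabilizer_def stab_def)
  ultimately show ?thesis using A.orbit_stabilizer_theorem[OF assms(2)] by (simp add: order_def)
qed

lemma self_in_orb: "subgroup H G \<Longrightarrow> x \<in> E \<Longrightarrow> x \<in> orb H x"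
  unfolding orb_def using subgroup.one_closed act_one by (metis image_eqI)

lemma orb_subset: "invariant H A \<Longrightarrow> x \<in> A \<Longrightarrow> orb H x \<subseteq> A"
  by (auto simp: invariant_def orb_def)

lemma orb_eq:
  assumes "subgroup H G" "x \<in> E" "y \<in> orb H x"
  shows "orb H y = orb H x"
proof -
  note s = subgroup.mem_carrier[OF assms(1)]
  obtain g where g: "g \<in> H" "y = act g x" using assms(3) by (auto simp: orb_def)
  show ?thesis
  proof
    show "orb H y \<subseteq> orb H x"
    proof
      fix z assume "z \<in> orb H y"
      then obtain h where "h \<in> H" "z = act h y" by (auto simp: orb_def)
      hence "z = act (h \<otimes> g) x" "h \<otimes> g \<in> H"
        using g s assms by (auto simp: act_mult subgroup.m_closed)
      thus "z \<in> orb H x" by (auto simp: orb_def)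
    qed
    show "orb H x \<subseteq> orb H y"
    proof
      fix z assume "z \<in> orb H x"
      then obtain h where h: "h \<in> H" "z = act h x" by (auto simp: orb_def)
      have "act (h \<otimes> inv g) y = z"
        using h g s assms by (simp add: act_mult act_inv act_closed)
      moreover have "h \<otimes> inv g \<in> H"
        using h g assms by (simp add: subgroup.m_closed subgroup.m_inv_closed)
      ultimately show "z \<in> orb H y" by (auto simp: orb_def)
    qed
  qed
qed

lemma orb_disjoint:
  assumes "subgroup H G" "x \<in> E" "y \<in> E" "orb H x \<noteq> orb H y"
  shows "orb H x \<inter> orb H y = {}"
  using assms orb_eq by blast

lemma orb_fixed_iff:
  assumes "subgroup H G" "x \<in> E"
  shows "x \<in> fixed H \<longleftrightarrow> card (orb H x) = 1"
proof
  assume "x \<in> fixed H"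
  hence "orb H x = {x}" using self_in_orb[OF assms] by (auto simp: orb_def fixed_def)
  thus "card (orb H x) = 1" by simp
next
  assume "card (orb H x) = 1"
  then obtain y where "orb H x = {y}" by (auto simp: card_1_singleton_iff)
  thus "x \<in> fixed H" using self_in_orb[OF assms] assms(2) by (auto simp: orb_def fixed_def)
qed

lemma invariant_nonfixed:
  assumes "subgroup H G" "invariant H A"
  shows "invariant H (A - fixed H)"
proof -
  have "act g x \<notin> fixed H" if "g \<in> H" "x \<in> A - fixed H" for g x
  proof
    assume f: "act g x \<in> fixed H"
    have x: "x \<in> E" and g: "g \<in> carrier G"
      using that assms subgroup.mem_carrier by (fastforce simp: invariant_def)+
    have "act (inv g) (act g x) = act g x"
      using f subgroup.m_inv_closed[OF assms(1) that(1)] by (auto simp: fixed_def)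
    hence "act g x = x" using act_inv(1)[OF g x] by simp
    thus False using f that by simp
  qed
  thus ?thesis using assms(2) by (auto simp: invariant_def)
qed

lemma card_nonfixed_dvd:
  assumes "subgroup H G" "invariant H A"
    and "\<And>x. x \<in> A - fixed H \<Longrightarrow> m dvd card (orb H x)"
  shows "m dvd card (A - fixed H)"
proof -
  let ?A = "A - fixed H"
  have inv: "invariant H ?A" using assms(1,2) by (rule invariant_nonfixed)
  have sub: "?A \<subseteq> E" using inv by (auto simp: invariant_def)
  have "\<Union> (orb H ` ?A) = ?A"
    using orb_subset[OF inv] self_in_orb[OF assms(1)] sub by blast
  moreover have "m dvd card (\<Union> (orb H ` ?A))"
  proof (rule dvd_partition)
    show "finite (\<Union> (orb H ` ?A))" using calculation finite_invariant[OF inv] by simp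
    show "\<forall>c\<in>orb H ` ?A. m dvd card c" using assms(3) by blast
    show "\<forall>c1\<in>orb H ` ?A. \<forall>c2\<in>orb H ` ?A. c1 \<noteq> c2 \<longrightarrow> c1 \<inter> c2 = {}"
      using orb_disjoint[OF assms(1)] sub by blast
  qed
  ultimately show ?thesis by simp
qed

lemma orb_card_dvd: "subgroup H G \<Longrightarrow> x \<in> E \<Longrightarrow> card (orb H x) dvd card H"
  using orbit_stabilizer by (metis dvd_triv_left)

lemma p_group_nonfixed:
  assumes "subgroup H G" "prime p" "card H = p ^ a" "invariant H A"
  shows "p dvd card (A - fixed H)"
proof (rule card_nonfixed_dvd[OF assms(1,4)])
  fix x assume x: "x \<in> A - fixed H"
  hence E: "x \<in> E" using assms(4) by (auto simp: invariant_def)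
  show "p dvd card (orb H x)"
    using prime_power_trivial_or_dvd[OF assms(2), of "card (orb H x)" a]
      orb_card_dvd[OF assms(1) E] orb_fixed_iff[OF assms(1) E] assms(3) x by auto
qed

text \<open>A nontrivial stabilizer in H of a point x that H moves contains a subgroup of order p.
  It fixes x in addition to all points fixed by H, against the bound. Hence H acts semiregularly on
  the points that it moves.\<close>

lemma p_group_semiregular:
  assumes H: "subgroup H G" "prime p" "card H = p ^ a" "invariant H A"
    and le: "\<And>K. subgroup K G \<Longrightarrow> K \<subseteq> H \<Longrightarrow> card K = p \<Longrightarrow> card (A \<inter> fixed K) \<le> card (A \<inter> fixed H)"
  shows "card H dvd card (A - fixed H)"
proof (rule card_nonfixed_dvd[OF H(1,4)])
  fix x assume x: "x \<in> A - fixed H"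
  hence E: "x \<in> E" using H(4) by (auto simp: invariant_def)
  note os = orbit_stabilizer[OF H(1) E]
  have "card (stab H x) = 1"
  proof (rule ccontr)
    assume "card (stab H x) \<noteq> 1"
    hence "p ^ 1 dvd card (stab H x)"
      using prime_power_trivial_or_dvd[OF H(2), of "card (stab H x)" a] os H(3)
      by (metis dvd_triv_right power_one_right)
    then obtain K where K: "subgroup K G" "K \<subseteq> stab H x" "card K = p ^ 1"
      using subgroup_of_prime_power_order[OF finite_carrier stab_subgroup[OF H(1) E] H(2)] by blast
    have KH: "K \<subseteq> H" using K(2) stab_subset by blast
    have "x \<in> fixed K" using K(2) E by (auto simp: fixed_def stab_def)
    hence "insert x (A \<inter> fixed H) \<subseteq> A \<inter> fixed K" using x fixed_antimono[OF KH] by blast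
    hence "card (insert x (A \<inter> fixed H)) \<le> card (A \<inter> fixed K)" by (intro card_mono) auto
    thus False using le[OF K(1) KH] K(3) x by auto
  qed
  thus "card H dvd card (orb H x)" using os by simp
qed

lemma prime_order_fixed:
  assumes "subgroup K G" "prime (card K)" "g \<in> K" "g \<noteq> \<one>" "x \<in> E" "act g x = x"
  shows "x \<in> fixed K"
proof -
  have "card (stab K x) dvd card K" using orbit_stabilizer[OF assms(1,5)] by (metis dvd_triv_right)
  moreover have "{\<one>, g} \<subseteq> stab K x"
    using assms act_one subgroup.one_closed by (auto simp: stab_def)
  hence "2 \<le> card (stab K x)"
    using card_mono[of "stab K x" "{\<one>, g}"] assms(4) finite_subgroup[OF stab_subgroup[OF assms(1,5)]] by auto
  ultimately have "card (stab K x) = card K" using assms(2) by (auto simp: prime_nat_iff)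
  hence "stab K x = K" using card_subset_eq[OF finite_subgroup[OF assms(1)] stab_subset] by blast
  thus ?thesis using assms(5) by (auto simp: stab_def fixed_def)
qed

lemma prime_order_orb:
  assumes "subgroup K G" "prime (card K)" "x \<in> E" "x \<notin> fixed K"
  shows "card (orb K x) = card K"
  using orb_card_dvd[OF assms(1,3)] orb_fixed_iff[OF assms(1,3)] assms(2,4) by (auto simp: prime_nat_iff)

end

lemma (in group) prime_order_nontrivial:
  assumes "subgroup K G" "prime (card K)"
  obtains g where "g \<in> K" "g \<noteq> \<one>" "g \<in> carrier G"
proof -
  have "\<not> K \<subseteq> {\<one>}"
    using assms(2) prime_ge_2_nat[OF assms(2)] card_mono[of "{\<one>}" K] by auto
  thus thesis using that subgroup.mem_carrier[OF assms(1)] by auto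
qed

lemma (in group) subgroup_pow_card:
  assumes "subgroup K G" "g \<in> K"
  shows "g [^] card K = \<one>"
proof -
  let ?K = "G\<lparr>carrier := K\<rparr>"
  interpret K: group ?K using assms(1) by (rule subgroup_imp_group)
  have "g [^]\<^bsub>?K\<^esub> order ?K = \<one>\<^bsub>?K\<^esub>" using K.pow_order_eq_1 assms(2) by simp
  thus ?thesis using nat_pow_consistent[of g "card K" K] by (simp add: order_def)
qed

lemma (in group) odd_subgroup_square:
  assumes "subgroup S G" "odd (card S)" "k \<in> S" "k \<otimes> k = \<one>"
  shows "k = \<one>"
proof -
  have k: "k \<in> carrier G" using subgroup.mem_carrier[OF assms(1,3)] .
  obtain m where m: "card S = 2 * m + 1" using assms(2) by (rule oddE)
  have "k [^] (2::nat) = \<one>" using assms(4) k by (simp add: numeral_2_eq_2)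
  hence "k [^] (2 * m) = \<one>" using k by (simp flip: nat_pow_pow)
  moreover have "k [^] card S = \<one>" by (rule subgroup_pow_card[OF assms(1,3)])
  ultimately show ?thesis using k by (simp add: m)
qed

section \<open>Fixed points of automorphisms of prime order\<close>

lemma strict_mono_choose_two: "m < n \<Longrightarrow> 2 \<le> n \<Longrightarrow> m choose 2 < n choose 2"
proof (induction n)
  case (Suc n)
  have "Suc n choose 2 = n + (n choose 2)" by (simp add: numeral_2_eq_2)
  thus ?case using Suc by (cases "m < n \<and> 2 \<le> n") (auto simp: less_Suc_eq le_Suc_eq numeral_2_eq_2)
qed simp

lemma le_4_cases: "(n::nat) \<le> 4 \<Longrightarrow> n \<in> {0,1,2,3,4}"
  by (simp, presburger)

lemma le_16_cases: "(n::nat) \<le> 16 \<Longrightarrow> 5 \<le> n \<Longrightarrow> n \<in> {5,6,7,8,9,10,11,12,13,14,15,16}"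
  by (simp, presburger)

lemma even_le_16_cases: "even (n::nat) \<Longrightarrow> n \<le> 16 \<Longrightarrow> n \<in> {0,2,4,6,8,10,12,14,16}"
  by (simp, presburger)

locale biplane_group = biplane121 P BB + group G + pt: fin_action G P act
  for P :: "'p set" and BB and G :: "('g, 'm) monoid_scheme" (structure) and act :: "'g \<Rightarrow> 'p \<Rightarrow> 'p" +
  assumes preserves: "g \<in> carrier G \<Longrightarrow> b \<in> BB \<Longrightarrow> act g ` b \<in> BB"
    and faithful: "g \<in> carrier G \<Longrightarrow> (\<And>x. x \<in> P \<Longrightarrow> act g x = x) \<Longrightarrow> g = \<one>"
begin

sublocale bl: fin_action G BB "\<lambda>g. image (act g)"
proof unfold_locales
  show "act \<one> ` b = b" if "b \<in> BB" for b
    using block_subset[OF that] pt.act_one by (force simp: image_iff)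
  show "act (g \<otimes> h) ` b = act g ` act h ` b" if "g \<in> carrier G" "h \<in> carrier G" "b \<in> BB" for g h b
    using that block_subset[OF that(3)] pt.act_mult by (force simp: image_iff)
qed (simp_all add: pt.finite_carrier preserves)

abbreviation nfix :: "'p set \<Rightarrow> 'g set \<Rightarrow> nat" where
  "nfix B K \<equiv> card (B \<inter> pt.fixed K)"

lemma act_mem_image_iff:
  assumes "g \<in> carrier G" "x \<in> P" "S \<subseteq> P"
  shows "act g x \<in> act g ` S \<longleftrightarrow> x \<in> S"
  using assms pt.act_inj by blast

lemma act_image_Int:
  assumes "g \<in> carrier G" "S \<subseteq> P" "T \<subseteq> P"
  shows "act g ` (S \<inter> T) = act g ` S \<inter> act g ` T"
  using assms pt.act_inj by blast

lemma card_act_image: "g \<in> carrier G \<Longrightarrow> S \<subseteq> P \<Longrightarrow> card (act g ` S) = card S"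
  by (meson card_image inj_on_def pt.act_inj subsetD)

text \<open>Count the pairs of a block b and a point x such that x and its preimage under g both lie
  on b. Summed over points or over blocks, the result is 2 * 121 plus 14 times the number of fixed
  elements, since the points counted for b form the intersection of b with its image. This replaces
  the usual comparison of traces of permutation matrices.\<close>

lemma card_fixed_points_eq_blocks:
  assumes g: "g \<in> carrier G"
  shows "card {x \<in> P. act g x = x} = card {b \<in> BB. act g ` b = b}"
proof -
  let ?F = "{x \<in> P. act g x = x}" and ?FB = "{b \<in> BB. act g ` b = b}"
  have sum_if: "(\<Sum>x\<in>A. if R x then 16 else 2) = 14 * card {x\<in>A. R x} + 2 * card A"
    if "finite A" for A :: "'x set" and R
  proof -
    have "(\<Sum>x\<in>A. if R x then 16 else (2::nat)) = (\<Sum>x\<in>A. (if R x then 14 else 0) + 2)"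
      by (intro sum.cong) auto
    also have "\<dots> = (\<Sum>x\<in>A. if R x then 14 else 0) + 2 * card A" by (subst sum.distrib) simp
    also have "(\<Sum>x\<in>A. if R x then 14 else 0) = 14 * card {x\<in>A. R x}"
      using that by (simp add: sum.If_cases Int_def)
    finally show ?thesis .
  qed
  have "(\<Sum>b\<in>BB. card {x\<in>P. x \<in> b \<and> act (inv g) x \<in> b}) = (\<Sum>x\<in>P. card {b\<in>BB. x \<in> b \<and> act (inv g) x \<in> b})"
    by (rule sum_card_swap) auto
  also have "\<dots> = (\<Sum>x\<in>P. if act g x = x then 16 else 2)"
  proof (rule sum.cong[OF refl])
    fix x assume x: "x \<in> P"
    have "act (inv g) x = x \<longleftrightarrow> act g x = x" using pt.act_eq_iff_inv g x by blast
    thus "card {b\<in>BB. x \<in> b \<and> act (inv g) x \<in> b} = (if act g x = x then 16 else 2)"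
      using common_blocks_card[OF x, of "act (inv g) x"] pt.act_closed[of "inv g" x] g x by auto
  qed
  also have "(\<Sum>b\<in>BB. card {x\<in>P. x \<in> b \<and> act (inv g) x \<in> b}) = (\<Sum>b\<in>BB. if act g ` b = b then 16 else 2)"
  proof (rule sum.cong[OF refl])
    fix b assume b: "b \<in> BB"
    have "act (inv g) x \<in> b \<longleftrightarrow> x \<in> act g ` b" if "x \<in> P" for x
      using act_mem_image_iff[OF g pt.act_closed[OF inv_closed[OF g] that] block_subset[OF b]]
        pt.act_inv(2)[OF g that] by simp
    hence "{x\<in>P. x \<in> b \<and> act (inv g) x \<in> b} = b \<inter> act g ` b"
      using block_subset[OF b] by blast
    thus "card {x\<in>P. x \<in> b \<and> act (inv g) x \<in> b} = (if act g ` b = b then 16 else 2)"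
      using common_points_card[OF b preserves[OF g b]] by auto
  qed
  finally show ?thesis using sum_if[of P "\<lambda>x. act g x = x"] sum_if[of BB "\<lambda>b. act g ` b = b"]
    by (simp add: card_points card_blocks)
qed

lemma prime_order_fixed_eq:
  assumes K: "subgroup K G" "prime (card K)" and g: "g \<in> K" "g \<noteq> \<one>"
  shows "pt.fixed K = {x \<in> P. act g x = x}" "bl.fixed K = {b \<in> BB. act g ` b = b}"
proof -
  show "pt.fixed K = {x \<in> P. act g x = x}"
    using pt.prime_order_fixed[OF K g] g unfolding pt.fixed_def by blast
  show "bl.fixed K = {b \<in> BB. act g ` b = b}"
    using bl.prime_order_fixed[OF K g] g unfolding bl.fixed_def by blast
qed

lemma card_fixed_eq:
  assumes "subgroup K G" "prime (card K)"
  shows "card (bl.fixed K) = card (pt.fixed K)"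
proof -
  obtain g where g: "g \<in> K" "g \<noteq> \<one>" "g \<in> carrier G" using prime_order_nontrivial[OF assms] .
  show ?thesis
    unfolding prime_order_fixed_eq[OF assms g(1,2)] using card_fixed_points_eq_blocks[OF g(3)] by simp
qed

lemma fixed_block_invariant: "B \<in> bl.fixed K \<Longrightarrow> pt.invariant K B"
  using block_subset by (auto simp: pt.invariant_def bl.fixed_def) (metis imageI)+

text \<open>Every other block is determined by its two points on \<open>B\<close>.\<close>

lemma card_fixed_blocks:
  assumes K: "subgroup K G" and B: "B \<in> bl.fixed K"
  shows "card (bl.fixed K) = 1 + card {s. s \<subseteq> B \<and> card s = 2 \<and> (\<forall>g\<in>K. act g ` s = s)}"
proof -
  let ?T = "{s. s \<subseteq> B \<and> card s = 2 \<and> (\<forall>g\<in>K. act g ` s = s)}"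
  have BB: "B \<in> BB" and Bf: "\<And>g. g \<in> K \<Longrightarrow> act g ` B = B" using B by (auto simp: bl.fixed_def)
  note s = subgroup.mem_carrier[OF K]
  have det: "b = c" if bc: "b \<in> BB - {B}" "c \<in> BB - {B}" "b \<inter> B = c \<inter> B" for b c
  proof -
    have "card (b \<inter> B) = 2" using two_blocks bc(1) BB by auto
    then obtain x y where xy: "b \<inter> B = {x, y}" "x \<noteq> y" by (auto simp: card_2_iff)
    have "x \<in> P" "y \<in> P" using xy block_subset[OF BB] by auto
    from three_blocks[OF this xy(2) BB, of b c] show "b = c" using xy bc by auto
  qed
  have "bij_betw (\<lambda>b. b \<inter> B) (bl.fixed K - {B}) ?T"
    unfolding bij_betw_def
  proof
    show "inj_on (\<lambda>b. b \<inter> B) (bl.fixed K - {B})"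
      by (rule inj_onI) (use det in \<open>auto simp: bl.fixed_def\<close>)
    show "(\<lambda>b. b \<inter> B) ` (bl.fixed K - {B}) = ?T"
    proof (intro equalityI subsetI)
      fix t assume "t \<in> (\<lambda>b. b \<inter> B) ` (bl.fixed K - {B})"
      then obtain b where b: "b \<in> BB" "b \<noteq> B" "\<And>g. g \<in> K \<Longrightarrow> act g ` b = b" "t = b \<inter> B"
        by (auto simp: bl.fixed_def)
      have "act g ` t = t" if "g \<in> K" for g
        using act_image_Int[OF s[OF that] block_subset[OF b(1)] block_subset[OF BB]] b(3,4) Bf that by simp
      thus "t \<in> ?T" using two_blocks[OF b(1) BB b(2)] b(4) by auto
    next
      fix t assume t: "t \<in> ?T"
      then obtain x y where xy: "t = {x, y}" "x \<noteq> y" by (auto simp: card_2_iff)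
      have xyP: "x \<in> P" "y \<in> P" using t xy block_subset[OF BB] by auto
      have "{b \<in> BB. x \<in> b \<and> y \<in> b} \<noteq> {B}"
      proof
        assume "{b \<in> BB. x \<in> b \<and> y \<in> b} = {B}"
        hence "card {b \<in> BB. x \<in> b \<and> y \<in> b} = 1" by simp
        thus False using two_points[OF xyP xy(2)] by simp
      qed
      moreover have "B \<in> {b \<in> BB. x \<in> b \<and> y \<in> b}" using t xy BB by simp
      ultimately obtain b where b: "b \<in> BB" "x \<in> b" "y \<in> b" "b \<noteq> B" by blast
      have "t \<subseteq> b \<inter> B" using b(2,3) t xy by simp
      moreover have "card t = card (b \<inter> B)" using two_blocks[OF b(1) BB b(4)] t by simp
      ultimately have bt: "b \<inter> B = t"
        using card_subset_eq[of "b \<inter> B" t] finite_block[OF BB] by simp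
      have "act g ` b = b" if g: "g \<in> K" for g
      proof (rule det)
        have "act g ` b \<inter> B = act g ` (b \<inter> B)"
          using act_image_Int[OF s[OF g] block_subset[OF b(1)] block_subset[OF BB]] Bf[OF g] by simp
        thus "act g ` b \<inter> B = b \<inter> B" using bt t g by simp
        have "act g ` b \<noteq> act g ` B" using bl.act_inj[OF s[OF g] b(1) BB] b(4) by auto
        thus "act g ` b \<in> BB - {B}" using preserves[OF s[OF g] b(1)] Bf[OF g] by auto
      qed (use b in auto)
      hence "b \<in> bl.fixed K - {B}" using b by (auto simp: bl.fixed_def)
      thus "t \<in> (\<lambda>b. b \<inter> B) ` (bl.fixed K - {B})" using bt by auto
    qed
  qed
  hence "card (bl.fixed K - {B}) = card ?T" by (rule bij_betw_same_card)
  moreover have "card (bl.fixed K) = 1 + card (bl.fixed K - {B})"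
    using card.remove[OF bl.finite_fixed B] by simp
  ultimately show ?thesis by simp
qed

text \<open>An orbit of length \<open>card K\<close> > 2 does not fit into a pair, so the invariant
  pairs counted by \<open>card_fixed_blocks\<close> are the pairs of fixed points on B.\<close>

lemma card_fixed_odd:
  assumes K: "subgroup K G" "prime (card K)" "card K \<noteq> 2" and B: "B \<in> bl.fixed K"
  shows "card (pt.fixed K) = 1 + (nfix B K choose 2)"
proof -
  have BB: "B \<in> BB" using B by (auto simp: bl.fixed_def)
  have "{s. s \<subseteq> B \<and> card s = 2 \<and> (\<forall>g\<in>K. act g ` s = s)} = {s. s \<subseteq> B \<inter> pt.fixed K \<and> card s = 2}"
  proof (intro Collect_cong iffI conjI)
    fix s assume s: "s \<subseteq> B \<and> card s = 2 \<and> (\<forall>g\<in>K. act g ` s = s)"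
    have sP: "s \<subseteq> P" using s block_subset[OF BB] by auto
    have "x \<in> pt.fixed K" if "x \<in> s" for x
    proof (rule ccontr)
      assume "x \<notin> pt.fixed K"
      hence "card (pt.orb K x) = card K" using pt.prime_order_orb[OF K(1,2)] that sP by auto
      moreover have "pt.orb K x \<subseteq> s" using that s by (auto simp: pt.orb_def)
      hence "card (pt.orb K x) \<le> 2" using card_mono[of s "pt.orb K x"] s card_ge_0_finite[of s] by auto
      ultimately show False using K(2,3) prime_ge_2_nat[OF K(2)] by auto
    qed
    thus "s \<subseteq> B \<inter> pt.fixed K" using s by auto
    show "card s = 2" using s by simp
  next
    fix s assume s: "s \<subseteq> B \<inter> pt.fixed K \<and> card s = 2"
    thus "s \<subseteq> B" "card s = 2" by auto
    show "\<forall>g\<in>K. act g ` s = s" using s by (force simp: pt.fixed_def)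
  qed
  thus ?thesis
    using card_fixed_blocks[OF K(1) B] card_fixed_eq[OF K(1,2)] n_subsets[of "B \<inter> pt.fixed K" 2] by simp
qed

text \<open>For an involution the invariant pairs on B are the pairs of fixed points together with
  the orbits of length 2, of which there are half as many as moved points.\<close>

lemma card_fixed_involution:
  assumes K: "subgroup K G" "card K = 2" and B: "B \<in> bl.fixed K"
  shows "card (pt.fixed K) = 1 + (nfix B K choose 2) + (16 - nfix B K) div 2"
    and "even (nfix B K)"
proof -
  have BB: "B \<in> BB" using B by (auto simp: bl.fixed_def)
  have p: "prime (card K)" using K(2) by simp
  let ?N = "B - pt.fixed K"
  have inv: "pt.invariant K ?N" using pt.invariant_nonfixed[OF K(1) fixed_block_invariant[OF B]] .
  have NP: "?N \<subseteq> P" using block_subset[OF BB] by auto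
  have orb2: "card (pt.orb K x) = 2" if "x \<in> ?N" for x
    using pt.prime_order_orb[OF K(1) p] that NP K(2) by auto
  have cB: "nfix B K + card ?N = 16"
    using pt.card_invariant[OF fixed_block_invariant[OF B]] block_card[OF BB] by simp
  have un: "\<Union> (pt.orb K ` ?N) = ?N" using pt.orb_subset[OF inv] pt.self_in_orb[OF K(1)] NP by blast
  have cN: "2 * card (pt.orb K ` ?N) = card ?N"
  proof -
    have "2 * card (pt.orb K ` ?N) = card (\<Union> (pt.orb K ` ?N))"
    proof (rule card_partition)
      show "c1 \<inter> c2 = {}" if "c1 \<in> pt.orb K ` ?N" "c2 \<in> pt.orb K ` ?N" "c1 \<noteq> c2" for c1 c2
        using that pt.orb_disjoint[OF K(1)] NP by blast
    qed (use un orb2 finite_block[OF BB] in auto)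
    thus ?thesis using un by simp
  qed
  hence "even (card ?N)" by (metis dvd_triv_left)
  thus "even (nfix B K)" using cB by (metis even_add even_numeral)
  let ?A = "{s. s \<subseteq> B \<inter> pt.fixed K \<and> card s = 2}"
  have "{s. s \<subseteq> B \<and> card s = 2 \<and> (\<forall>g\<in>K. act g ` s = s)} = ?A \<union> pt.orb K ` ?N"
  proof (intro equalityI subsetI)
    fix s assume s: "s \<in> {s. s \<subseteq> B \<and> card s = 2 \<and> (\<forall>g\<in>K. act g ` s = s)}"
    have sP: "s \<subseteq> P" using s block_subset[OF BB] by auto
    show "s \<in> ?A \<union> pt.orb K ` ?N"
    proof (cases "s \<subseteq> pt.fixed K")
      case False
      then obtain x where x: "x \<in> s" "x \<in> ?N" using s by auto
      have "pt.orb K x \<subseteq> s" using x s by (auto simp: pt.orb_def)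
      hence "pt.orb K x = s" using card_subset_eq[of s "pt.orb K x"] s orb2[OF x(2)] card_ge_0_finite[of s] by auto
      thus ?thesis using x by auto
    qed (use s in auto)
  next
    fix s assume "s \<in> ?A \<union> pt.orb K ` ?N"
    thus "s \<in> {s. s \<subseteq> B \<and> card s = 2 \<and> (\<forall>g\<in>K. act g ` s = s)}"
    proof
      assume "s \<in> ?A" thus ?thesis by (force simp: pt.fixed_def)
    next
      assume "s \<in> pt.orb K ` ?N"
      then obtain x where x: "x \<in> ?N" "s = pt.orb K x" by auto
      have "act g ` s = s" if g: "g \<in> K" for g
      proof (rule card_subset_eq)
        have gG: "g \<in> carrier G" using subgroup.mem_carrier[OF K(1) g] .
        have sP: "s \<subseteq> P" using pt.orb_subset[OF inv x(1)] x(2) NP by auto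
        show "finite s" using sP finite_subset finite_points by blast
        show "act g ` s \<subseteq> s"
        proof
          fix y assume "y \<in> act g ` s"
          then obtain h where h: "h \<in> K" "y = act g (act h x)" using x by (auto simp: pt.orb_def)
          hence "y = act (g \<otimes> h) x" using gG subgroup.mem_carrier[OF K(1)] x NP by (subst pt.act_mult) auto
          thus "y \<in> s" using h g K(1) x by (auto simp: pt.orb_def subgroup.m_closed)
        qed
        show "card (act g ` s) = card s" using card_act_image[OF gG sP] .
      qed
      thus ?thesis using x orb2 pt.orb_subset[OF inv x(1)] by auto
    qed
  qed
  moreover have "?A \<inter> pt.orb K ` ?N = {}"
    using pt.self_in_orb[OF K(1)] NP by blast
  moreover have "finite ?A" by (rule finite_subset[of _ "Pow B"]) (use finite_block[OF BB] in auto)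
  ultimately show "card (pt.fixed K) = 1 + (nfix B K choose 2) + (16 - nfix B K) div 2"
    using card_fixed_blocks[OF K(1) B] card_fixed_eq[OF K(1) p] n_subsets[of "B \<inter> pt.fixed K" 2] cN cB
      finite_block[OF BB] by (simp add: card_Un_disjoint)
qed

text \<open>Fixed points on b lie on every block in the orbit of b, and two distinct blocks share
  only two points. If the orbit has at least three blocks, two such points would lie on more than
  two blocks.\<close>

lemma nonfixed_block_bound:
  assumes K: "subgroup K G" "prime (card K)" and b: "b \<in> BB - bl.fixed K"
  shows "nfix b K \<le> (if card K = 2 then 2 else 1)"
proof -
  have orb: "card (bl.orb K b) = card K" using bl.prime_order_orb[OF K] b by auto
  have inc: "b \<inter> pt.fixed K \<subseteq> c" if "c \<in> bl.orb K b" for c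
    using that by (force simp: bl.orb_def pt.fixed_def)
  have orbB: "bl.orb K b \<subseteq> BB" using bl.orb_subset[OF bl.invariant_E[OF K(1)]] b by auto
  have le2: "nfix b K \<le> 2"
  proof -
    obtain c where c: "c \<in> bl.orb K b" "c \<noteq> b"
      using orb prime_ge_2_nat[OF K(2)] card_mono[of "{b}" "bl.orb K b"] by auto
    have "card (b \<inter> c) = 2" using two_blocks c orbB b by auto
    thus ?thesis using card_mono[of "b \<inter> c" "b \<inter> pt.fixed K"] inc[OF c(1)] finite_block b by auto
  qed
  show ?thesis
  proof (cases "card K = 2")
    case False
    have "nfix b K \<noteq> 2"
    proof
      assume "nfix b K = 2"
      then obtain x y where xy: "b \<inter> pt.fixed K = {x, y}" "x \<noteq> y" by (auto simp: card_2_iff)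
      have "x \<in> P" "y \<in> P" using xy pt.fixed_subset by auto
      from two_points[OF this xy(2)] have "card (bl.orb K b) \<le> 2"
        using card_mono[of "{b \<in> BB. x \<in> b \<and> y \<in> b}" "bl.orb K b"] inc orbB xy by auto
      thus False using orb False prime_ge_2_nat[OF K(2)] by simp
    qed
    thus ?thesis using le2 False by simp
  qed (use le2 in simp)
qed

text \<open>Count flags consisting of a fixed point and a block: each fixed point lies on 16 blocks,
  each of the f fixed blocks has e fixed points, and the remaining 121 - f blocks are limited by
  \<open>nonfixed_block_bound\<close>.\<close>

lemma flag_bound:
  assumes K: "subgroup K G" "prime (card K)"
    and e: "\<And>b. b \<in> bl.fixed K \<Longrightarrow> nfix b K = e"
  defines "f \<equiv> card (pt.fixed K)"
  shows "16 * f \<le> f * e + (if card K = 2 then 2 else 1) * (121 - f)"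
proof -
  let ?c = "if card K = 2 then 2 else 1 :: nat"
  have "16 * f = (\<Sum>x\<in>pt.fixed K. card {b\<in>BB. x \<in> b})"
    using point_card pt.fixed_subset by (simp add: f_def subset_iff)
  also have "\<dots> = (\<Sum>b\<in>BB. card {x\<in>pt.fixed K. x \<in> b})" by (rule sum_card_swap) auto
  also have "\<dots> = (\<Sum>b\<in>BB. nfix b K)" by (simp add: Int_def conj_commute)
  also have "\<dots> = (\<Sum>b\<in>BB - bl.fixed K. nfix b K) + (\<Sum>b\<in>bl.fixed K. nfix b K)"
    by (rule sum.subset_diff) (simp_all add: bl.fixed_subset)
  also have "(\<Sum>b\<in>bl.fixed K. nfix b K) = f * e"
    using e card_fixed_eq[OF K] by (simp add: f_def)
  also have "(\<Sum>b\<in>BB - bl.fixed K. nfix b K) \<le> (\<Sum>b\<in>BB - bl.fixed K. ?c)"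
    by (rule sum_mono) (rule nonfixed_block_bound[OF K])
  also have "\<dots> = ?c * (121 - f)"
    using card_fixed_eq[OF K] card_blocks bl.fixed_subset by (simp add: card_Diff_subset f_def)
  finally show ?thesis by simp
qed

lemma card_fixed_lt:
  assumes K: "subgroup K G" "prime (card K)"
  shows "card (pt.fixed K) < 121"
proof (rule ccontr)
  assume "\<not> ?thesis"
  hence "pt.fixed K = P" using card_subset_eq[OF finite_points pt.fixed_subset] card_points
      card_mono[OF finite_points pt.fixed_subset, of K] by simp
  moreover obtain g where "g \<in> K" "g \<noteq> \<one>" "g \<in> carrier G" using prime_order_nontrivial[OF K] .
  ultimately show False using faithful[of g] by (auto simp: pt.fixed_def)
qed

text \<open>Since n choose 2 is strictly increasing from n = 1 on, f = 1 + (e choose 2) forces the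
  same e on all fixed blocks once e is at least 5. Then \<open>flag_bound\<close> fails for e from 5
  to 15. For e = 16 it holds, but f = 121, which faithfulness excludes.\<close>

lemma fixed_block_card_odd:
  assumes K: "subgroup K G" "prime (card K)" "card K \<noteq> 2" and B: "B \<in> bl.fixed K"
  shows "nfix B K \<le> 4"
proof (rule ccontr)
  let ?e = "nfix B K"
  assume "\<not> ?thesis"
  hence e5: "5 \<le> ?e" by simp
  have "nfix b K = ?e" if b: "b \<in> bl.fixed K" for b
  proof -
    have "nfix b K choose 2 = ?e choose 2"
      using card_fixed_odd[OF K B] card_fixed_odd[OF K b] by linarith
    thus ?thesis
      using e5 strict_mono_choose_two[of ?e "nfix b K"]
        strict_mono_choose_two[of "nfix b K" ?e] by linarith
  qed
  from flag_bound[OF K(1,2) this] have fl: "16 * card (pt.fixed K) \<le> card (pt.fixed K) * ?e + (121 - card (pt.fixed K))"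
    using K(3) by simp
  have "?e \<le> 16"
    using B card_mono[of B "B \<inter> pt.fixed K"] finite_block[of B] block_card[of B] by (auto simp: bl.fixed_def)
  hence "?e \<in> {5,6,7,8,9,10,11,12,13,14,15,16}" using e5 by (intro le_16_cases)
  thus False using fl card_fixed_odd[OF K B] card_fixed_lt[OF K(1,2)] by (auto simp: choose_two)
qed

text \<open>The values e = 0, 2, 4, 6, ... give f = 9, 9, 13, 21, ..., so e is the same on all fixed
  blocks from 6 on and \<open>flag_bound\<close> applies; e = 16 again gives f = 121. The
  coincidence at 0 and 2 is why neither can be singled out.\<close>

lemma fixed_block_card_involution:
  assumes K: "subgroup K G" "card K = 2" and B: "B \<in> bl.fixed K"
  shows "nfix B K \<in> {0, 2, 4}"
proof (rule ccontr)
  let ?e = "\<lambda>b. nfix b K"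
  have p: "prime (card K)" using K(2) by simp
  have ran: "?e b \<in> {0,2,4,6,8,10,12,14,16}" if b: "b \<in> bl.fixed K" for b
  proof -
    have "?e b \<le> 16"
      using b card_mono[of b "b \<inter> pt.fixed K"] finite_block[of b] block_card[of b] by (auto simp: bl.fixed_def)
    thus ?thesis using card_fixed_involution(2)[OF K b] even_le_16_cases by blast
  qed
  assume "\<not> ?thesis"
  hence e: "?e B \<in> {6,8,10,12,14,16}" using ran[OF B] by auto
  note fB = card_fixed_involution(1)[OF K B]
  have "?e b = ?e B" if b: "b \<in> bl.fixed K" for b
    using ran[OF b] e fB card_fixed_involution(1)[OF K b] by (auto simp: choose_two)
  from flag_bound[OF K(1) p this] have fl: "16 * card (pt.fixed K) \<le> card (pt.fixed K) * ?e B + 2 * (121 - card (pt.fixed K))"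
    using K(2) by simp
  thus False using e fB card_fixed_lt[OF K(1) p] by (auto simp: choose_two)
qed

lemma fixed_block_card_mod:
  assumes "subgroup K G" "prime p" "card K = p ^ a" and B: "B \<in> bl.fixed K"
  shows "p dvd 16 - nfix B K" "nfix B K \<le> 16"
    "card (B - pt.fixed K) = 16 - nfix B K"
proof -
  have "card B = 16" using B block_card by (simp add: bl.fixed_def)
  hence sum: "nfix B K + card (B - pt.fixed K) = 16"
    using pt.card_invariant[OF fixed_block_invariant[OF B]] by simp
  thus "nfix B K \<le> 16" "card (B - pt.fixed K) = 16 - nfix B K" by linarith+
  thus "p dvd 16 - nfix B K"
    using pt.p_group_nonfixed[OF assms(1-3) fixed_block_invariant[OF B]] by simp
qed

lemma exists_fixed_block:
  assumes "subgroup K G" "prime p" "card K = p ^ a" "\<not> p dvd 121"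
  obtains B where "B \<in> bl.fixed K"
proof -
  have "bl.fixed K \<noteq> {}"
    using bl.p_group_nonfixed[OF assms(1-3) bl.invariant_E[OF assms(1)]] assms(4) card_blocks by auto
  thus thesis using that by auto
qed

text \<open>The prime divides 16 - e with e at most 4, that is, one of 16, 15, 14, 13, 12.\<close>

lemma prime_order_cases:
  assumes K: "subgroup K G" "prime (card K)" "card K \<noteq> 2" and B: "B \<in> bl.fixed K"
  shows "card K = 3 \<and> nfix B K \<in> {1, 4} \<or> card K = 5 \<and> nfix B K = 1 \<or>
    card K = 7 \<and> nfix B K = 2 \<or> card K = 13 \<and> nfix B K = 3"
proof -
  let ?e = "nfix B K"
  have "?e \<in> {0,1,2,3,4}" using fixed_block_card_odd[OF K B] by (rule le_4_cases)
  moreover have "card K dvd 16 - ?e" using fixed_block_card_mod(1)[OF K(1,2) _ B, of 1] by simp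
  moreover have "card K = q" if "card K dvd q ^ i" "prime q" for q i
    using that K(2) by (metis prime_dvd_power primes_dvd_imp_eq)
  hence two: "\<not> card K dvd 2 ^ i" for i using K(3) by (metis two_is_prime_nat)
  moreover have "card K = q \<or> card K dvd r" if "card K dvd r * q" "prime q" for q r
    using that K(2) by (metis prime_dvd_mult_iff primes_dvd_imp_eq)
  from this[of 3 5] this[of 2 7] this[of 1 13] this[of 4 3] this[of 1 3]
  have "card K dvd 15 \<longrightarrow> card K = 3 \<or> card K = 5" "card K dvd 14 \<longrightarrow> card K = 7"
    "card K dvd 13 \<longrightarrow> card K = 13" "card K dvd 12 \<longrightarrow> card K = 3"
    using two[of 1] two[of 2] K(2) by auto
  moreover have "\<not> card K dvd 16" using two[of 4] by simp
  ultimately show ?thesis by auto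
qed

end

section \<open>Sylow subgroups\<close>

text \<open>\<open>?L\<close> is the intersection of K with its conjugate by h. It is K or trivial
  because K has prime order; if it is trivial, the double coset K h K has \<open>card K\<close>
  squared elements and does not fit into H.\<close>

lemma (in group) normalizes_of_card_less_square:
  assumes H: "subgroup H G" "finite H" and K: "subgroup K G" "K \<subseteq> H" "prime (card K)"
    and less: "card H < card K * card K" and h: "h \<in> H" and k: "k \<in> K"
  shows "inv h \<otimes> k \<otimes> h \<in> K"
proof -
  note HG = subgroup.mem_carrier[OF H(1)] and KG = subgroup.mem_carrier[OF K(1)]
  have hG: "h \<in> carrier G" using h HG by simp
  have finK: "finite K" using H(2) K(2) finite_subset by blast
  let ?L = "{k \<in> K. inv h \<otimes> k \<otimes> h \<in> K}"
  have L: "subgroup ?L G"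
  proof (rule subgroupI)
    show "?L \<subseteq> carrier G" using KG by auto
    have "\<one> \<in> ?L" using subgroup.one_closed[OF K(1)] hG by simp
    thus "?L \<noteq> {}" by blast
    show "inv a \<in> ?L" if "a \<in> ?L" for a
    proof -
      have "inv h \<otimes> inv a \<otimes> h = inv (inv h \<otimes> a \<otimes> h)"
        using that hG KG by (simp add: inv_mult_group m_assoc)
      thus ?thesis using that subgroup.m_inv_closed[OF K(1)] by simp
    qed
    show "a \<otimes> b \<in> ?L" if "a \<in> ?L" "b \<in> ?L" for a b
    proof -
      have "h \<otimes> (inv h \<otimes> (b \<otimes> h)) = b \<otimes> h"
        using that hG KG by (simp flip: m_assoc)
      hence "inv h \<otimes> (a \<otimes> b) \<otimes> h = (inv h \<otimes> a \<otimes> h) \<otimes> (inv h \<otimes> b \<otimes> h)"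
        using that hG KG by (simp add: m_assoc)
      thus ?thesis using that subgroup.m_closed[OF K(1)] by simp
    qed
  qed
  have "card ?L dvd card K" using card_subgroup_dvd[OF K(1) L] by auto
  hence "card ?L = 1 \<or> card ?L = card K" using K(3) by (auto simp: prime_nat_iff)
  thus ?thesis
  proof
    assume "card ?L = card K"
    hence "?L = K" using card_subset_eq[of K ?L] finK by auto
    thus ?thesis using k by auto
  next
    assume "card ?L = 1"
    then obtain l where l: "?L = {l}" by (rule card_1_singletonE)
    have triv: "a = \<one>" if "a \<in> K" "inv h \<otimes> a \<otimes> h \<in> K" for a
    proof -
      have "a \<in> ?L" using that by simp
      thus ?thesis using subgroup.one_closed[OF L] unfolding l by simp
    qed
    \<comment> \<open>If a h b = c h d, then the conjugate of c^-1 a by h equals d b^-1 and lies in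
      K, so c^-1 a lies in the trivial group \<open>?L\<close>.\<close>
    have "inj_on (\<lambda>(a, b). a \<otimes> h \<otimes> b) (K \<times> K)"
    proof (rule inj_onI, clarify)
      fix a b c d assume ab: "a \<in> K" "b \<in> K" "c \<in> K" "d \<in> K" and eq: "a \<otimes> h \<otimes> b = c \<otimes> h \<otimes> d"
      note G = KG[OF ab(1)] KG[OF ab(2)] KG[OF ab(3)] KG[OF ab(4)] hG
      define u where "u = c \<otimes> h"
      have u: "u \<in> carrier G" "inv u = inv h \<otimes> inv c" using G by (simp_all add: u_def inv_mult_group)
      have "inv h \<otimes> (inv c \<otimes> a) \<otimes> h = inv u \<otimes> (a \<otimes> h \<otimes> b) \<otimes> inv b"
        unfolding u(2) using G by (simp add: m_assoc)
      also have "\<dots> = inv u \<otimes> (u \<otimes> d) \<otimes> inv b" unfolding eq u_def ..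
      also have "\<dots> = d \<otimes> inv b" using G u(1) by (simp flip: m_assoc)
      also have "\<dots> \<in> K" using ab subgroup.m_closed[OF K(1)] subgroup.m_inv_closed[OF K(1)] by simp
      finally have "inv c \<otimes> a = \<one>"
        using triv ab subgroup.m_closed[OF K(1)] subgroup.m_inv_closed[OF K(1)] by simp
      hence "a = c" using G by (metis inv_closed inv_equality inv_inv)
      moreover from this have "b = d" using eq G by (simp add: m_assoc)
      ultimately show "a = c \<and> b = d" by simp
    qed
    moreover have "(\<lambda>(a, b). a \<otimes> h \<otimes> b) ` (K \<times> K) \<subseteq> H"
      using h K(2) by (auto intro!: subgroup.m_closed[OF H(1)])
    ultimately have "card (K \<times> K) \<le> card H" using H(2) by (rule card_inj_on_le)
    thus ?thesis using less by (simp add: card_cartesian_product)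
  qed
qed

lemma (in fin_action) fixed_normalizer:
  assumes K: "subgroup K G" and h: "h \<in> carrier G" "\<And>k. k \<in> K \<Longrightarrow> inv h \<otimes> k \<otimes> h \<in> K"
    and x: "x \<in> fixed K"
  shows "act h x \<in> fixed K"
proof -
  have xE: "x \<in> E" using x fixed_subset by auto
  have "act k (act h x) = act h x" if k: "k \<in> K" for k
  proof -
    have kG: "k \<in> carrier G" using subgroup.mem_carrier[OF K k] .
    have "act (inv h \<otimes> k \<otimes> h) x = x" using h(2)[OF k] x by (auto simp: fixed_def)
    hence "act (inv h) (act k (act h x)) = x" using kG h(1) xE by (simp add: act_mult act_closed)
    thus ?thesis using act_inv(2)[OF h(1), of "act k (act h x)"] kG h(1) xE act_closed by simp
  qed
  thus ?thesis using xE h(1) act_closed by (simp add: fixed_def)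
qed

lemma (in fin_action) fixed_invariant:
  assumes "subgroup K G" "subgroup H G" "\<And>h k. h \<in> H \<Longrightarrow> k \<in> K \<Longrightarrow> inv h \<otimes> k \<otimes> h \<in> K"
  shows "invariant H (fixed K)"
  using fixed_normalizer[OF assms(1) subgroup.mem_carrier[OF assms(2)] assms(3)] fixed_subset
  by (auto simp: invariant_def)

section \<open>Groups of prime power order acting on a fixed block\<close>

context biplane_group
begin

lemma fixed_block_subgroup: "B \<in> bl.fixed H \<Longrightarrow> K \<subseteq> H \<Longrightarrow> B \<in> bl.fixed K"
  by (auto simp: bl.fixed_def)

lemma fixed_on_block_mono:
  assumes "K \<subseteq> H" "B \<in> bl.fixed H"
  shows "nfix B H \<le> nfix B K"
  using pt.fixed_antimono[OF assms(1)] by (intro card_mono) auto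

text \<open>The bounds from above for subgroups of order p and from below for H meet at e, so H acts
  semiregularly on the other 16 - e points of B.\<close>

lemma p_group_on_block:
  assumes H: "subgroup H G" "prime p" "card H = p ^ a" "0 < a" and B: "B \<in> bl.fixed H"
    and e: "\<And>K. subgroup K G \<Longrightarrow> K \<subseteq> H \<Longrightarrow> card K = p \<Longrightarrow> nfix B K \<le> e"
    and s: "e \<le> nfix B H"
  shows "card H dvd 16 - e"
proof -
  have "p ^ 1 dvd card H" using H(3,4) by (metis One_nat_def Suc_leI le_imp_power_dvd)
  then obtain K where K: "subgroup K G" "K \<subseteq> H" "card K = p"
    using subgroup_of_prime_power_order[OF pt.finite_carrier H(1,2)] by (metis power_one_right)
  have "nfix B H = e"
    using fixed_on_block_mono[OF K(2) B] e[OF K] s by simp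
  moreover have "card H dvd card (B - pt.fixed H)"
    by (rule pt.p_group_semiregular[OF H(1-3) fixed_block_invariant[OF B]]) (rule order_trans[OF e s])
  ultimately show ?thesis using fixed_block_card_mod(3)[OF H(1-3) B] by simp
qed

text \<open>The number of fixed points on B is congruent to 16 modulo p, hence at least e, and
  \<open>p_group_on_block\<close> would make 49 divide 14 or 25 divide 15.\<close>

lemma no_subgroup_prime_square:
  fixes p e :: nat
  assumes H: "subgroup H G" and pe: "p = 7 \<and> e = 2 \<or> p = 5 \<and> e = 1"
  shows "card H \<noteq> p ^ 2"
proof
  assume c: "card H = p ^ 2"
  have p: "prime p" "\<not> p dvd 121" using pe by auto
  obtain B where B: "B \<in> bl.fixed H" using exists_fixed_block[OF H p(1) c p(2)] .
  have "card H dvd 16 - e"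
  proof (rule p_group_on_block[OF H p(1) c _ B])
    show "nfix B K \<le> e" if "subgroup K G" "K \<subseteq> H" "card K = p" for K
      using prime_order_cases[of K B] fixed_block_subgroup[OF B] that pe by auto
    have "p dvd 16 - n \<Longrightarrow> n \<le> 16 \<Longrightarrow> e \<le> n" for n :: nat using pe by (elim disjE) (simp, presburger)+
    thus "e \<le> nfix B H" using fixed_block_card_mod(1,2)[OF H p(1) c B] by blast
  qed simp
  thus False using c pe by auto
qed

text \<open>If p^2 does not divide the number of moved points of B, some orbit there has exactly p
  points; the stabilizer of one of them has index p and fixes that point as well.\<close>

lemma more_fixed_subgroup:
  assumes H: "subgroup H G" "prime p" "card H = p ^ a" and B: "B \<in> bl.fixed H"
    and nd: "\<not> p ^ 2 dvd 16 - nfix B H"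
  obtains Q where "subgroup Q G" "Q \<subseteq> H" "card H = p * card Q" "nfix B H < nfix B Q"
proof -
  have "\<exists>z\<in>B - pt.fixed H. \<not> p ^ 2 dvd card (pt.orb H z)"
    using pt.card_nonfixed_dvd[OF H(1) fixed_block_invariant[OF B], of "p ^ 2"]
      fixed_block_card_mod(3)[OF H B] nd by auto
  then obtain z where z: "z \<in> B" "z \<notin> pt.fixed H" "\<not> p ^ 2 dvd card (pt.orb H z)" by auto
  have zP: "z \<in> P" using z(1) B block_subset by (auto simp: bl.fixed_def)
  have "card (pt.orb H z) dvd p ^ a" using pt.orb_card_dvd[OF H(1) zP] H(3) by simp
  then obtain i where i: "card (pt.orb H z) = p ^ i" unfolding divides_primepow_nat[OF H(2)] by blast
  have "i \<noteq> 0" using i pt.orb_fixed_iff[OF H(1) zP] z(2) by auto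
  moreover have "i < 2" using z(3) i le_imp_power_dvd[of 2 i p] by force
  ultimately have "card (pt.orb H z) = p" using i by (cases "i = 1") auto
  hence cQ: "card H = p * card (pt.stab H z)" using pt.orbit_stabilizer[OF H(1) zP] by simp
  let ?Q = "pt.stab H z"
  have "insert z (B \<inter> pt.fixed H) \<subseteq> B \<inter> pt.fixed ?Q"
    using z zP pt.fixed_antimono[OF pt.stab_subset[of H z]] by (auto simp: pt.fixed_def pt.stab_def)
  hence "card (insert z (B \<inter> pt.fixed H)) \<le> nfix B ?Q" by (intro card_mono) auto
  hence "nfix B H < nfix B ?Q" using z(2) by simp
  thus thesis by (rule that[OF pt.stab_subgroup[OF H(1) zP] pt.stab_subset cQ])
qed

text \<open>The count is 1 modulo 3, so two fixed points would mean at least four, the maximum for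
  subgroups of order 3; then 9 would divide 12.\<close>

lemma order_9_fixed:
  assumes Q: "subgroup Q G" "card Q = 9" and B: "B \<in> bl.fixed Q"
  shows "nfix B Q < 2"
proof (rule ccontr)
  have p: "prime (3::nat)" "card Q = 3 ^ 2" using Q(2) by auto
  assume "\<not> ?thesis"
  hence "4 \<le> nfix B Q" using fixed_block_card_mod(1,2)[OF Q(1) p B] by presburger
  from p_group_on_block[OF Q(1) p _ B _ this] have "card Q dvd 16 - 4"
    using prime_order_cases[of _ B] fixed_block_subgroup[OF B] by fastforce
  thus False using Q(2) by simp
qed

text \<open>By \<open>order_9_fixed\<close>, H fixes exactly one point of B. Since 9 does not divide
  15, a subgroup of order 9 fixes more than one, against the same lemma.\<close>

lemma no_subgroup_27: "subgroup H G \<Longrightarrow> card H \<noteq> 27"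
proof
  assume H: "subgroup H G" and c: "card H = 27"
  have p: "prime (3::nat)" "card H = 3 ^ 3" using c by auto
  have "\<not> (3::nat) dvd 121" by simp
  then obtain B where B: "B \<in> bl.fixed H" using exists_fixed_block[OF H p] by blast
  let ?s = "nfix B H"
  obtain Q where Q: "subgroup Q G" "Q \<subseteq> H" "card Q = 3 ^ 2"
    using subgroup_of_prime_power_order[OF pt.finite_carrier H, of 3 2] c by auto
  have "?s < 2"
    using order_9_fixed[OF Q(1) _ fixed_block_subgroup[OF B Q(2)]] fixed_on_block_mono[OF Q(2) B] Q(3) by simp
  hence s1: "?s = 1" using fixed_block_card_mod(1,2)[OF H p B] by presburger
  hence "\<not> 3 ^ 2 dvd 16 - ?s" by simp
  then obtain R where R: "subgroup R G" "R \<subseteq> H" "card H = 3 * card R" "?s < nfix B R"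
    using more_fixed_subgroup[OF H p B] by blast
  thus False using order_9_fixed[OF R(1) _ fixed_block_subgroup[OF B R(2)]] c s1 by simp
qed

text \<open>By parity three fixed points would mean at least four, the maximum for involutions; then
  8 would divide 12.\<close>

lemma order_8_fixed:
  assumes Q: "subgroup Q G" "card Q = 8" and B: "B \<in> bl.fixed Q"
  shows "nfix B Q < 3"
proof (rule ccontr)
  have p: "prime (2::nat)" "card Q = 2 ^ 3" using Q(2) by auto
  assume "\<not> ?thesis"
  hence "\<not> nfix B Q < 3" by simp
  moreover have "\<not> n < 3 \<Longrightarrow> 2 dvd 16 - n \<Longrightarrow> n \<le> 16 \<Longrightarrow> 4 \<le> n" for n :: nat by presburger
  ultimately have "4 \<le> nfix B Q" using fixed_block_card_mod(1,2)[OF Q(1) p B] by blast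
  from p_group_on_block[OF Q(1) p _ B _ this] have "card Q dvd 16 - 4"
    using fixed_block_card_involution[of _ B] fixed_block_subgroup[OF B] by fastforce
  thus False using Q(2) by simp
qed

text \<open>By \<open>order_8_fixed\<close> and parity a positive count is 2. Since 4 does not
  divide 14, a subgroup of order 8 then fixes more than two points of B.\<close>

lemma order_16_fixed:
  assumes Q: "subgroup Q G" "card Q = 16" and B: "B \<in> bl.fixed Q"
  shows "nfix B Q = 0"
proof (rule ccontr)
  have p: "prime (2::nat)" "card Q = 2 ^ 4" using Q(2) by auto
  assume s0: "nfix B Q \<noteq> 0"
  obtain R where R: "subgroup R G" "R \<subseteq> Q" "card R = 2 ^ 3"
    using subgroup_of_prime_power_order[OF pt.finite_carrier Q(1), of 2 3] Q(2) by auto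
  have "nfix B Q < 3"
    using order_8_fixed[OF R(1) _ fixed_block_subgroup[OF B R(2)]] fixed_on_block_mono[OF R(2) B] R(3) by simp
  moreover have "n < 3 \<Longrightarrow> 2 dvd 16 - n \<Longrightarrow> n \<le> 16 \<Longrightarrow> n \<noteq> 0 \<Longrightarrow> n = 2" for n :: nat by presburger
  ultimately have s: "nfix B Q = 2" using fixed_block_card_mod(1,2)[OF Q(1) p B] s0 by blast
  hence "\<not> 2 ^ 2 dvd 16 - nfix B Q" by simp
  then obtain R where R: "subgroup R G" "R \<subseteq> Q" "card Q = 2 * card R"
    "nfix B Q < nfix B R"
    using more_fixed_subgroup[OF Q(1) p B] by blast
  thus False using order_8_fixed[OF R(1) _ fixed_block_subgroup[OF B R(2)]] Q(2) s by simp
qed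

text \<open>A point z of a fixed block has an orbit of at most 16 points, so its stabilizer has
  order at least 16, and a subgroup of order 16 in it fixes z, against
  \<open>order_16_fixed\<close>. The exponent 7 in the bound reflects orbits of length 16 with
  stabilizers of order 8.\<close>

lemma no_subgroup_256: "subgroup H G \<Longrightarrow> card H \<noteq> 256"
proof
  assume H: "subgroup H G" and c: "card H = 256"
  have p: "prime (2::nat)" "card H = 2 ^ 8" using c by auto
  have "\<not> (2::nat) dvd 121" by simp
  then obtain B where B: "B \<in> bl.fixed H" using exists_fixed_block[OF H p] by blast
  have BB: "B \<in> BB" using B by (auto simp: bl.fixed_def)
  obtain z where z: "z \<in> B" using block_card[OF BB] by fastforce
  have zP: "z \<in> P" using z block_subset[OF BB] by auto
  have "card (pt.orb H z) \<le> card B"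
    by (rule card_mono[OF finite_block[OF BB] pt.orb_subset[OF fixed_block_invariant[OF B] z]])
  hence o16: "card (pt.orb H z) \<le> 16" using block_card[OF BB] by simp
  have "card (pt.stab H z) dvd 2 ^ 8" using pt.orbit_stabilizer[OF H zP] p(2) by (metis dvd_triv_right)
  then obtain i where i: "card (pt.stab H z) = 2 ^ i" unfolding divides_primepow_nat[OF p(1)] by blast
  have "4 \<le> i"
  proof (rule ccontr)
    assume "\<not> 4 \<le> i"
    hence "(2::nat) ^ i \<le> 2 ^ 3" by (intro power_increasing) auto
    hence "card (pt.orb H z) * card (pt.stab H z) \<le> 16 * 8" using o16 i by (intro mult_le_mono) auto
    thus False using pt.orbit_stabilizer[OF H zP] c by simp
  qed
  hence "2 ^ 4 dvd card (pt.stab H z)" unfolding i by (rule le_imp_power_dvd)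
  then obtain Q where Q: "subgroup Q G" "Q \<subseteq> pt.stab H z" "card Q = 2 ^ 4"
    using subgroup_of_prime_power_order[OF pt.finite_carrier pt.stab_subgroup[OF H zP] p(1)] by blast
  have "z \<in> B \<inter> pt.fixed Q" using z zP Q(2) by (auto simp: pt.fixed_def pt.stab_def)
  moreover have "Q \<subseteq> H" using Q(2) pt.stab_subset by blast
  ultimately show False
    using order_16_fixed[OF Q(1) _ fixed_block_subgroup[OF B]] Q(3) by (auto simp: card_eq_0_iff)
qed

section \<open>Order 35, and commuting elements of orders 7 and 3 or 5 and 2\<close>

lemma fixed_card_prime:
  fixes e :: nat
  assumes K: "subgroup K G" and pe: "card K = 7 \<and> e = 2 \<or> card K = 5 \<and> e = 1"
  shows "card (pt.fixed K) = e" "card (bl.fixed K) = e" "B \<in> bl.fixed K \<Longrightarrow> pt.fixed K \<subseteq> B"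
proof -
  have p: "prime (card K)" "card K \<noteq> 2" "\<not> card K dvd 121" using pe by auto
  obtain C where C: "C \<in> bl.fixed K" using exists_fixed_block[OF K p(1) _ p(3), of 1] by auto
  show c: "card (pt.fixed K) = e"
    using card_fixed_odd[OF K p(1,2) C] prime_order_cases[OF K p(1,2) C] pe by auto
  thus "card (bl.fixed K) = e" using card_fixed_eq[OF K p(1)] by simp
  show "pt.fixed K \<subseteq> B" if B: "B \<in> bl.fixed K"
    using prime_order_cases[OF K p(1,2) B] pe c card_subset_eq[of "pt.fixed K" "B \<inter> pt.fixed K"] by auto
qed

lemmas fixed_card_7 = fixed_card_prime[OF _ disjI1[OF conjI[OF _ refl]]]
  and fixed_card_5 = fixed_card_prime[OF _ disjI2[OF conjI[OF _ refl]]]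

text \<open>Because 35 < 49, the subgroup T of order 5 normalizes the subgroup S of order 7. It acts
  on the two fixed points of S and must fix both, but it has only one fixed point.\<close>

lemma no_subgroup_35: "subgroup H G \<Longrightarrow> card H \<noteq> 35"
proof
  assume H: "subgroup H G" and c: "card H = 35"
  obtain S where S: "subgroup S G" "S \<subseteq> H" "card S = 7 ^ 1"
    using subgroup_of_prime_power_order[OF pt.finite_carrier H, of 7 1] c by auto
  obtain T where T: "subgroup T G" "T \<subseteq> H" "card T = 5 ^ 1"
    using subgroup_of_prime_power_order[OF pt.finite_carrier H, of 5 1] c by auto
  have "inv h \<otimes> k \<otimes> h \<in> S" if "h \<in> T" "k \<in> S" for h k
    by (rule normalizes_of_card_less_square[OF H pt.finite_subgroup[OF H] S(1,2)]) (use S(3) T(2) c that in auto)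
  hence inv: "pt.invariant T (pt.fixed S)" by (rule pt.fixed_invariant[OF S(1) T(1)])
  have "5 dvd card (pt.fixed S - pt.fixed T)" by (rule pt.p_group_nonfixed[OF T(1) _ T(3) inv]) simp
  moreover have "card (pt.fixed S \<inter> pt.fixed T) + card (pt.fixed S - pt.fixed T) = 2"
    using pt.card_invariant[OF inv] fixed_card_7(1)[OF S(1)] S(3) by simp
  moreover have "card (pt.fixed S \<inter> pt.fixed T) \<le> 1"
    using card_mono[of "pt.fixed T" "pt.fixed S \<inter> pt.fixed T"] fixed_card_5(1)[OF T(1)] T(3) by simp
  moreover have "5 dvd c \<Longrightarrow> a + c = 2 \<Longrightarrow> a \<le> 1 \<Longrightarrow> False" for a c :: nat by presburger
  ultimately show False by blast
qed

lemma commuting_invariant: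
  assumes "subgroup S G" "subgroup T G" "\<And>s t. s \<in> S \<Longrightarrow> t \<in> T \<Longrightarrow> s \<otimes> t = t \<otimes> s"
  shows "pt.invariant T (pt.fixed S)" "bl.invariant T (bl.fixed S)"
proof -
  have "inv t \<otimes> s \<otimes> t \<in> S" if "t \<in> T" "s \<in> S" for s t
  proof -
    have G: "s \<in> carrier G" "t \<in> carrier G" using subgroup.mem_carrier[OF assms(1) that(2)] subgroup.mem_carrier[OF assms(2) that(1)] .
    hence "inv t \<otimes> s \<otimes> t = inv t \<otimes> (t \<otimes> s)" by (simp add: m_assoc flip: assms(3)[OF that(2,1)])
    also have "\<dots> = s" using G by (simp flip: m_assoc)
    finally have "inv t \<otimes> s \<otimes> t = s" .
    thus ?thesis using that by simp
  qed
  thus "pt.invariant T (pt.fixed S)" "bl.invariant T (bl.fixed S)"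
    using pt.fixed_invariant[OF assms(1,2)] bl.fixed_invariant[OF assms(1,2)] by blast+
qed

text \<open>T fixes both fixed points of S, and S moves the other fixed points of T in orbits of
  length 7. So T has 2 modulo 7 fixed points, whereas \<open>card_fixed_odd\<close> allows only 1 or
  7.\<close>

lemma no_commuting_7_3:
  assumes S: "subgroup S G" "card S = 7" and T: "subgroup T G" "card T = 3"
    and comm: "\<And>s t. s \<in> S \<Longrightarrow> t \<in> T \<Longrightarrow> s \<otimes> t = t \<otimes> s"
  shows False
proof -
  note inv = commuting_invariant(1)[OF S(1) T(1) comm] commuting_invariant(1)[OF T(1) S(1) comm[symmetric]]
  note f7 = fixed_card_7(1)[OF S]
  have p: "prime (card T)" "card T \<noteq> 2" using T(2) by auto
  have "3 dvd card (pt.fixed S - pt.fixed T)" by (rule pt.p_group_nonfixed[OF T(1) _ _ inv(1), of 3 1]) (use T in auto)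
  moreover have "card (pt.fixed S - pt.fixed T) \<le> 2"
    using card_mono[of "pt.fixed S" "pt.fixed S - pt.fixed T"] f7 by auto
  ultimately have "card (pt.fixed S - pt.fixed T) = 0" by presburger
  hence sub: "pt.fixed S \<subseteq> pt.fixed T" by simp
  hence "pt.fixed T \<inter> pt.fixed S = pt.fixed S" by auto
  hence "card (pt.fixed T) = 2 + card (pt.fixed T - pt.fixed S)" using pt.card_invariant[OF inv(2)] f7 by simp
  moreover have "7 dvd card (pt.fixed T - pt.fixed S)" by (rule pt.p_group_nonfixed[OF S(1) _ _ inv(2), of 7 1]) (use S in auto)
  moreover obtain C where C: "C \<in> bl.fixed T" using exists_fixed_block[OF T(1), of 3 1] T(2) by auto
  have "card (pt.fixed T) = 1 \<or> card (pt.fixed T) = 7"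
    using card_fixed_odd[OF T(1) p C] prime_order_cases[OF T(1) p C] T(2) by (auto simp: choose_two)
  moreover have "7 dvd c \<Longrightarrow> f = 2 + c \<Longrightarrow> f = 1 \<or> f = 7 \<Longrightarrow> False" for f c :: nat by presburger
  ultimately show False by blast
qed

text \<open>The only fixed block and the only fixed point of S are fixed by T as well. On that block
  S fixes one fixed point of T and moves the others in orbits of length 5, which makes their number
  1 modulo 5 and not 0, 2 or 4.\<close>

lemma no_commuting_5_2:
  assumes S: "subgroup S G" "card S = 5" and T: "subgroup T G" "card T = 2"
    and comm: "\<And>s t. s \<in> S \<Longrightarrow> t \<in> T \<Longrightarrow> s \<otimes> t = t \<otimes> s"
  shows False
proof -
  note inv = commuting_invariant[OF S(1) T(1) comm] commuting_invariant(1)[OF T(1) S(1) comm[symmetric]]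
  obtain B where B: "bl.fixed S = {B}" using fixed_card_5(2)[OF S] by (auto simp: card_1_singleton_iff)
  obtain z where z: "pt.fixed S = {z}" using fixed_card_5(1)[OF S] by (auto simp: card_1_singleton_iff)
  have zB: "z \<in> B" using fixed_card_5(3)[OF S, of B] B z by auto
  have BT: "B \<in> bl.fixed T" using inv(2) bl.fixed_subset[of S] unfolding B by (auto simp: bl.invariant_def bl.fixed_def)
  have zT: "z \<in> pt.fixed T" using inv(1) pt.fixed_subset[of S] unfolding z by (auto simp: pt.invariant_def pt.fixed_def)
  have "pt.invariant S (B \<inter> pt.fixed T)"
    using inv(3) fixed_block_invariant[of B S] B by (auto simp: pt.invariant_def)
  from pt.p_group_nonfixed[OF S(1) _ _ this, of 5 1] pt.card_invariant[OF this]
  have "5 dvd card (B \<inter> pt.fixed T - pt.fixed S)"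
    "nfix B T = card (B \<inter> pt.fixed T \<inter> pt.fixed S) + card (B \<inter> pt.fixed T - pt.fixed S)"
    using S(2) by auto
  moreover have "B \<inter> pt.fixed T \<inter> pt.fixed S = {z}" using z zT zB by auto
  moreover have "nfix B T \<in> {0,2,4}" by (rule fixed_block_card_involution[OF T BT])
  ultimately show False by auto
qed

end

section \<open>The Bruck--Ryser argument for automorphisms of order 11 and 13\<close>

text \<open>Affine and not linear because one coordinate is set to 1 from the start; no solution of
  a homogeneous system has to be shown nonzero later.\<close>

definition affine_form :: "nat \<Rightarrow> ((nat \<Rightarrow> rat) \<Rightarrow> rat) \<Rightarrow> bool" where
  "affine_form m L \<longleftrightarrow> (\<exists>c a. \<forall>y. L y = c + (\<Sum>j<m. a j * y j))"

lemma affine_form_const: "affine_form m (\<lambda>y. c)"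
  unfolding affine_form_def by (rule exI[of _ c], rule exI[of _ "\<lambda>_. 0"]) simp

lemma affine_form_coord:
  assumes "j < m" shows "affine_form m (\<lambda>y. y j)"
  unfolding affine_form_def
proof (intro exI allI)
  fix y :: "nat \<Rightarrow> rat"
  have "(\<Sum>i<m. (if i = j then 1 else 0) * y i) = (\<Sum>i<m. if i = j then y i else 0)"
    by (intro sum.cong) auto
  thus "y j = 0 + (\<Sum>i<m. (if i = j then 1 else 0) * y i)" using assms by simp
qed

lemma affine_form_add:
  assumes "affine_form m L" "affine_form m M" shows "affine_form m (\<lambda>y. L y + M y)"
proof -
  obtain c a d b where "\<And>y. L y = c + (\<Sum>j<m. a j * y j)" "\<And>y. M y = d + (\<Sum>j<m. b j * y j)"
    using assms by (auto simp: affine_form_def)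
  hence "\<forall>y. L y + M y = (c + d) + (\<Sum>j<m. (a j + b j) * y j)"
    by (simp add: sum.distrib distrib_right)
  thus ?thesis unfolding affine_form_def by (intro exI[of _ "c + d"] exI[of _ "\<lambda>j. a j + b j"])
qed

lemma affine_form_scale:
  assumes "affine_form m L" shows "affine_form m (\<lambda>y. k * L y)"
proof -
  obtain c a where "\<And>y. L y = c + (\<Sum>j<m. a j * y j)" using assms by (auto simp: affine_form_def)
  hence "\<forall>y. k * L y = k * c + (\<Sum>j<m. (k * a j) * y j)"
    by (simp add: sum_distrib_left distrib_left mult.assoc)
  thus ?thesis unfolding affine_form_def by (intro exI[of _ "k * c"] exI[of _ "\<lambda>j. k * a j"])
qed

lemma affine_form_sum:
  assumes "finite A" "\<And>i. i \<in> A \<Longrightarrow> affine_form m (L i)" shows "affine_form m (\<lambda>y. \<Sum>i\<in>A. L i y)"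
  using assms by (induction A) (auto intro: affine_form_const affine_form_add)

text \<open>Each equation \<open>L\<^sub>i y = \<plusminus> y\<^sub>i\<close> is solved for \<open>y\<^sub>i\<close>, the sign being chosen
  so that the coefficient of \<open>y\<^sub>i\<close> does not vanish.\<close>

lemma affine_forms_square_eq:
  assumes "\<And>i. i < m \<Longrightarrow> affine_form m (L i)"
  shows "\<exists>y. \<forall>i<m. (L i y)\<^sup>2 = (y i)\<^sup>2"
  using assms
proof (induction m arbitrary: L)
  case (Suc m)
  obtain c a where La: "\<And>y. L m y = c + (\<Sum>j<Suc m. a j * y j)"
    using Suc.prems[of m] by (auto simp: affine_form_def)
  define s where "s = (if a m = 1 then - (1 / 2) else 1 / (1 - a m))"
  define t where "t = (\<lambda>y. s * (c + (\<Sum>j<m. a j * y j)))"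
  have t: "affine_form m t" unfolding t_def
    by (intro affine_form_scale affine_form_add affine_form_const affine_form_sum affine_form_coord) auto
  define L' where "L' = (\<lambda>i y. L i (y(m := t y)))"
  have "affine_form m (L' i)" if i: "i < m" for i
  proof -
    obtain d b where "\<And>y. L i y = d + (\<Sum>j<Suc m. b j * y j)"
      using Suc.prems[of i] i by (auto simp: affine_form_def)
    hence "L' i = (\<lambda>y. (d + (\<Sum>j<m. b j * y j)) + b m * t y)" by (simp add: L'_def add.assoc)
    thus ?thesis
      by (auto intro!: affine_form_scale affine_form_add affine_form_const affine_form_sum affine_form_coord t)
  qed
  then obtain y where y: "\<forall>i<m. (L' i y)\<^sup>2 = (y i)\<^sup>2" using Suc.IH[of L'] by blast
  have "L m (y(m := t y)) = c + (\<Sum>j<m. a j * y j) + a m * t y" by (simp add: La)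
  also have "\<dots> = (if a m = 1 then - t y else t y)"
    by (simp add: t_def s_def divide_simps) (simp add: algebra_simps)
  finally have m: "(L m (y(m := t y)))\<^sup>2 = (t y)\<^sup>2" by simp
  have "(L i (y(m := t y)))\<^sup>2 = ((y(m := t y)) i)\<^sup>2" if "i < Suc m" for i
  proof (cases "i = m")
    case True
    thus ?thesis using m by (simp only: fun_upd_same)
  next
    case False
    hence "i < m" using that by simp
    hence "(L i (y(m := t y)))\<^sup>2 = (y i)\<^sup>2" using y unfolding L'_def by blast
    thus ?thesis by (simp only: fun_upd_other[OF False])
  qed
  thus ?case by blast
qed simp

text \<open>Hamilton's identity for \<open>14 = 1\<^sup>2 + 2\<^sup>2 + 3\<^sup>2 + 0\<^sup>2\<close>, on consecutive quadruples of coordinates.\<close>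

definition hamilton14 :: "(nat \<Rightarrow> rat) \<Rightarrow> nat \<Rightarrow> rat" where
  "hamilton14 y k = (let q = 4 * (k div 4) in
     if k mod 4 = 0 then (y q + 2 * y (q + 1) + 3 * y (q + 2)) / 14
     else if k mod 4 = 1 then (2 * y q - y (q + 1) + 3 * y (q + 3)) / 14
     else if k mod 4 = 2 then (3 * y q - y (q + 2) - 2 * y (q + 3)) / 14
     else (- 3 * y (q + 1) + 2 * y (q + 2) - y (q + 3)) / 14)"

text \<open>On each quadruple \<open>hamilton14\<close> is M / 14 for the integer matrix M with rows
  (1, 2, 3, 0), (2, -1, 0, 3), (3, 0, -1, -2), (0, -3, 2, -1), which are orthogonal of squared
  length 14.\<close>

lemma hamilton14_square:
  "14 * ((hamilton14 y (4 * q))\<^sup>2 + (hamilton14 y (4 * q + 1))\<^sup>2 + (hamilton14 y (4 * q + 2))\<^sup>2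
    + (hamilton14 y (4 * q + 3))\<^sup>2) = (y (4 * q))\<^sup>2 + (y (4 * q + 1))\<^sup>2 + (y (4 * q + 2))\<^sup>2 + (y (4 * q + 3))\<^sup>2"
proof -
  have m: "(4 * q) mod 4 = 0" "(4 * q + 1) mod 4 = 1" "(4 * q + 2) mod 4 = 2" "(4 * q + 3) mod 4 = 3"
    "(4 * q) div 4 = q" "(4 * q + 1) div 4 = q" "(4 * q + 2) div 4 = q" "(4 * q + 3) div 4 = q"
    by presburger+
  show ?thesis unfolding hamilton14_def Let_def m by (simp add: field_simps power2_eq_square)
qed

lemma sum_lessThan_12: "(\<Sum>k<12. f k) = f 0 + f 1 + f 2 + f 3 + (f 4 + f 5 + f 6 + f 7) + (f 8 + f 9 + f 10 + f (11::nat))"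
  for f :: "nat \<Rightarrow> rat"
  by (simp add: eval_nat_numeral algebra_simps)

text \<open>The coordinates from m on are frozen at 1 and supply the constant term.\<close>

lemma affine_form_hamilton14:
  "affine_form m (\<lambda>y. hamilton14 (\<lambda>i. if i < m then y i else 1) k)"
proof -
  have c: "affine_form m (\<lambda>y. if i < m then y i else 1)" for i
    by (cases "i < m") (auto intro: affine_form_const affine_form_coord)
  let ?q = "4 * (k div 4)"
  have lin: "affine_form m (\<lambda>y. (r0 * (if ?q < m then y ?q else 1) + r1 * (if ?q + 1 < m then y (?q + 1) else 1)
     + r2 * (if ?q + 2 < m then y (?q + 2) else 1) + r3 * (if ?q + 3 < m then y (?q + 3) else 1)))" for r0 r1 r2 r3
    by (intro affine_form_add affine_form_scale c)
  have "k mod 4 = 0 \<or> k mod 4 = 1 \<or> k mod 4 = 2 \<or> k mod 4 = 3" by presburger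
  thus ?thesis
    using lin[of "1/14" "2/14" "3/14" 0] lin[of "2/14" "-1/14" 0 "3/14"] lin[of "3/14" 0 "-1/14" "-2/14"]
      lin[of 0 "-3/14" "2/14" "-1/14"]
    by (elim disjE) (simp_all add: hamilton14_def Let_def add_divide_distrib diff_divide_distrib)
qed

section \<open>Two quadratic equations without rational solutions\<close>

lemma dvd7_sum_squares:
  assumes "7 dvd s\<^sup>2 + (t::int)\<^sup>2" shows "7 dvd s" "7 dvd t"
proof -
  have sq: "x\<^sup>2 mod 7 = (x mod 7)\<^sup>2 mod 7" for x :: int by (simp add: power_mod)
  have r: "x mod 7 \<in> {0,1,2,3,4,5,6}" for x :: int by (simp, presburger)
  have "(s\<^sup>2 + t\<^sup>2) mod 7 = ((s mod 7)\<^sup>2 mod 7 + (t mod 7)\<^sup>2 mod 7) mod 7" by (metis mod_add_eq sq)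
  hence "((s mod 7)\<^sup>2 mod 7 + (t mod 7)\<^sup>2 mod 7) mod 7 = 0" using assms by simp
  \<comment> \<open>The squares modulo 7 are 0, 1, 2 and 4, and two of them add up to 0 only if both
    vanish.\<close>
  hence "s mod 7 = 0 \<and> t mod 7 = 0" using r[of s] r[of t] by auto
  thus "7 dvd s" "7 dvd t" by auto
qed

text \<open>Infinite descent: x and z are divisible by 7, hence 49 divides the left-hand side and 7
  divides y; dividing all three by 7 gives a smaller solution.\<close>

lemma descent_7:
  fixes a b c :: int
  assumes anis: "\<And>x z. 7 dvd a * x\<^sup>2 + b * z\<^sup>2 \<Longrightarrow> 7 dvd x \<and> 7 dvd z" and c: "\<not> 7 dvd c"
  shows "a * x\<^sup>2 + b * z\<^sup>2 = 7 * c * y\<^sup>2 \<Longrightarrow> y = 0"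
proof (induction "nat \<bar>y\<bar>" arbitrary: x y z rule: less_induct)
  case less
  have "7 dvd a * x\<^sup>2 + b * z\<^sup>2" using less.prems by simp
  then obtain x' z' where xz: "x = 7 * x'" "z = 7 * z'" using anis by (meson dvdE)
  have "7 * (a * x'\<^sup>2 + b * z'\<^sup>2) = c * y\<^sup>2"
    using less.prems by (simp add: xz power_mult_distrib algebra_simps)
  hence "7 dvd c * y\<^sup>2" by (metis dvd_triv_left)
  moreover have "prime (7::int)" by simp
  ultimately have "7 dvd y" using c by (metis prime_dvd_mult_iff prime_dvd_power)
  then obtain y' where y: "y = 7 * y'" by (rule dvdE)
  have eq: "a * x'\<^sup>2 + b * z'\<^sup>2 = 7 * c * y'\<^sup>2"
    using \<open>7 * (a * x'\<^sup>2 + b * z'\<^sup>2) = c * y\<^sup>2\<close> by (simp add: y power_mult_distrib)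
  have "y' = 0"
  proof (rule ccontr)
    assume "y' \<noteq> 0"
    hence "nat \<bar>y'\<bar> < nat \<bar>y\<bar>" by (simp add: y abs_mult)
    from less.hyps[OF this eq] show False using \<open>y' \<noteq> 0\<close> by simp
  qed
  thus "y = 0" by (simp add: y)
qed

lemma rat_common_denominator:
  obtains p q d :: int where "d \<noteq> 0" "(r::rat) = of_int p / of_int d" "(s::rat) = of_int q / of_int d"
proof -
  obtain a b c e where q: "quotient_of r = (a, b)" "quotient_of s = (c, e)" by (cases "quotient_of r", cases "quotient_of s")
  have "b > 0" "e > 0" "r = of_int a / of_int b" "s = of_int c / of_int e"
    using quotient_of_denom_pos[OF q(1)] quotient_of_denom_pos[OF q(2)]
      quotient_of_div[OF q(1)] quotient_of_div[OF q(2)] .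
  thus thesis by (intro that[of "b * e" "a * e" "c * b"]) auto
qed

lemma no_rat_11: "154 * u\<^sup>2 \<noteq> 11 + 2 * (w::rat)\<^sup>2"
proof
  assume eq: "154 * u\<^sup>2 = 11 + 2 * w\<^sup>2"
  obtain p q d where d: "d \<noteq> 0" "u = of_int p / of_int d" "w = of_int q / of_int d"
    using rat_common_denominator .
  have "rat_of_int (11 * d\<^sup>2 + 2 * q\<^sup>2) = of_int (7 * 22 * p\<^sup>2)"
    using eq d(1) by (simp add: d(2,3) power_divide divide_simps)
  hence int: "11 * d\<^sup>2 + 2 * q\<^sup>2 = 7 * 22 * p\<^sup>2" by (simp only: of_int_eq_iff)
  have "p = 0"
  proof (rule descent_7[OF _ _ int])
    fix x z :: int assume "7 dvd 11 * x\<^sup>2 + 2 * z\<^sup>2"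
    \<comment> \<open>The factor 4 inverts 2 modulo 7 and turns the form into a sum of squares: 44 =
      35 + 9 and 8 = 7 + 1.\<close>
    from dvd_diff[OF dvd_mult[OF this] dvd_triv_left]
    have "7 dvd 4 * (11 * x\<^sup>2 + 2 * z\<^sup>2) - 7 * (5 * x\<^sup>2 + z\<^sup>2)" .
    also have "\<dots> = (3 * x)\<^sup>2 + z\<^sup>2" by (simp add: power_mult_distrib)
    finally show "7 dvd x \<and> 7 dvd z" using dvd7_sum_squares[of "3 * x" z] by presburger
  qed simp
  hence "11 * d\<^sup>2 + 2 * q\<^sup>2 = 0" using int by simp
  thus False using d(1) by (smt (verit) zero_less_power2 zero_le_power2)
qed

text \<open>Here 182 carries the factor 7, so the descent runs on the denominator, with 13 x^2 - 2
  z^2 as the form. Three times this form is (2 x)^2 + z^2 modulo 7.\<close>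

lemma no_rat_13: "13 * l\<^sup>2 \<noteq> 182 + 2 * (w::rat)\<^sup>2"
proof
  assume eq: "13 * l\<^sup>2 = 182 + 2 * w\<^sup>2"
  obtain p q d where d: "d \<noteq> 0" "l = of_int p / of_int d" "w = of_int q / of_int d"
    using rat_common_denominator .
  have "rat_of_int (13 * p\<^sup>2 + (- 2) * q\<^sup>2) = of_int (7 * 26 * d\<^sup>2)"
    using eq d(1) by (simp add: d(2,3) power_divide divide_simps)
  hence int: "13 * p\<^sup>2 + (- 2) * q\<^sup>2 = 7 * 26 * d\<^sup>2" by (simp only: of_int_eq_iff)
  have "d = 0"
  proof (rule descent_7[OF _ _ int])
    fix x z :: int assume "7 dvd 13 * x\<^sup>2 + (- 2) * z\<^sup>2"
    from dvd_diff[OF dvd_mult[OF this] dvd_triv_left]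
    have "7 dvd 3 * (13 * x\<^sup>2 + (- 2) * z\<^sup>2) - 7 * (5 * x\<^sup>2 - z\<^sup>2)" .
    also have "\<dots> = (2 * x)\<^sup>2 + z\<^sup>2" by (simp add: power_mult_distrib)
    finally show "7 dvd x \<and> 7 dvd z" using dvd7_sum_squares[of "2 * x" z] by presburger
  qed simp
  thus False using d(1) by simp
qed

section \<open>The block equation for functions constant on orbits\<close>

context fin_action
begin

lemma sum_over_orbits:
  fixes f :: "'e \<Rightarrow> 'r::comm_monoid_add"
  assumes "subgroup H G"
  shows "(\<Sum>x\<in>E. f x) = (\<Sum>\<omega>\<in>orb H ` E. \<Sum>x\<in>\<omega>. f x)"
proof -
  have "\<Union> (orb H ` E) = E"
    using orb_subset[OF invariant_E[OF assms]] self_in_orb[OF assms] by blast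
  moreover have "\<forall>A\<in>orb H ` E. finite A"
    using orb_subset[OF invariant_E[OF assms]] finite_E finite_subset by blast
  moreover have "\<forall>A\<in>orb H ` E. \<forall>B\<in>orb H ` E. A \<noteq> B \<longrightarrow> A \<inter> B = {}"
    using orb_disjoint[OF assms] by blast
  ultimately show ?thesis using sum.Union_disjoint[of "orb H ` E" f] by simp
qed

text \<open>With the fixed elements first, the length of an orbit depends only on its index. Points
  and blocks have equally many fixed elements, so both can be numbered with the same
  weights.\<close>

lemma prime_orbit_enumeration:
  assumes K: "subgroup K G" "prime (card K)" and E: "card E = card (fixed K) + card K * g"
  obtains \<omega> where "bij_betw \<omega> {..<card (fixed K) + g} (orb K ` E)"
    "\<And>k. k < card (fixed K) \<Longrightarrow> card (\<omega> k) = 1"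
    "\<And>k. card (fixed K) \<le> k \<Longrightarrow> k < card (fixed K) + g \<Longrightarrow> card (\<omega> k) = card K"
proof -
  let ?f = "card (fixed K)" and ?A = "orb K ` fixed K" and ?B = "orb K ` (E - fixed K)"
  have A1: "card a = 1" if "a \<in> ?A" for a
    using that orb_fixed_iff[OF K(1)] fixed_subset by auto
  have Bq: "card b = card K" if "b \<in> ?B" for b
    using that prime_order_orb[OF K] by auto
  have q: "card K \<ge> 2" using prime_ge_2_nat[OF K(2)] .
  have "inj_on (orb K) (fixed K)"
    by (rule inj_onI) (metis A1 card_1_singletonE fixed_subset imageI self_in_orb[OF K(1)] singletonD subsetD)
  hence cA: "card ?A = ?f" by (rule card_image)
  have inv: "invariant K (E - fixed K)" using invariant_nonfixed[OF K(1) invariant_E[OF K(1)]] .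
  have un: "\<Union> ?B = E - fixed K"
    using orb_subset[OF inv] self_in_orb[OF K(1)] by blast
  have "card K * card ?B = card (\<Union> ?B)"
  proof (rule card_partition)
    show "c \<inter> d = {}" if "c \<in> ?B" "d \<in> ?B" "c \<noteq> d" for c d
      using that orb_disjoint[OF K(1)] by blast
  qed (use un Bq finite_E in auto)
  moreover have "card (E - fixed K) = card K * g"
    using E card_Diff_subset[OF finite_fixed fixed_subset] by simp
  ultimately have cB: "card ?B = g" using un q by simp
  obtain h1 where h1: "bij_betw h1 {0..<?f} ?A" using ex_bij_betw_nat_finite[of ?A] cA finite_E by auto
  obtain h2 where h2: "bij_betw h2 {0..<g} ?B" using ex_bij_betw_nat_finite[of ?B] cB finite_E by auto
  define \<omega> where "\<omega> k = (if k < ?f then h1 k else h2 (k - ?f))" for k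
  have "bij_betw \<omega> ({..<?f} \<union> {?f..<?f + g}) (?A \<union> ?B)"
  proof (rule bij_betw_combine)
    show "bij_betw \<omega> {..<?f} ?A"
      using h1 unfolding lessThan_atLeast0 by (rule bij_betw_cong[THEN iffD1, rotated]) (simp add: \<omega>_def)
    have "bij_betw (\<lambda>k. k - ?f) {?f..<?f + g} {0..<g}"
      by (rule bij_betw_byWitness[where f' = "\<lambda>k. k + ?f"]) auto
    from bij_betw_trans[OF this h2] show "bij_betw \<omega> {?f..<?f + g} ?B"
      by (rule bij_betw_cong[THEN iffD1, rotated]) (simp add: \<omega>_def)
    show "?A \<inter> ?B = {}" using A1 Bq q by fastforce
  qed
  moreover have "{..<?f} \<union> {?f..<?f + g} = {..<?f + g}" by auto
  moreover have "?A \<union> ?B = orb K ` E" using fixed_subset[of K] by blast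
  ultimately have bij: "bij_betw \<omega> {..<?f + g} (orb K ` E)" by simp
  show thesis
  proof (rule that[OF bij])
    show "card (\<omega> k) = 1" if "k < ?f" for k
      using that A1 bij_betwE[OF h1] by (simp add: \<omega>_def)
    show "card (\<omega> k) = card K" if "?f \<le> k" "k < ?f + g" for k
      using that Bq bij_betwE[OF h2] by (simp add: \<omega>_def)
  qed
qed

end

context biplane_group
begin

text \<open>The entry of the orbit matrix at a block orbit and a point orbit; by
  \<open>orbit_meet_eq\<close> it does not depend on the block chosen.\<close>

definition orbit_meet :: "'p set set \<Rightarrow> 'p set \<Rightarrow> nat" where
  "orbit_meet \<beta> \<omega> = card ((SOME b. b \<in> \<beta>) \<inter> \<omega>)"

lemma card_meet_act:
  assumes "g \<in> carrier G" "b \<subseteq> P" "\<omega> \<subseteq> P"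
  shows "card (act g ` b \<inter> act g ` \<omega>) = card (b \<inter> \<omega>)"
  using card_act_image[OF assms(1), of "b \<inter> \<omega>"] act_image_Int[OF assms] assms(2) by auto

lemma act_orb_eq:
  assumes "subgroup H G" "x \<in> P" "g \<in> H"
  shows "act g ` pt.orb H x = pt.orb H x"
proof (rule card_subset_eq)
  note g = subgroup.mem_carrier[OF assms(1,3)]
  have sub: "pt.orb H x \<subseteq> P" using pt.orb_subset[OF pt.invariant_E[OF assms(1)] assms(2)] .
  show "finite (pt.orb H x)" using sub finite_subset finite_points by blast
  show "act g ` pt.orb H x \<subseteq> pt.orb H x"
  proof
    fix z assume "z \<in> act g ` pt.orb H x"
    then obtain h where h: "h \<in> H" "z = act g (act h x)" by (auto simp: pt.orb_def)
    hence "z = act (g \<otimes> h) x"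
      using pt.act_mult[OF g subgroup.mem_carrier[OF assms(1) h(1)] assms(2)] by simp
    thus "z \<in> pt.orb H x" using subgroup.m_closed[OF assms(1,3) h(1)] by (auto simp: pt.orb_def)
  qed
  show "card (act g ` pt.orb H x) = card (pt.orb H x)" by (rule card_act_image[OF g sub])
qed

lemma orbit_meet_eq:
  assumes K: "subgroup K G" and \<beta>: "\<beta> \<in> bl.orb K ` BB" "b \<in> \<beta>" and \<omega>: "\<omega> \<in> pt.orb K ` P"
  shows "card (b \<inter> \<omega>) = orbit_meet \<beta> \<omega>"
proof -
  obtain x where x: "x \<in> P" "\<omega> = pt.orb K x" using \<omega> by auto
  obtain d where d: "d \<in> BB" "\<beta> = bl.orb K d" using \<beta> by auto
  have \<omega>P: "\<omega> \<subseteq> P" using pt.orb_subset[OF pt.invariant_E[OF K] x(1)] x(2) by simp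
  have *: "card (c \<inter> \<omega>) = card (d \<inter> \<omega>)" if c: "c \<in> \<beta>" for c
  proof -
    obtain g where g: "g \<in> K" "c = act g ` d" using c d by (auto simp: bl.orb_def)
    show ?thesis
      using card_meet_act[OF subgroup.mem_carrier[OF K g(1)] block_subset[OF d(1)] \<omega>P]
        act_orb_eq[OF K x(1) g(1)] g(2) x(2) by simp
  qed
  show ?thesis unfolding orbit_meet_def using *[OF \<beta>(2)] *[OF someI[of "\<lambda>b. b \<in> \<beta>", OF \<beta>(2)]] by simp
qed

text \<open>\<open>block_form\<close> for functions constant on orbits, whose sum over a block
  depends only on the orbit of the block. The bilinear version serves the dihedral case, which needs
  inner products of different basis functions.\<close>

lemma orbit_form:
  fixes u v :: "'p set \<Rightarrow> 'r::comm_ring_1"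
  assumes K: "subgroup K G"
  defines "OP \<equiv> pt.orb K ` P" and "OB \<equiv> bl.orb K ` BB"
  shows "(\<Sum>\<beta>\<in>OB. of_nat (card \<beta>) * ((\<Sum>\<omega>\<in>OP. of_nat (orbit_meet \<beta> \<omega>) * u \<omega>) * (\<Sum>\<omega>\<in>OP. of_nat (orbit_meet \<beta> \<omega>) * v \<omega>)))
    = 14 * (\<Sum>\<omega>\<in>OP. of_nat (card \<omega>) * (u \<omega> * v \<omega>))
      + 2 * (\<Sum>\<omega>\<in>OP. of_nat (card \<omega>) * u \<omega>) * (\<Sum>\<omega>\<in>OP. of_nat (card \<omega>) * v \<omega>)"
proof -
  have finOP: "finite OP" unfolding OP_def by simp
  have mem: "x \<in> \<omega> \<Longrightarrow> pt.orb K x = \<omega>" if "\<omega> \<in> OP" for x \<omega>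
    using that pt.orb_eq[OF K] by (auto simp: OP_def)
  have subP: "\<omega> \<subseteq> P" if "\<omega> \<in> OP" for \<omega>
    using that pt.orb_subset[OF pt.invariant_E[OF K]] by (auto simp: OP_def)
  have block_sum: "(\<Sum>p\<in>b. w (pt.orb K p)) = (\<Sum>\<omega>\<in>OP. of_nat (orbit_meet \<beta> \<omega>) * w \<omega>)"
    if b: "\<beta> \<in> OB" "b \<in> \<beta>" for b \<beta> and w :: "'p set \<Rightarrow> 'r"
  proof -
    have bB: "b \<in> BB" using b bl.orb_subset[OF bl.invariant_E[OF K]] by (auto simp: OB_def)
    have "(\<Sum>p\<in>b. w (pt.orb K p)) = (\<Sum>p\<in>P. if p \<in> b then w (pt.orb K p) else 0)"
      using block_subset[OF bB] by (simp add: sum.If_cases Int_absorb1)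
    also have "\<dots> = (\<Sum>\<omega>\<in>OP. \<Sum>p\<in>\<omega>. if p \<in> b then w (pt.orb K p) else 0)"
      unfolding OP_def by (rule pt.sum_over_orbits[OF K])
    also have "\<dots> = (\<Sum>\<omega>\<in>OP. of_nat (orbit_meet \<beta> \<omega>) * w \<omega>)"
    proof (rule sum.cong[OF refl])
      fix \<omega> assume \<omega>: "\<omega> \<in> OP"
      have "finite \<omega>" using subP[OF \<omega>] finite_subset finite_points by blast
      hence "(\<Sum>p\<in>\<omega>. if p \<in> b then w (pt.orb K p) else 0) = (\<Sum>p\<in>b \<inter> \<omega>. w (pt.orb K p))"
        by (simp add: sum.If_cases Int_commute)
      also have "\<dots> = (\<Sum>p\<in>b \<inter> \<omega>. w \<omega>)" by (rule sum.cong) (use mem[OF \<omega>] in auto)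
      finally show "(\<Sum>p\<in>\<omega>. if p \<in> b then w (pt.orb K p) else 0) = of_nat (orbit_meet \<beta> \<omega>) * w \<omega>"
        using orbit_meet_eq[OF K, of \<beta> b \<omega>] b \<omega> by (simp add: OP_def OB_def)
    qed
    finally show ?thesis .
  qed
  have point_sum: "(\<Sum>p\<in>P. w (pt.orb K p)) = (\<Sum>\<omega>\<in>OP. of_nat (card \<omega>) * w \<omega>)" for w :: "'p set \<Rightarrow> 'r"
  proof -
    have "(\<Sum>p\<in>P. w (pt.orb K p)) = (\<Sum>\<omega>\<in>OP. \<Sum>p\<in>\<omega>. w (pt.orb K p))"
      unfolding OP_def by (rule pt.sum_over_orbits[OF K])
    also have "\<dots> = (\<Sum>\<omega>\<in>OP. \<Sum>p\<in>\<omega>. w \<omega>)" by (intro sum.cong refl) (simp add: mem)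
    finally show ?thesis by simp
  qed
  let ?L = "\<lambda>w b. \<Sum>p\<in>b. w (pt.orb K p)"
  have "(\<Sum>b\<in>BB. ?L u b * ?L v b) = (\<Sum>\<beta>\<in>OB. \<Sum>b\<in>\<beta>. ?L u b * ?L v b)"
    unfolding OB_def by (rule bl.sum_over_orbits[OF K])
  also have "\<dots> = (\<Sum>\<beta>\<in>OB. of_nat (card \<beta>) * ((\<Sum>\<omega>\<in>OP. of_nat (orbit_meet \<beta> \<omega>) * u \<omega>) * (\<Sum>\<omega>\<in>OP. of_nat (orbit_meet \<beta> \<omega>) * v \<omega>)))"
    by (intro sum.cong refl) (simp add: block_sum)
  finally show ?thesis
    using block_form[of "\<lambda>p. u (pt.orb K p)" "\<lambda>p. v (pt.orb K p)"]
      point_sum[of "\<lambda>\<omega>. u \<omega> * v \<omega>"] point_sum[of u] point_sum[of v] by simp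
qed

lemma orbit_matrix:
  assumes K: "subgroup K G" "prime (card K)" and fg: "121 = card (pt.fixed K) + card K * g"
  defines "f \<equiv> card (pt.fixed K)" and "w \<equiv> \<lambda>k. if k < card (pt.fixed K) then 1 else of_nat (card K) :: rat"
  obtains N :: "nat \<Rightarrow> nat \<Rightarrow> rat" where
    "\<And>u. (\<Sum>i<f + g. w i * (\<Sum>k<f + g. N i k * u k)\<^sup>2) = 14 * (\<Sum>k<f + g. w k * (u k)\<^sup>2) + 2 * (\<Sum>k<f + g. w k * u k)\<^sup>2"
proof -
  have feq: "card (bl.fixed K) = f" using card_fixed_eq[OF K] by (simp add: f_def)
  have Pfg: "card P = card (pt.fixed K) + card K * g" using fg card_points by simp
  have Bfg: "card BB = card (bl.fixed K) + card K * g" using Pfg card_points card_blocks feq f_def by simp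
  obtain \<omega> where \<omega>: "bij_betw \<omega> {..<f + g} (pt.orb K ` P)"
    "\<And>k. k < f \<Longrightarrow> card (\<omega> k) = 1" "\<And>k. f \<le> k \<Longrightarrow> k < f + g \<Longrightarrow> card (\<omega> k) = card K"
    using pt.prime_orbit_enumeration[OF K Pfg] unfolding f_def by blast
  obtain \<beta> where \<beta>: "bij_betw \<beta> {..<f + g} (bl.orb K ` BB)"
    "\<And>k. k < f \<Longrightarrow> card (\<beta> k) = 1" "\<And>k. f \<le> k \<Longrightarrow> k < f + g \<Longrightarrow> card (\<beta> k) = card K"
    using bl.prime_orbit_enumeration[OF K Bfg] unfolding feq by blast
  have w\<omega>: "of_nat (card (\<omega> k)) = w k" and w\<beta>: "of_nat (card (\<beta> k)) = w k" if "k < f + g" for k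
    using that \<omega>(2,3)[of k] \<beta>(2,3)[of k] by (auto simp: w_def f_def)
  show thesis
  proof (rule that[of "\<lambda>i k. of_nat (orbit_meet (\<beta> i) (\<omega> k))"])
    fix u :: "nat \<Rightarrow> rat"
    define u' where "u' = (\<lambda>z. u (the_inv_into {..<f + g} \<omega> z))"
    have u': "u' (\<omega> k) = u k" if "k < f + g" for k
      using the_inv_into_f_f[of \<omega> "{..<f + g}" k] \<omega>(1) that by (simp add: u'_def bij_betw_def)
    have re: "(\<Sum>z\<in>pt.orb K ` P. h z) = (\<Sum>k<f + g. h (\<omega> k))" for h :: "'p set \<Rightarrow> rat"
      using sum.reindex_bij_betw[OF \<omega>(1), of h] by simp
    have reb: "(\<Sum>z\<in>bl.orb K ` BB. h z) = (\<Sum>k<f + g. h (\<beta> k))" for h :: "'p set set \<Rightarrow> rat"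
      using sum.reindex_bij_betw[OF \<beta>(1), of h] by simp
    show "(\<Sum>i<f + g. w i * (\<Sum>k<f + g. of_nat (orbit_meet (\<beta> i) (\<omega> k)) * u k)\<^sup>2)
      = 14 * (\<Sum>k<f + g. w k * (u k)\<^sup>2) + 2 * (\<Sum>k<f + g. w k * u k)\<^sup>2"
      using orbit_form[OF K(1), of u' u'] unfolding re reb
      by (simp add: u' w\<omega> w\<beta> power2_eq_square mult.assoc)
  qed
qed

text \<open>For no e up to 4 does 11 divide 16 - e, so no block is fixed and all 11 orbits have
  length 11. Once each form \<open>L i\<close> equals its coordinate up to sign, the unknown squares
  cancel, and 154 u^2 = 11 + 2 w^2 remains, where u is the last of the twelve transformed
  coordinates.\<close>

lemma no_subgroup_11:
  assumes K: "subgroup K G" "card K = 11" shows False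
proof -
  have p: "prime (card K)" "card K \<noteq> 2" using K(2) by auto
  have "bl.fixed K = {}" using prime_order_cases[OF K(1) p] K(2) by fastforce
  hence f0: "card (pt.fixed K) = 0" using card_fixed_eq[OF K(1) p(1)] by simp
  obtain N :: "nat \<Rightarrow> nat \<Rightarrow> rat" where N: "\<And>u. (\<Sum>i<11. 11 * (\<Sum>k<11. N i k * u k)\<^sup>2)
      = 14 * (\<Sum>k<11. 11 * (u k)\<^sup>2) + 2 * (\<Sum>k<11. 11 * u k)\<^sup>2"
    using orbit_matrix[OF K(1) p(1), of 11] f0 K(2) by auto
  \<comment> \<open>Hamilton's identity needs a multiple of four variables, so the eleven free ones
    are completed by a 1.\<close>
  define Y :: "(nat \<Rightarrow> rat) \<Rightarrow> nat \<Rightarrow> rat" where "Y = (\<lambda>y i. if i < 11 then y i else 1)"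
  define L where "L = (\<lambda>i y. \<Sum>k<11. N i k * hamilton14 (Y y) k)"
  have "affine_form 11 (L i)" for i
    unfolding L_def Y_def
    by (intro affine_form_sum affine_form_scale affine_form_hamilton14) auto
  then obtain y where y: "\<And>i. i < 11 \<Longrightarrow> (L i y)\<^sup>2 = (y i)\<^sup>2" using affine_forms_square_eq[of 11 L] by blast
  let ?u = "hamilton14 (Y y)"
  have h: "14 * (\<Sum>k<12. (?u k)\<^sup>2) = (\<Sum>k<12. (Y y k)\<^sup>2)"
    using hamilton14_square[of "Y y" 0] hamilton14_square[of "Y y" 1] hamilton14_square[of "Y y" 2]
    unfolding sum_lessThan_12 by (simp add: numeral_2_eq_2)
  have s12: "(\<Sum>k<12. g k) = (\<Sum>k<11. g k) + g 11" for g :: "nat \<Rightarrow> rat"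
    using sum.lessThan_Suc[of g 11] by simp
  have "(\<Sum>i<11. (L i y)\<^sup>2) = (\<Sum>i<11. (Y y i)\<^sup>2)" by (rule sum.cong) (auto simp: y Y_def)
  hence "11 * (\<Sum>i<11. (Y y i)\<^sup>2) = 11 * (14 * (\<Sum>k<11. (?u k)\<^sup>2)) + 2 * (\<Sum>k<11. 11 * ?u k)\<^sup>2"
    using N[of ?u] by (simp add: L_def flip: sum_distrib_left)
  moreover have "14 * (\<Sum>k<11. (?u k)\<^sup>2) = (\<Sum>k<11. (Y y k)\<^sup>2) + 1 - 14 * (?u 11)\<^sup>2"
    using h unfolding s12 by (simp add: Y_def)
  ultimately have "154 * (?u 11)\<^sup>2 = 11 + 2 * (\<Sum>k<11. 11 * ?u k)\<^sup>2" by simp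
  thus False using no_rat_11 by blast
qed

text \<open>There are 4 fixed points and 9 orbits of length 13. In this order the weights are
  constant on the quadruples 0-3, 4-7 and 8-11, so Hamilton's identity applies to the weighted
  squares. Twelve equations cancel the twelve free squares, and the remaining form l gives 13 l^2 =
  182 + 2 w^2 with 182 = 14 * 13.\<close>

lemma no_subgroup_13:
  assumes K: "subgroup K G" "card K = 13" shows False
proof -
  have p: "prime (card K)" "card K \<noteq> 2" using K(2) by auto
  obtain B where B: "B \<in> bl.fixed K" using exists_fixed_block[OF K(1), of 13 1] K(2) by auto
  have f4: "card (pt.fixed K) = 4"
    using prime_order_cases[OF K(1) p B] card_fixed_odd[OF K(1) p B] K(2) by (simp add: choose_two)
  define w :: "nat \<Rightarrow> rat" where "w k = (if k < 4 then 1 else 13)" for k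
  obtain N :: "nat \<Rightarrow> nat \<Rightarrow> rat" where N: "\<And>u. (\<Sum>i<13. w i * (\<Sum>k<13. N i k * u k)\<^sup>2)
      = 14 * (\<Sum>k<13. w k * (u k)\<^sup>2) + 2 * (\<Sum>k<13. w k * u k)\<^sup>2"
    using orbit_matrix[OF K(1) p(1), of 9] unfolding f4 K(2) w_def of_nat_numeral by auto
  define Y :: "(nat \<Rightarrow> rat) \<Rightarrow> nat \<Rightarrow> rat" where "Y = (\<lambda>y i. if i < 12 then y i else 1)"
  \<comment> \<open>The leftover coordinate 12 is not transformed but set to 1; only twelve
    variables are free.\<close>
  define U where "U = (\<lambda>y k. if k < 12 then hamilton14 (Y y) k else 1)"
  define L where "L = (\<lambda>i y. \<Sum>k<13. N i k * U y k)"
  have "affine_form 12 (\<lambda>y. U y k)" for k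
    unfolding U_def Y_def by (cases "k < 12") (auto intro!: affine_form_const affine_form_hamilton14)
  hence "affine_form 12 (L i)" for i
    unfolding L_def by (intro affine_form_sum affine_form_scale) auto
  then obtain y where y: "\<And>i. i < 12 \<Longrightarrow> (L i y)\<^sup>2 = (y i)\<^sup>2" using affine_forms_square_eq[of 12 L] by blast
  have h: "14 * (\<Sum>k<12. w k * (U y k)\<^sup>2) = (\<Sum>k<12. w k * (y k)\<^sup>2)"
    using hamilton14_square[of "Y y" 0] hamilton14_square[of "Y y" 1] hamilton14_square[of "Y y" 2]
    unfolding sum_lessThan_12 by (simp add: w_def U_def Y_def numeral_2_eq_2)
  have s13: "(\<Sum>k<13. g k) = (\<Sum>k<12. g k) + g 12" for g :: "nat \<Rightarrow> rat"
    using sum.lessThan_Suc[of g 12] by simp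
  have ww: "w k = (if k < 4 then 1 else 13)" for k by (simp add: w_def)
  have "(\<Sum>i<12. w i * (L i y)\<^sup>2) = (\<Sum>i<12. w i * (y i)\<^sup>2)" by (rule sum.cong) (auto simp: y)
  moreover have "(\<Sum>i<13. w i * (L i y)\<^sup>2) = 14 * (\<Sum>k<13. w k * (U y k)\<^sup>2) + 2 * (\<Sum>k<13. w k * U y k)\<^sup>2"
    using N[of "U y"] by (simp add: L_def)
  moreover have "w 12 = 13" "U y 12 = 1" by (simp_all add: w_def U_def)
  ultimately have "13 * (L 12 y)\<^sup>2 = 182 + 2 * (\<Sum>k<13. w k * U y k)\<^sup>2"
    using h s13[of "\<lambda>i. w i * (L i y)\<^sup>2"] s13[of "\<lambda>i. w i * (U y i)\<^sup>2"] by simp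
  thus False using no_rat_13 by blast
qed

text \<open>Without a fixed block the prime divides 121 and is 11; otherwise
  \<open>prime_order_cases\<close> leaves 13 as the only large prime.\<close>

lemma prime_order_le_7:
  assumes K: "subgroup K G" "prime (card K)"
  shows "card K \<in> {2, 3, 5, 7}"
proof (cases "bl.fixed K = {}")
  case True
  hence "card K dvd card BB"
    using bl.p_group_nonfixed[OF K(1,2) _ bl.invariant_E[OF K(1)], of 1] by simp
  hence "card K dvd 11 ^ 2" by (simp add: card_blocks)
  moreover have "prime (11::nat)" by simp
  ultimately have "card K = 11" using K(2) prime_dvd_power primes_dvd_imp_eq by blast
  thus ?thesis using no_subgroup_11[OF K(1)] by simp
next
  case False
  then obtain B where "B \<in> bl.fixed K" by auto
  thus ?thesis using prime_order_cases[OF K, of B] no_subgroup_13[OF K(1)] by auto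
qed

end

section \<open>Dihedral groups of order 14\<close>

text \<open>Kept free of any group because it is applied to points, to orbits of points or blocks,
  and to blocks.\<close>

lemma involution_transversal:
  assumes "finite A" "\<And>a. a \<in> A \<Longrightarrow> \<sigma> a \<in> A" "\<And>a. a \<in> A \<Longrightarrow> \<sigma> (\<sigma> a) = a" "\<And>a. a \<in> A \<Longrightarrow> \<sigma> a \<noteq> a"
  shows "\<exists>R. R \<inter> \<sigma> ` R = {} \<and> R \<union> \<sigma> ` R = A \<and> card A = 2 * card R"
  using assms
proof (induction "card A" arbitrary: A rule: less_induct)
  case less
  note fin = less.prems(1) and cl = less.prems(2) and inv = less.prems(3) and nf = less.prems(4)
  show ?case
  proof (cases "A = {}")
    case False
    then obtain a where a: "a \<in> A" by auto
    let ?A = "A - {a, \<sigma> a}"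
    have cA: "card A = 2 + card ?A"
    proof -
      have "card {a, \<sigma> a} = 2" using nf[OF a] by auto
      moreover have "{a, \<sigma> a} \<subseteq> A" using a cl by auto
      ultimately show ?thesis
        using fin card_Diff_subset[of "{a, \<sigma> a}" A] card_mono[of A "{a, \<sigma> a}"] by simp
    qed
    have "\<exists>R. R \<inter> \<sigma> ` R = {} \<and> R \<union> \<sigma> ` R = ?A \<and> card ?A = 2 * card R"
    proof (rule less.hyps)
      show "\<sigma> b \<in> ?A" if "b \<in> ?A" for b
        using that cl inv by (metis DiffD1 DiffD2 DiffI a insertE insertI1 insertI2 singletonD)
    qed (use cA fin inv nf in auto)
    then obtain R where R: "R \<inter> \<sigma> ` R = {}" "R \<union> \<sigma> ` R = ?A" "card ?A = 2 * card R" by blast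
    have "finite R" using R(2) fin by (metis finite_Diff finite_Un)
    moreover have "a \<notin> R" using R(2) by auto
    ultimately have "card A = 2 * card (insert a R)" using cA R(3) by simp
    moreover have "insert a R \<inter> \<sigma> ` insert a R = {}" using R(1,2) nf[OF a] by auto
    moreover have "insert a R \<union> \<sigma> ` insert a R = A" using R(2) a cl[OF a] by auto
    ultimately show ?thesis by blast
  qed (simp add: exI[of _ "{}"])
qed

lemma card_filter_compl:
  "finite A \<Longrightarrow> card {x \<in> A. R x} + card {x \<in> A. \<not> R x} = card A"
  by (subst card_Un_disjoint[symmetric]) (auto intro: arg_cong[where f = card])

text \<open>Comparison of the exponents of 2 in the determinants.\<close>

lemma no_odd_similitude_14:
  fixes N :: "nat \<Rightarrow> nat \<Rightarrow> int" and c w :: "nat \<Rightarrow> int"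
  assumes odd: "\<And>i. i < d \<Longrightarrow> odd (c i)" "\<And>i. i < d \<Longrightarrow> odd (w i)" "odd d"
    and sim: "\<And>i j. i < d \<Longrightarrow> j < d \<Longrightarrow> (\<Sum>k<d. c k * (N k i * N k j)) = (if i = j then 14 * w i else 0)"
  shows False
proof -
  define M where "M = mat d d (\<lambda>(k, i). N k i)"
  define C where "C = mat d d (\<lambda>(k, i). if k = i then c i else 0)"
  define W where "W = mat d d (\<lambda>(k, i). if k = i then 14 * w i else 0)"
  have car: "M \<in> carrier_mat d d" "C \<in> carrier_mat d d" "W \<in> carrier_mat d d" "C * M \<in> carrier_mat d d"
    "transpose_mat M \<in> carrier_mat d d"
    by (auto simp: M_def C_def W_def)
  have CM: "(C * M) $$ (k, j) = c k * N k j" if "k < d" "j < d" for k j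
  proof -
    have "(C * M) $$ (k, j) = (\<Sum>i = 0..<d. (if k = i then c i else 0) * N i j)"
      using that by (simp add: C_def M_def scalar_prod_def)
    also have "\<dots> = (\<Sum>i = 0..<d. if k = i then c i * N i j else 0)" by (rule sum.cong) auto
    finally show ?thesis using that by simp
  qed
  have "transpose_mat M * (C * M) = W"
  proof (rule eq_matI)
    fix i j assume "i < dim_row W" "j < dim_col W"
    hence ij: "i < d" "j < d" by (simp_all add: W_def)
    have "(transpose_mat M * (C * M)) $$ (i, j) = (\<Sum>k = 0..<d. N k i * (C * M) $$ (k, j))"
      using ij car by (simp add: scalar_prod_def M_def)
    also have "\<dots> = (\<Sum>k<d. c k * (N k i * N k j))"
      by (rule sum.cong) (auto simp: CM ij mult.left_commute)
    finally show "(transpose_mat M * (C * M)) $$ (i, j) = W $$ (i, j)"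
      using sim ij by (simp add: W_def)
  qed (use car in auto)
  hence "det W = det (transpose_mat M) * (det C * det M)"
    using det_mult[OF car(5,4)] det_mult[OF car(2,1)] by simp
  hence "det W = det C * (det M)\<^sup>2"
    using det_transpose[OF car(1)] by (simp add: power2_eq_square mult.left_commute)
  moreover have "det C = (\<Prod>i = 0..<d. c i)"
    using det_upper_triangular[of C d] car(2) unfolding prod_list_diag_prod by (auto simp: C_def upper_triangular_def)
  moreover have "det W = (\<Prod>i = 0..<d. 14 * w i)"
    using det_upper_triangular[of W d] car(3) unfolding prod_list_diag_prod by (auto simp: W_def upper_triangular_def)
  moreover have "(\<Prod>i = 0..<d. 14 * w i) = 2 ^ d * (7 ^ d * (\<Prod>i = 0..<d. w i))"
    by (simp add: prod.distrib flip: power_mult_distrib)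
  ultimately have eq: "2 ^ d * (7 ^ d * (\<Prod>i = 0..<d. w i)) = (\<Prod>i = 0..<d. c i) * (det M)\<^sup>2" by simp
  have two: "prime_elem (2::int)" by simp
  have oc: "odd (\<Prod>i = 0..<d. c i)" using odd(1) by (subst prime_dvd_prod_iff) auto
  have "odd (\<Prod>i = 0..<d. w i)" using odd(2) by (subst prime_dvd_prod_iff) auto
  hence ow: "odd (7 ^ d * (\<Prod>i = 0..<d. w i))" by simp
  have nz: "7 ^ d * (\<Prod>i = 0..<d. w i) \<noteq> 0" "(\<Prod>i = 0..<d. c i) \<noteq> 0" using ow oc by (metis even_zero)+
  hence "det M \<noteq> 0" using eq by (metis mult_zero_right mult_eq_0_iff power_eq_0_iff zero_neq_numeral zero_power2)
  hence "multiplicity 2 ((\<Prod>i = 0..<d. c i) * (det M)\<^sup>2) = 2 * multiplicity 2 (det M)"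
    using nz oc by (simp add: prime_elem_multiplicity_mult_distrib prime_elem_multiplicity_power_distrib not_dvd_imp_multiplicity_0)
  moreover have "multiplicity 2 (2 ^ d * (7 ^ d * (\<Prod>i = 0..<d. w i))) = d"
    using prime_elem_multiplicity_mult_distrib[OF two, of "2 ^ d"] nz(1) not_dvd_imp_multiplicity_0[OF ow]
    by (simp add: multiplicity_same_power')
  ultimately have "d = 2 * multiplicity 2 (det M)" using eq by simp
  thus False using odd(3) by (metis dvd_triv_left)
qed

context fin_action
begin

lemma orb_card_prime:
  assumes "subgroup K G" "prime (card K)" "w \<in> orb K ` E"
  shows "card w = 1 \<or> card w = card K"
proof -
  obtain x where "x \<in> E" "w = orb K x" using assms(3) by auto
  thus ?thesis
    using orb_fixed_iff[OF assms(1)] prime_order_orb[OF assms(1,2)] by (cases "x \<in> fixed K") auto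
qed

lemma act_dihedral:
  assumes S: "subgroup S G" "s \<in> S" and g: "g \<in> carrier G" "g \<otimes> s = inv s \<otimes> g" and x: "x \<in> E"
  shows "act g (act s x) = act (inv s) (act g x)"
proof -
  note s = subgroup.mem_carrier[OF S]
  have "act g (act s x) = act (inv s \<otimes> g) x" using act_mult[OF g(1) s x] g(2) by simp
  thus ?thesis using act_mult[OF inv_closed[OF s] g(1) x] by simp
qed

lemma act_orb_dihedral:
  assumes S: "subgroup S G" and g: "g \<in> carrier G" and dih: "\<And>s. s \<in> S \<Longrightarrow> g \<otimes> s = inv s \<otimes> g"
    and x: "x \<in> E"
  shows "act g ` orb S x = orb S (act g x)"
proof -
  note c = subgroup.mem_carrier[OF S] and i = subgroup.m_inv_closed[OF S]
  have *: "act g (act s x) = act (inv s) (act g x)" if "s \<in> S" for s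
    by (rule act_dihedral[OF S that g dih[OF that] x])
  show ?thesis
  proof
    show "act g ` orb S x \<subseteq> orb S (act g x)" using * i by (auto simp: orb_def)
    show "orb S (act g x) \<subseteq> act g ` orb S x"
    proof
      fix y assume "y \<in> orb S (act g x)"
      then obtain s where s: "s \<in> S" "y = act s (act g x)" by (auto simp: orb_def)
      hence "y = act g (act (inv s) x)" using *[OF i[OF s(1)]] c by simp
      thus "y \<in> act g ` orb S x" using i[OF s(1)] by (auto simp: orb_def)
    qed
  qed
qed

lemma act_orbit_dihedral:
  assumes S: "subgroup S G" and g: "g \<in> carrier G" and dih: "\<And>s. s \<in> S \<Longrightarrow> g \<otimes> s = inv s \<otimes> g"
    and w: "w \<in> orb S ` E"
  shows "act g ` w \<in> orb S ` E"
proof -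
  obtain x where x: "x \<in> E" "w = orb S x" using w by (rule imageE)
  have "act g ` orb S x = orb S (act g x)" by (rule act_orb_dihedral[OF S g dih x(1)])
  thus ?thesis unfolding x(2) using act_closed[OF g x(1)] by simp
qed

lemma orbit_subset: "subgroup S G \<Longrightarrow> w \<in> orb S ` E \<Longrightarrow> w \<subseteq> E"
  by (metis imageE invariant_E orb_subset)

lemma act_involution:
  assumes "g \<in> carrier G" "g \<otimes> g = \<one>" "x \<in> E"
  shows "act g (act g x) = x"
  using act_mult[OF assms(1,1,3)] assms(2,3) act_one by simp

lemma act_involution_image:
  assumes "g \<in> carrier G" "g \<otimes> g = \<one>" "A \<subseteq> E"
  shows "act g ` act g ` A = A"
proof -
  have "act g (act g x) = x" if "x \<in> A" for x using act_involution[OF assms(1,2)] assms(3) that by blast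
  thus ?thesis by (simp add: image_image)
qed

text \<open>An orbit of \<open>S\<close> that is invariant under the involution \<open>g\<close> contains exactly one fixed
  point of \<open>g\<close>.\<close>

lemma dihedral_orbit_pairs:
  assumes S: "subgroup S G" "card S = 7" and g: "g \<in> carrier G" "g \<otimes> g = \<one>"
    and dih: "\<And>s. s \<in> S \<Longrightarrow> g \<otimes> s = inv s \<otimes> g"
    and E: "card E = 121" "card (fixed S) = 2"
  obtains R where "R \<inter> (`) (act g) ` R = {}" "R \<union> (`) (act g) ` R = {w \<in> orb S ` E. act g ` w \<noteq> w}"
    "2 * card R + card {x \<in> E. act g x = x} = 19"
proof -
  let ?O = "orb S ` E" and ?F = "{x \<in> E. act g x = x}"
  have p: "prime (card S)" using S(2) by simp
  note cS = subgroup.mem_carrier[OF S(1)]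
  note gg = act_involution[OF g]
  have card_O: "card ?O = 19"
  proof -
    \<comment> \<open>121 = 2 + 7 * 17, hence 2 + 17 = 19 orbits.\<close>
    have "card E = card (fixed S) + card S * 17" using E S(2) by simp
    from prime_orbit_enumeration[OF S(1) p this] obtain w :: "nat \<Rightarrow> 'e set"
      where "bij_betw w {..<card (fixed S) + 17} ?O" by blast
    thus ?thesis using bij_betw_same_card E(2) by fastforce
  qed
  have odd_orb: "odd (card w)" if "w \<in> ?O" for w
    using orb_card_prime[OF S(1) p that] S(2) by auto
  have gO: "act g ` w \<in> ?O" if "w \<in> ?O" for w
    by (rule act_orbit_dihedral[OF S(1) g(1) dih that])
  note subE = orbit_subset[OF S(1)]
  note ggO = act_involution_image[OF g subE]
  have "bij_betw (orb S) ?F {w \<in> ?O. act g ` w = w}"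
    unfolding bij_betw_def
  proof
    show "inj_on (orb S) ?F"
    proof (rule inj_onI)
      fix x y assume x: "x \<in> ?F" and y: "y \<in> ?F" and eq: "orb S x = orb S y"
      have "y \<in> orb S x" using eq self_in_orb[OF S(1)] y by auto
      then obtain s where s: "s \<in> S" "y = act s x" by (auto simp: orb_def)
      \<comment> \<open>If x and s x are both fixed by g, then s x = s^-1 x, so s^2 fixes x. As S
        has odd prime order, s = 1 or x is fixed by S.\<close>
      have "y = act g (act s x)" using s y by simp
      also have "\<dots> = act (inv s) (act g x)"
        by (rule act_dihedral[OF S(1) s(1) g(1) dih[OF s(1)]]) (use x in simp)
      also have "\<dots> = act (inv s) x" using x by simp
      finally have "act s (act s x) = x" using act_inv(2)[OF cS[OF s(1)]] x s(2) by auto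
      hence ss: "act (s \<otimes> s) x = x" using act_mult[OF cS[OF s(1)] cS[OF s(1)]] x by simp
      show "x = y"
      proof (cases "s \<otimes> s = \<one>")
        case True
        hence "s = \<one>" using odd_subgroup_square[OF S(1) _ s(1)] S(2) by simp
        thus ?thesis using s(2) act_one x by simp
      next
        case False
        have "x \<in> fixed S"
          by (rule prime_order_fixed[OF S(1) p _ False _ ss]) (use x s subgroup.m_closed[OF S(1)] in auto)
        thus ?thesis using s by (auto simp: fixed_def)
      qed
    qed
    show "orb S ` ?F = {w \<in> ?O. act g ` w = w}"
    proof (intro equalityI subsetI)
      fix w assume "w \<in> orb S ` ?F"
      then obtain x where x: "x \<in> ?F" "w = orb S x" by blast
      hence "act g ` w = w" using act_orb_dihedral[OF S(1) g(1) dih, of x] by simp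
      thus "w \<in> {w \<in> ?O. act g ` w = w}" using x by blast
    next
      fix w assume w: "w \<in> {w \<in> ?O. act g ` w = w}"
      \<comment> \<open>Otherwise g would pair off the points of w, but w has 1 or 7 points.\<close>
      have "\<exists>x\<in>w. act g x = x"
      proof (rule ccontr)
        assume "\<not> ?thesis"
        hence nf: "act g x \<noteq> x" if "x \<in> w" for x using that by blast
        have wE: "w \<subseteq> E" using subE w by simp
        have "act g x \<in> w" if "x \<in> w" for x
          using imageI[OF that, of "act g"] w by simp
        moreover have "act g (act g x) = x" if "x \<in> w" for x using gg[OF subsetD[OF wE that]] .
        ultimately have "\<exists>R. R \<inter> act g ` R = {} \<and> R \<union> act g ` R = w \<and> card w = 2 * card R"
          using nf by (intro involution_transversal) (use finite_subset[OF wE finite_E] in auto)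
        hence "even (card w)" by auto
        thus False using odd_orb w by simp
      qed
      then obtain x where x: "x \<in> w" "act g x = x" by auto
      have wO: "w \<in> ?O" using w by simp
      then obtain y where y: "w = orb S y" "y \<in> E" by (rule imageE)
      have "w = orb S x" using orb_eq[OF S(1) y(2)] x(1) y(1) by simp
      moreover have "x \<in> ?F" using x subsetD[OF subE[OF wO]] by simp
      ultimately show "w \<in> orb S ` ?F" by (rule image_eqI)
    qed
  qed
  hence cF: "card {w \<in> ?O. act g ` w = w} = card ?F" by (rule bij_betw_same_card[symmetric])
  let ?A = "{w \<in> ?O. act g ` w \<noteq> w}"
  have "\<exists>R. R \<inter> (`) (act g) ` R = {} \<and> R \<union> (`) (act g) ` R = ?A \<and> card ?A = 2 * card R"
  proof (rule involution_transversal)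
    show "act g ` w \<in> ?A" if "w \<in> ?A" for w
    proof -
      have w: "w \<in> ?O" "act g ` w \<noteq> w" using that by simp_all
      have "act g ` act g ` w \<noteq> act g ` w" unfolding ggO[OF w(1)] by (rule w(2)[symmetric])
      thus ?thesis using gO[OF w(1)] by simp
    qed
    show "act g ` act g ` w = w" if "w \<in> ?A" for w
    proof -
      have "w \<in> ?O" using that by simp
      thus ?thesis by (rule ggO)
    qed
    show "act g ` w \<noteq> w" if "w \<in> ?A" for w using that by simp
    show "finite ?A" using finite_E by simp
  qed
  then obtain R where R: "R \<inter> (`) (act g) ` R = {}" "R \<union> (`) (act g) ` R = ?A" "card ?A = 2 * card R"
    by (elim exE conjE)
  have "card ?A + card {w \<in> ?O. act g ` w = w} = card ?O"
    using card_filter_compl[of ?O "\<lambda>w. act g ` w = w"] finite_E by (simp add: add.commute)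
  hence "2 * card R + card ?F = 19" unfolding R(3) cF card_O .
  with R(1,2) show thesis by (rule that)
qed

end

context biplane_group
begin

text \<open>On a fixed block, 0 or 2 fixed points give 9 in all, and 4 give 13.\<close>

lemma involution_card_fixed:
  assumes T: "subgroup T G" "card T = 2"
  shows "card (pt.fixed T) \<in> {9, 13}"
    "B \<in> bl.fixed T \<Longrightarrow> card (pt.fixed T) = 9 \<Longrightarrow> nfix B T \<in> {0, 2}"
proof -
  obtain C where C: "C \<in> bl.fixed T" using exists_fixed_block[OF T(1), of 2 1] T(2) by auto
  show "card (pt.fixed T) \<in> {9, 13}"
    using card_fixed_involution(1)[OF T C] fixed_block_card_involution[OF T C] by (auto simp: choose_two)
  show "nfix B T \<in> {0, 2}" if B: "B \<in> bl.fixed T" and 9: "card (pt.fixed T) = 9"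
    using card_fixed_involution(1)[OF T B] fixed_block_card_involution[OF T B] 9 by (auto simp: choose_two)
qed

lemma involution_subgroup:
  assumes "g \<in> carrier G" "g \<otimes> g = \<one>" "g \<noteq> \<one>"
  shows "subgroup {\<one>, g} G" "card {\<one>, g} = 2"
  using assms inv_equality[of g g] by (auto intro!: subgroupI simp: card_2_iff)

text \<open>The functions \<open>u w\<close>, for w in the transversal R, span the functions that
  are constant on S-orbits and negated by g. Their sum over all points vanishes because g preserves
  the lengths of orbits, and this removes the 2 J term. The dimension (19 - f) / 2 is 5 or 3, for
  points and blocks alike.\<close>

lemma no_dihedral_14:
  assumes S: "subgroup S G" "card S = 7" and g: "g \<in> carrier G" "g \<otimes> g = \<one>" "g \<noteq> \<one>"
    and dih: "\<And>s. s \<in> S \<Longrightarrow> g \<otimes> s = inv s \<otimes> g"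
  shows False
proof -
  let ?\<sigma> = "(`) (act g)"
  let ?\<tau> = "(`) ?\<sigma>"
  let ?OP = "pt.orb S ` P" and ?OB = "bl.orb S ` BB"
  have p7: "prime (card S)" using S(2) by simp
  note T = involution_subgroup[OF g]
  have pT: "prime (card {\<one>, g})" unfolding T(2) by simp
  define f where "f = card {x \<in> P. act g x = x}"
  have f: "f \<in> {9, 13}"
    using involution_card_fixed(1)[OF T] prime_order_fixed_eq(1)[OF T(1) pT, of g] g(3) by (simp add: f_def)
  have fB: "card {b \<in> BB. act g ` b = b} = f"
    using card_fixed_points_eq_blocks[OF g(1)] by (simp add: f_def)
  obtain R where R: "R \<inter> ?\<sigma> ` R = {}" "R \<union> ?\<sigma> ` R = {w \<in> ?OP. act g ` w \<noteq> w}" "2 * card R + f = 19"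
    unfolding f_def by (rule pt.dihedral_orbit_pairs[OF S g(1,2) dih card_points fixed_card_7(1)[OF S]])
  obtain Q where Q: "Q \<inter> ?\<tau> ` Q = {}" "Q \<union> ?\<tau> ` Q = {c \<in> ?OB. ?\<sigma> ` c \<noteq> c}" "2 * card Q + f = 19"
    unfolding fB[symmetric] by (rule bl.dihedral_orbit_pairs[OF S g(1,2) dih card_blocks fixed_card_7(2)[OF S]])
  define d where "d = card R"
  have dd: "card R = d" "card Q = d" "odd d" using R(3) Q(3) f by (auto simp: d_def)
  have finOP: "finite ?OP" and finOB: "finite ?OB" by simp_all
  have "R \<subseteq> {w \<in> ?OP. act g ` w \<noteq> w}" unfolding R(2)[symmetric] by (rule Un_upper1)
  hence ROP: "R \<subseteq> ?OP" by blast
  have "Q \<subseteq> {c \<in> ?OB. ?\<sigma> ` c \<noteq> c}" unfolding Q(2)[symmetric] by (rule Un_upper1)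
  hence QOB: "Q \<subseteq> ?OB" by blast
  note OP_sub = pt.orbit_subset[OF S(1)] and OB_sub = bl.orbit_subset[OF S(1)]
  have \<sigma>OP: "?\<sigma> w \<in> ?OP" if "w \<in> ?OP" for w
    by (rule pt.act_orbit_dihedral[OF S(1) g(1) dih that])
  have \<tau>OB: "?\<sigma> ` c \<in> ?OB" if "c \<in> ?OB" for c
    by (rule bl.act_orbit_dihedral[OF S(1) g(1) dih that])
  note \<sigma>\<sigma> = pt.act_involution_image[OF g(1,2) OP_sub] and \<tau>\<tau> = bl.act_involution_image[OF g(1,2) OB_sub]
  have meet: "orbit_meet (?\<sigma> ` c) (?\<sigma> w) = orbit_meet c w" if cw: "c \<in> ?OB" "w \<in> ?OP" for c w
  proof -
    obtain b where b': "c = bl.orb S b" "b \<in> BB" using cw(1) by (rule imageE)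
    hence b: "b \<in> c" and bP: "b \<subseteq> P" using bl.self_in_orb[OF S(1)] block_subset by auto
    have "card (act g ` b \<inter> ?\<sigma> w) = orbit_meet (?\<sigma> ` c) (?\<sigma> w)"
      by (rule orbit_meet_eq[OF S(1) \<tau>OB[OF cw(1)] _ \<sigma>OP[OF cw(2)]]) (use b in auto)
    thus ?thesis
      using card_meet_act[OF g(1) bP OP_sub[OF cw(2)]] orbit_meet_eq[OF S(1) cw(1) b cw(2)] by simp
  qed
  \<comment> \<open>\<open>M c w\<close> is the sum of the function \<open>u w\<close> over a block
    of the orbit c; by \<open>M_anti\<close> it changes sign when g is applied to c.\<close>
  define M :: "'p set set \<Rightarrow> 'p set \<Rightarrow> int"
    where "M c w = int (orbit_meet c w) - int (orbit_meet c (?\<sigma> w))" for c w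
  have M_anti: "M (?\<sigma> ` c) w = - M c w" if "c \<in> ?OB" "w \<in> ?OP" for c w
    using meet[OF that] meet[OF that(1) \<sigma>OP[OF that(2)]] \<sigma>\<sigma>[OF that(2)] by (simp add: M_def)
  define u :: "'p set \<Rightarrow> 'p set \<Rightarrow> int"
    where "u w z = (if z = w then 1 else 0) - (if z = ?\<sigma> w then 1 else 0)" for w z
  have sum_u: "(\<Sum>z\<in>?OP. h z * u w z) = h w - h (?\<sigma> w)" if "w \<in> ?OP" for w and h :: "'p set \<Rightarrow> int"
  proof -
    have "(\<Sum>z\<in>?OP. h z * u w z) = (\<Sum>z\<in>?OP. (if z = w then h z else 0) - (if z = ?\<sigma> w then h z else 0))"
      by (rule sum.cong) (auto simp: u_def)
    thus ?thesis using that \<sigma>OP[OF that] finOP by (simp add: sum_subtractf)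
  qed
  have card_\<sigma>: "card (?\<sigma> w) = card w" if "w \<in> ?OP" for w
    using card_act_image[OF g(1) OP_sub[OF that]] .
  have card_\<tau>: "card (?\<sigma> ` c) = card c" if "c \<in> ?OB" for c
    by (rule card_image) (use bl.act_inj[OF g(1)] OB_sub[OF that] in \<open>auto intro!: inj_onI\<close>)
  \<comment> \<open>28 = 14 * 2, since \<open>u w\<close> is supported on the two orbits w and its
    image under g.\<close>
  have form: "(\<Sum>c\<in>?OB. int (card c) * (M c w * M c w')) = (if w = w' then 28 * int (card w) else 0)"
    if w: "w \<in> R" "w' \<in> R" for w w'
  proof -
    have OP: "w \<in> ?OP" "w' \<in> ?OP" using w ROP by auto
    have "(\<Sum>z\<in>?OP. int (card z) * (u w z * u w' z)) = (\<Sum>z\<in>?OP. (int (card z) * u w z) * u w' z)"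
      by (simp add: mult.assoc)
    also have "\<dots> = int (card w') * u w w' - int (card w') * u w (?\<sigma> w')"
      using sum_u[OF OP(2), of "\<lambda>z. int (card z) * u w z"] card_\<sigma>[OF OP(2)] by simp
    also have "\<dots> = (if w = w' then 2 * int (card w) else 0)"
    proof (cases "w = w'")
      case True
      have "?\<sigma> w \<noteq> w" using R(1) w by auto
      thus ?thesis using True by (simp add: u_def)
    next
      case False
      have "w' \<noteq> ?\<sigma> w" "?\<sigma> w' \<noteq> w" using R(1) w by auto
      moreover have "?\<sigma> w' \<noteq> ?\<sigma> w" using False \<sigma>\<sigma> OP by metis
      ultimately show ?thesis using False by (simp add: u_def)
    qed
    finally show ?thesis
      using orbit_form[OF S(1), of "u w" "u w'"] sum_u[OF OP(1)] sum_u[OF OP(2)] card_\<sigma> OP by (simp add: M_def)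
  qed
  \<comment> \<open>Block orbits invariant under g contribute 0 and the others contribute equally in
    pairs. Keeping one of each pair halves 28 to 14 and makes the matrix square.\<close>
  have formQ: "(\<Sum>c\<in>Q. int (card c) * (M c w * M c w')) = (if w = w' then 14 * int (card w) else 0)"
    if w: "w \<in> R" "w' \<in> R" for w w'
  proof -
    have OP: "w \<in> ?OP" "w' \<in> ?OP" using w ROP by auto
    let ?h = "\<lambda>c. int (card c) * (M c w * M c w')"
    have h\<tau>: "?h (?\<sigma> ` c) = ?h c" if "c \<in> Q" for c
      using M_anti[of c] card_\<tau>[of c] that QOB OP by auto
    have "?h c = 0" if "c \<in> ?OB" "?\<sigma> ` c = c" for c
      using M_anti[OF that(1) OP(1)] that(2) by simp
    hence "(\<Sum>c\<in>?OB. ?h c) = (\<Sum>c\<in>Q \<union> ?\<tau> ` Q. ?h c)"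
      unfolding Q(2) by (intro sum.mono_neutral_right finOB) auto
    also have "\<dots> = (\<Sum>c\<in>Q. ?h c) + (\<Sum>c\<in>?\<tau> ` Q. ?h c)"
      by (rule sum.union_disjoint) (use Q(1) finite_subset[OF QOB finOB] in auto)
    also have "(\<Sum>c\<in>?\<tau> ` Q. ?h c) = (\<Sum>c\<in>Q. ?h (?\<sigma> ` c))"
    proof (rule sum.reindex[unfolded o_def])
      show "inj_on ?\<tau> Q" by (rule inj_on_inverseI[of _ ?\<tau>]) (rule \<tau>\<tau>[OF subsetD[OF QOB]])
    qed
    also have "\<dots> = (\<Sum>c\<in>Q. ?h c)" by (rule sum.cong[OF refl h\<tau>])
    finally show ?thesis using form[OF w] by (simp split: if_splits)
  qed
  obtain r where r: "bij_betw r {0..<d} R"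
    using ex_bij_betw_nat_finite[of R] finite_subset[OF ROP finOP] dd(1) by auto
  obtain q where q: "bij_betw q {0..<d} Q"
    using ex_bij_betw_nat_finite[of Q] finite_subset[OF QOB finOB] dd(2) by auto
  have rR: "r i \<in> R" and qQ: "q i \<in> Q" if "i < d" for i
    using that bij_betwE[OF r] bij_betwE[OF q] by auto
  show False
  proof (rule no_odd_similitude_14)
    show "odd (int (card (q i)))" if "i < d" for i
      using bl.orb_card_prime[OF S(1) p7 subsetD[OF QOB qQ[OF that]]] S(2) by auto
    show "odd (int (card (r i)))" if "i < d" for i
      using pt.orb_card_prime[OF S(1) p7 subsetD[OF ROP rR[OF that]]] S(2) by auto
    show "odd d" by (rule dd(3))
    show "(\<Sum>k<d. int (card (q k)) * (M (q k) (r i) * M (q k) (r j))) = (if i = j then 14 * int (card (r i)) else 0)"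
      if "i < d" "j < d" for i j
    proof -
      have "(\<Sum>k<d. int (card (q k)) * (M (q k) (r i) * M (q k) (r j))) = (\<Sum>c\<in>Q. int (card c) * (M c (r i) * M c (r j)))"
        using sum.reindex_bij_betw[OF q, of "\<lambda>c. int (card c) * (M c (r i) * M c (r j))"]
        by (simp add: lessThan_atLeast0)
      moreover have "r i = r j \<longleftrightarrow> i = j" using r that by (auto simp: bij_betw_def inj_on_def)
      ultimately show ?thesis using formQ[OF rR[OF that(1)] rR[OF that(2)]] by simp
    qed
  qed
qed

end

section \<open>Cyclic groups of order 14\<close>

lemma sum_signs_eq_0:
  fixes p :: "'y \<Rightarrow> nat"
  assumes "finite F" and bij: "bij_betw t F F" and flip: "\<And>y. y \<in> F \<Longrightarrow> even (p (t y)) \<longleftrightarrow> odd (p y)"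
  shows "(\<Sum>y\<in>F. (- 1) ^ p y) = (0::int)"
proof -
  have "(\<Sum>y\<in>F. (- 1) ^ p y) = (\<Sum>y\<in>F. (- 1) ^ p (t y) :: int)"
    by (rule sum.reindex_bij_betw[OF bij, symmetric])
  also have "\<dots> = (\<Sum>y\<in>F. - ((- 1) ^ p y))"
    by (rule sum.cong[OF refl]) (use flip in \<open>auto simp: minus_one_power_iff\<close>)
  finally show ?thesis by (simp add: sum_negf)
qed

lemma even_card_Int_sym_diff:
  assumes "finite c"
  shows "even (card (c \<inter> sym_diff Y Z)) \<longleftrightarrow> (even (card (c \<inter> Y)) \<longleftrightarrow> even (card (c \<inter> Z)))"
proof -
  have *: "card (c \<inter> A) = card (c \<inter> (A - B)) + card (c \<inter> (A \<inter> B))" for A B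
    by (subst card_Un_disjoint[symmetric]) (use assms in \<open>auto intro: arg_cong[where f = card]\<close>)
  have "card (c \<inter> sym_diff Y Z) = card (c \<inter> (Y - Z)) + card (c \<inter> (Z - Y))"
    by (subst card_Un_disjoint[symmetric]) (use assms in \<open>auto intro: arg_cong[where f = card]\<close>)
  thus ?thesis using *[of Y Z] *[of Z Y] by (simp add: Int_commute[of Z Y]) argo
qed

text \<open>Families of sets closed under symmetric difference are binary linear codes; both sides count
  \<open>\<Sum>\<^sub>c\<^sub>,\<^sub>Y (-1)\<^bsup>|c \<inter> Y|\<^esup>\<close>.\<close>

lemma code_duality:
  assumes fin: "finite P" and sub: "\<C> \<subseteq> Pow P" "\<E> \<subseteq> Pow P"
    and sd: "\<And>A B. A \<in> \<C> \<Longrightarrow> B \<in> \<C> \<Longrightarrow> sym_diff A B \<in> \<C>" "\<And>A B. A \<in> \<E> \<Longrightarrow> B \<in> \<E> \<Longrightarrow> sym_diff A B \<in> \<E>"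
  shows "card \<C> * card {Y \<in> \<E>. \<forall>c\<in>\<C>. even (card (c \<inter> Y))} = card \<E> * card {c \<in> \<C>. \<forall>Y\<in>\<E>. even (card (c \<inter> Y))}"
proof -
  have finC: "finite \<C>" "finite \<E>" using sub fin finite_subset by (auto intro: finite_subset)
  \<comment> \<open>A character sum: translation by a set Z that meets c in an odd number of points
    permutes the family and reverses every sign.\<close>
  have inner: "(\<Sum>Y\<in>\<B>. (- 1) ^ card (c \<inter> Y)) = (if \<forall>Y\<in>\<B>. even (card (c \<inter> Y)) then int (card \<B>) else 0)"
    if \<B>: "finite \<B>" "\<And>A B. A \<in> \<B> \<Longrightarrow> B \<in> \<B> \<Longrightarrow> sym_diff A B \<in> \<B>" and c: "finite c" for c :: "'a set" and \<B>
  proof (cases "\<forall>Y\<in>\<B>. even (card (c \<inter> Y))")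
    case False
    then obtain Z where Z: "Z \<in> \<B>" "odd (card (c \<inter> Z))" by auto
    have inv: "sym_diff (sym_diff Y Z) Z = Y" for Y by auto
    have "bij_betw (\<lambda>Y. sym_diff Y Z) \<B> \<B>"
      by (rule bij_betw_byWitness[where f' = "\<lambda>Y. sym_diff Y Z"]) (use \<B>(2) Z(1) inv in auto)
    hence "(\<Sum>Y\<in>\<B>. (- 1) ^ card (c \<inter> Y)) = (0::int)"
      by (rule sum_signs_eq_0[OF \<B>(1)]) (use even_card_Int_sym_diff[OF c] Z(2) in simp)
    thus ?thesis using False by (simp only: if_False)
  qed simp
  have fc: "finite c" if "c \<in> \<C> \<or> c \<in> \<E>" for c
  proof -
    have "c \<subseteq> P" using that sub by blast
    thus ?thesis using fin by (rule finite_subset)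
  qed
  have "(\<Sum>c\<in>\<C>. \<Sum>Y\<in>\<E>. (- 1) ^ card (c \<inter> Y)) = (\<Sum>c\<in>\<C>. if \<forall>Y\<in>\<E>. even (card (c \<inter> Y)) then int (card \<E>) else 0)"
    by (rule sum.cong[OF refl]) (use inner[OF finC(2) sd(2)] fc in simp)
  also have "\<dots> = int (card \<E>) * int (card {c \<in> \<C>. \<forall>Y\<in>\<E>. even (card (c \<inter> Y))})"
    using finC by (simp add: sum.If_cases Int_def)
  finally have 1: "(\<Sum>c\<in>\<C>. \<Sum>Y\<in>\<E>. (- 1) ^ card (c \<inter> Y)) = int (card \<E> * card {c \<in> \<C>. \<forall>Y\<in>\<E>. even (card (c \<inter> Y))})"
    by simp
  have "(\<Sum>Y\<in>\<E>. \<Sum>c\<in>\<C>. (- 1) ^ card (c \<inter> Y)) = (\<Sum>Y\<in>\<E>. if \<forall>c\<in>\<C>. even (card (c \<inter> Y)) then int (card \<C>) else 0)"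
  proof (rule sum.cong[OF refl])
    fix Y assume "Y \<in> \<E>"
    thus "(\<Sum>c\<in>\<C>. (- 1) ^ card (c \<inter> Y)) = (if \<forall>c\<in>\<C>. even (card (c \<inter> Y)) then int (card \<C>) else 0)"
      using inner[OF finC(1) sd(1), of Y] fc unfolding Int_commute[of Y] by simp
  qed
  also have "\<dots> = int (card \<C>) * int (card {Y \<in> \<E>. \<forall>c\<in>\<C>. even (card (c \<inter> Y))})"
    using finC by (simp add: sum.If_cases Int_def)
  finally have 2: "(\<Sum>Y\<in>\<E>. \<Sum>c\<in>\<C>. (- 1) ^ card (c \<inter> Y)) = int (card \<C> * card {Y \<in> \<E>. \<forall>c\<in>\<C>. even (card (c \<inter> Y))})"
    by simp
  have "int (card \<C> * card {Y \<in> \<E>. \<forall>c\<in>\<C>. even (card (c \<inter> Y))})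
      = int (card \<E> * card {c \<in> \<C>. \<forall>Y\<in>\<E>. even (card (c \<inter> Y))})"
    unfolding 1[symmetric] 2[symmetric] by (rule sum.swap)
  thus ?thesis by (simp only: of_nat_eq_iff)
qed

lemma card_le_fibres:
  assumes "finite A" "finite V" "\<And>a. a \<in> A \<Longrightarrow> f a \<in> V" "\<And>v. v \<in> V \<Longrightarrow> card {a \<in> A. f a = v} \<le> n"
  shows "card A \<le> card V * n"
proof -
  have "card A = (\<Sum>a\<in>A. card {v \<in> V. f a = v})"
  proof -
    have "{v \<in> V. f a = v} = {f a}" if "a \<in> A" for a using assms(3)[OF that] by auto
    thus ?thesis by simp
  qed
  also have "\<dots> = (\<Sum>v\<in>V. card {a \<in> A. f a = v})" by (rule sum_card_swap) (use assms in auto)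
  also have "\<dots> \<le> (\<Sum>v\<in>V. n)" by (rule sum_mono) (rule assms(4))
  finally show ?thesis by simp
qed

section \<open>The binary code spanned by the blocks\<close>

context biplane121
begin

text \<open>The span of the blocks over the field with two elements; U selects the blocks that are
  added.\<close>

definition block_code :: "'p set set" where
  "block_code = (\<lambda>U. {p \<in> P. odd (card {b \<in> U. p \<in> b})}) ` Pow BB"

lemma block_code_sub: "block_code \<subseteq> Pow P" by (auto simp: block_code_def)

lemma block_code_sym_diff:
  assumes "c \<in> block_code" "d \<in> block_code"
  shows "sym_diff c d \<in> block_code"
proof -
  obtain U V where U: "U \<subseteq> BB" "c = {p \<in> P. odd (card {b \<in> U. p \<in> b})}"
    and V: "V \<subseteq> BB" "d = {p \<in> P. odd (card {b \<in> V. p \<in> b})}"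
    using assms by (auto simp: block_code_def)
  have "odd (card {b \<in> sym_diff U V. p \<in> b}) \<longleftrightarrow> (odd (card {b \<in> U. p \<in> b}) \<noteq> odd (card {b \<in> V. p \<in> b}))" for p
  proof -
    have e: "{b \<in> W. p \<in> b} = {b \<in> BB. p \<in> b} \<inter> W" if "W \<subseteq> BB" for W using that by auto
    have UV: "sym_diff U V \<subseteq> BB" using U(1) V(1) by auto
    have "finite {b \<in> BB. p \<in> b}" by simp
    from even_card_Int_sym_diff[OF this, of U V] show ?thesis
      unfolding e[OF UV] e[OF U(1)] e[OF V(1)] by argo
  qed
  hence "sym_diff c d = {p \<in> P. odd (card {b \<in> sym_diff U V. p \<in> b})}" using U V by auto
  moreover have "sym_diff U V \<in> Pow BB" using U(1) V(1) by auto
  ultimately show ?thesis unfolding block_code_def by blast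
qed

lemma even_code_word:
  assumes U: "U \<subseteq> BB" and Y: "Y \<subseteq> P" and even: "\<And>b. b \<in> U \<Longrightarrow> even (card (b \<inter> Y))"
  shows "even (card ({p \<in> P. odd (card {b \<in> U. p \<in> b})} \<inter> Y))"
proof -
  have fY: "finite Y" using Y finite_subset finite_points by blast
  have fU: "finite U" using U finite_subset finite_blocks by blast
  have "(\<Sum>p\<in>Y. card {b \<in> U. p \<in> b}) = (\<Sum>b\<in>U. card {p \<in> Y. p \<in> b})" by (rule sum_card_swap[OF fY fU])
  also have "even \<dots>" using even by (intro dvd_sum) (simp add: Int_def conj_commute)
  finally have "even (card {p \<in> Y. odd (card {b \<in> U. p \<in> b})})" by (simp only: even_sum_iff[OF fY])
  moreover have "{p \<in> Y. odd (card {b \<in> U. p \<in> b})} = {p \<in> P. odd (card {b \<in> U. p \<in> b})} \<inter> Y" using Y by auto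
  ultimately show ?thesis by simp
qed

lemma block_code_even:
  assumes "c \<in> block_code" "b \<in> BB"
  shows "even (card (c \<inter> b))"
proof -
  obtain U where U: "U \<subseteq> BB" "c = {p \<in> P. odd (card {b \<in> U. p \<in> b})}" using assms(1) by (auto simp: block_code_def)
  show ?thesis unfolding U(2)
    by (rule even_code_word[OF U(1) block_subset[OF assms(2)]]) (use U(1) common_points_card assms(2) in auto)
qed

lemma block_code_dual_iff:
  assumes "Y \<subseteq> P"
  shows "(\<forall>c\<in>block_code. even (card (c \<inter> Y))) \<longleftrightarrow> (\<forall>b\<in>BB. even (card (b \<inter> Y)))"
proof
  assume all: "\<forall>c\<in>block_code. even (card (c \<inter> Y))"
  show "\<forall>b\<in>BB. even (card (b \<inter> Y))"
  proof
    fix b assume b: "b \<in> BB"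
    have "{p \<in> P. odd (card {d \<in> {b}. p \<in> d})} = b"
    proof -
      have "{d \<in> {b}. p \<in> d} = (if p \<in> b then {b} else {})" for p by auto
      thus ?thesis using block_subset[OF b] by auto
    qed
    moreover have "{p \<in> P. odd (card {d \<in> {b}. p \<in> d})} \<in> block_code"
      unfolding block_code_def by (rule imageI) (use b in simp)
    ultimately have "b \<in> block_code" by simp
    thus "even (card (b \<inter> Y))" using all by simp
  qed
next
  assume "\<forall>b\<in>BB. even (card (b \<inter> Y))"
  thus "\<forall>c\<in>block_code. even (card (c \<inter> Y))"
    using even_code_word[OF _ assms] by (auto simp: block_code_def)
qed

text \<open>Only the empty word is orthogonal to all sets of points, so \<open>code_duality\<close>
  against \<open>Pow P\<close> bounds the product of the sizes of the code and its dual by 2 ^ 121.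
  The code lies in its dual because 16 and 2 are even.\<close>

lemma card_block_code: "card block_code * card block_code \<le> 2 ^ 121"
proof -
  let ?D = "{Y \<in> Pow P. \<forall>c\<in>block_code. even (card (c \<inter> Y))}"
  have "{c \<in> block_code. \<forall>Y\<in>Pow P. even (card (c \<inter> Y))} \<subseteq> {{}}"
  proof
    fix c assume c: "c \<in> {c \<in> block_code. \<forall>Y\<in>Pow P. even (card (c \<inter> Y))}"
    have "p \<notin> c" for p
    proof
      assume p: "p \<in> c"
      hence "{p} \<in> Pow P" using c block_code_sub by auto
      hence "even (card (c \<inter> {p}))" using c by blast
      thus False using p by simp
    qed
    thus "c \<in> {{}}" by auto
  qed
  from card_mono[OF _ this] have "card {c \<in> block_code. \<forall>Y\<in>Pow P. even (card (c \<inter> Y))} \<le> 1" by simp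
  moreover have "card block_code * card ?D
      = card (Pow P) * card {c \<in> block_code. \<forall>Y\<in>Pow P. even (card (c \<inter> Y))}"
    by (rule code_duality[OF finite_points block_code_sub order_refl block_code_sym_diff]) auto
  ultimately have "card block_code * card ?D \<le> 2 ^ 121"
    by (simp add: card_Pow card_points)
  moreover have "block_code \<subseteq> ?D"
  proof
    fix c assume c: "c \<in> block_code"
    hence cP: "c \<subseteq> P" using block_code_sub by blast
    have "\<forall>b\<in>BB. even (card (b \<inter> c))" using block_code_even[OF c] by (simp add: Int_commute)
    thus "c \<in> ?D" using block_code_dual_iff[OF cP] cP by simp
  qed
  hence "card block_code \<le> card ?D" by (intro card_mono) auto
  hence "card block_code * card block_code \<le> card block_code * card ?D" by (rule mult_le_mono2)
  ultimately show ?thesis by (rule order_trans[rotated])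
qed

text \<open>Inverting the incidence matrix modulo 2: \<open>A\<^sup>T A = 14 I + 2 J\<close> determines \<open>Y\<close> from \<open>A Y / 2\<close>.\<close>

definition half_sum :: "'p set \<Rightarrow> 'p \<Rightarrow> nat" where
  "half_sum Y p = (\<Sum>b\<in>{b \<in> BB. p \<in> b}. card (b \<inter> Y) div 2)"

text \<open>Half of \<open>point_form\<close> for the indicator of Y: \<open>half_sum Y p\<close> is
  7 y + |Y|, where y is 1 or 0 according to whether p lies in Y. The coefficient 7 is odd because 4
  does not divide 14.\<close>

lemma half_sum_even_iff:
  assumes Y: "Y \<subseteq> P" and even: "\<And>b. b \<in> BB \<Longrightarrow> even (card (b \<inter> Y))" and p: "p \<in> P"
  shows "even (half_sum Y p) \<longleftrightarrow> (p \<in> Y \<longleftrightarrow> odd (card Y))"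
proof -
  let ?y = "\<lambda>q. if q \<in> Y then 1 else 0 :: int"
  have fY: "finite Y" using Y finite_subset finite_points by blast
  have s: "(\<Sum>q\<in>b. ?y q) = int (card (b \<inter> Y))" if "finite b" for b
    using that by (simp add: sum.If_cases)
  have "(\<Sum>b\<in>{b \<in> BB. p \<in> b}. \<Sum>q\<in>b. ?y q) = 14 * ?y p + 2 * (\<Sum>q\<in>P. ?y q)" by (rule point_form[OF p])
  also have "(\<Sum>q\<in>P. ?y q) = int (card Y)" using s[OF finite_points] Y by (simp add: Int_absorb1)
  also have "(\<Sum>b\<in>{b \<in> BB. p \<in> b}. \<Sum>q\<in>b. ?y q) = (\<Sum>b\<in>{b \<in> BB. p \<in> b}. 2 * int (card (b \<inter> Y) div 2))"
  proof (rule sum.cong[OF refl])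
    fix b assume "b \<in> {b \<in> BB. p \<in> b}"
    hence "b \<in> BB" by simp
    thus "(\<Sum>q\<in>b. ?y q) = 2 * int (card (b \<inter> Y) div 2)" using s[OF finite_block] even[of b] by auto
  qed
  also have "\<dots> = 2 * int (half_sum Y p)" by (simp add: half_sum_def sum_distrib_left)
  finally have "int (half_sum Y p) = 7 * ?y p + int (card Y)" by simp
  hence "even (int (half_sum Y p)) \<longleftrightarrow> even (7 * ?y p + int (card Y))" by simp
  thus ?thesis by (simp only: even_of_nat_iff) auto
qed

end

context biplane_group
begin

text \<open>The nine fixed points of g are the two fixed points of S and one S-orbit of length 7,
  and the same holds for blocks. A set Y that is invariant under g and orthogonal to all blocks is
  described on these nine points by two bits (\<open>const_O\<close>, \<open>const_X\<close>), and
  it lies in the code if it avoids them (\<open>kernel\<close>).\<close>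

lemma no_cyclic_14:
  assumes S: "subgroup S G" "card S = 7" and g: "g \<in> carrier G" "g \<otimes> g = \<one>" "g \<noteq> \<one>"
    and comm: "\<And>s. s \<in> S \<Longrightarrow> g \<otimes> s = s \<otimes> g"
  shows False
proof -
  have p7: "prime (card S)" using S(2) by simp
  let ?T = "{\<one>, g}"
  note T = involution_subgroup[OF g]
  have pT: "prime (card ?T)" unfolding T(2) by simp
  note cS = subgroup.mem_carrier[OF S(1)]
  define F where "F = pt.fixed ?T"
  define FB where "FB = bl.fixed ?T"
  define X where "X = pt.fixed S"
  define XB where "XB = bl.fixed S"
  have gT: "g \<in> ?T" by simp
  have F: "F = {x \<in> P. act g x = x}" and FB: "FB = {b \<in> BB. act g ` b = b}"
    unfolding F_def FB_def using prime_order_fixed_eq[OF T(1) pT gT g(3)] by simp_all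
  have comm': "s \<otimes> t = t \<otimes> s" "t \<otimes> s = s \<otimes> t" if "t \<in> ?T" "s \<in> S" for s t
    using that comm cS by auto
  have invF: "pt.invariant S F" "bl.invariant S FB"
    unfolding F_def FB_def by (rule commuting_invariant[OF T(1) S(1) comm'(2)]; assumption)+
  have cX: "card X = 2" "card XB = 2" unfolding X_def XB_def using fixed_card_7[OF S] by simp_all
  have f9: "card F = 9" and XF: "X \<subseteq> F" and FBeq: "card FB = 9" and XFB: "XB \<subseteq> FB"
  proof -
    \<comment> \<open>At most two of the f elements are fixed by S and the rest form orbits of
      length 7; 9 = 2 + 7 fits, but 13 is 6 modulo 7.\<close>
    have arith: "f = 9 \<and> a = 2" if "f \<in> {9, 13}" "7 dvd c" "f = a + c" "a \<le> 2" for f a c :: nat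
      using that by (auto elim!: dvdE) presburger+
    have "card F \<in> {9, 13}" unfolding F_def by (rule involution_card_fixed(1)[OF T])
    moreover have "7 dvd card (F - X)" unfolding X_def by (rule pt.p_group_nonfixed[OF S(1) _ _ invF(1), of 7 1]) (simp_all add: S(2))
    moreover have "card F = card (F \<inter> X) + card (F - X)" unfolding X_def by (rule pt.card_invariant[OF invF(1)])
    moreover have "card (F \<inter> X) \<le> 2" unfolding cX(1)[symmetric] by (rule card_mono) (simp_all add: X_def)
    ultimately have *: "card F = 9 \<and> card (F \<inter> X) = 2" by (rule arith)
    thus "card F = 9" by simp
    have "F \<inter> X = X" by (rule card_subset_eq) (use * cX in \<open>simp_all add: X_def\<close>)
    thus "X \<subseteq> F" by auto
    have cFB: "card FB = card F" unfolding FB_def F_def by (rule card_fixed_eq[OF T(1) pT])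
    hence "card FB \<in> {9, 13}" using * by simp
    moreover have "7 dvd card (FB - XB)" unfolding XB_def by (rule bl.p_group_nonfixed[OF S(1) _ _ invF(2), of 7 1]) (simp_all add: S(2))
    moreover have "card FB = card (FB \<inter> XB) + card (FB - XB)" unfolding XB_def by (rule bl.card_invariant[OF invF(2)])
    moreover have "card (FB \<inter> XB) \<le> 2" unfolding cX(2)[symmetric] by (rule card_mono) (simp_all add: XB_def)
    ultimately have *: "card FB = 9 \<and> card (FB \<inter> XB) = 2" by (rule arith)
    thus "card FB = 9" by simp
    have "FB \<inter> XB = XB" by (rule card_subset_eq) (use * cX in \<open>simp_all add: XB_def\<close>)
    thus "XB \<subseteq> FB" by auto
  qed
  have FP: "F \<subseteq> P" and FBB: "FB \<subseteq> BB" by (auto simp: F FB)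
  have finF: "finite F" using FP finite_subset finite_points by blast
  have e02: "card (b \<inter> F) \<in> {0, 2}" if "b \<in> FB" for b
    using involution_card_fixed(2)[OF T, of b] that f9 unfolding F_def FB_def by simp
  have XB_sub: "X \<subseteq> b" if "b \<in> XB" for b using fixed_card_7(3)[OF S] that unfolding X_def XB_def by simp
  have meet_XB: "b \<inter> F = X" if b: "b \<in> XB" for b
  proof (rule card_subset_eq[symmetric])
    show "X \<subseteq> b \<inter> F" using XB_sub[OF b] XF by simp
    hence "2 \<le> card (b \<inter> F)" using card_mono[of "b \<inter> F" X] finF cX by simp
    thus "card X = card (b \<inter> F)" using e02[of b] XFB b cX by auto
  qed (use finF in simp)
  \<comment> \<open>If W met F, some k in S would make W and its image share their two points with
    F. Then k preserves this pair and, having odd order, fixes both points. The pair is X, and three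
    blocks contain it.\<close>
  have meet_W: "W \<inter> F = {}" if W: "W \<in> FB" "W \<notin> XB" for W
  proof (rule ccontr)
    assume "W \<inter> F \<noteq> {}"
    hence W2: "card (W \<inter> F) = 2" using e02[OF W(1)] finF by auto
    have WB: "W \<in> BB" using W FBB by auto
    \<comment> \<open>If W meets X, any nontrivial k will do, with y in X. Otherwise both points of
      W in F lie in the S-orbit of length 7, and k carries one to the other.\<close>
    obtain k y where k: "k \<in> S" "k \<noteq> \<one>" and y: "y \<in> F" "y \<in> W" "y \<in> act k ` W"
    proof (cases "W \<inter> F \<inter> X = {}")
      case False
      then obtain y where y: "y \<in> W" "y \<in> F" "y \<in> X" by auto
      obtain k where k: "k \<in> S" "k \<noteq> \<one>" "k \<in> carrier G" using prime_order_nontrivial[OF S(1) p7] .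
      have "act k y = y" using y(3) k(1) by (simp add: X_def pt.fixed_def)
      hence "y \<in> act k ` W" using y(1) by (metis imageI)
      with k(1,2) y(2,1) show thesis by (rule that)
    next
      case True
      obtain z v where zv: "W \<inter> F = {z, v}" "z \<noteq> v" using W2 by (auto simp: card_2_iff)
      have z: "z \<in> F" "z \<notin> X" "v \<in> F" "v \<notin> X" "z \<in> W" "v \<in> W" using zv True by auto
      have zP: "z \<in> P" using z FP by auto
      have "card (pt.orb S z) = 7" using pt.prime_order_orb[OF S(1) p7 zP] z(2) S(2) by (simp add: X_def)
      moreover have "card (F - X) = 7" using f9 cX XF finF by (simp add: card_Diff_subset finite_subset)
      moreover have "pt.orb S z \<subseteq> F - X"
        using pt.orb_subset[OF pt.invariant_nonfixed[OF S(1) invF(1)]] z unfolding X_def by blast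
      ultimately have "pt.orb S z = F - X" by (intro card_subset_eq) (use finF in auto)
      hence "v \<in> pt.orb S z" using z by simp
      then obtain k where k: "k \<in> S" "v = act k z" by (auto simp: pt.orb_def)
      have "k \<noteq> \<one>" using k zv(2) pt.act_one[OF zP] by auto
      moreover have "v \<in> act k ` W" using k(2) z(5) by simp
      ultimately show thesis using that[of k v] k(1) z(3,6) by blast
    qed
    have kG: "k \<in> carrier G" using cS[OF k(1)] .
    let ?W = "act k ` W"
    have W': "?W \<in> FB" using invF(2) W(1) k(1) by (simp add: bl.invariant_def)
    have WW: "?W \<noteq> W" using bl.prime_order_fixed[OF S(1) p7 k WB] W(2) by (auto simp: XB_def)
    have c2: "card (W \<inter> ?W) = 2" using two_blocks[OF WB _ WW[symmetric]] W' FBB by auto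
    have WWP: "W \<inter> ?W \<subseteq> P" using block_subset[OF WB] by auto
    have ginv: "act g ` (W \<inter> ?W) = W \<inter> ?W"
      using act_image_Int[OF g(1) block_subset[OF WB], of ?W] block_subset W' W(1) FBB by (auto simp: FB)
    \<comment> \<open>g preserves this pair and fixes one of its points, hence also the
      other.\<close>
    have sub: "W \<inter> ?W \<subseteq> F"
    proof -
      obtain y' where y': "W \<inter> ?W = {y, y'}" "y \<noteq> y'"
      proof -
        obtain a b where ab: "W \<inter> ?W = {a, b}" "a \<noteq> b" using c2 by (auto simp: card_2_iff)
        have "y \<in> {a, b}" using y ab(1) by blast
        thus thesis using that[of a] that[of b] ab by (auto simp: insert_commute)
      qed
      have y'P: "y' \<in> P" and yP: "y \<in> P" using y'(1) WWP by auto
      have gy: "act g y = y" using y(1) by (simp add: F)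
      have "act g y' \<in> {y, y'}" using ginv y'(1) by auto
      moreover have "act g y' \<noteq> y" using pt.act_inj[OF g(1) y'P yP] gy y'(2) by auto
      ultimately have "y' \<in> F" using y'P by (simp add: F)
      thus ?thesis using y'(1) y(1) by simp
    qed
    have eq1: "W \<inter> ?W = W \<inter> F"
      by (rule card_subset_eq) (use finF sub c2 W2 in auto)
    have kF: "act k ` F = F"
    proof (rule card_subset_eq[OF finF])
      show "act k ` F \<subseteq> F" using invF(1) k(1) by (auto simp: pt.invariant_def)
      show "card (act k ` F) = card F" by (rule card_act_image[OF kG FP])
    qed
    have kWF: "act k ` (W \<inter> F) = ?W \<inter> F" using act_image_Int[OF kG block_subset[OF WB] FP] kF by simp
    hence "card (?W \<inter> F) = 2" using card_act_image[OF kG, of "W \<inter> F"] FP W2 by auto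
    hence "W \<inter> ?W = ?W \<inter> F" by (intro card_subset_eq) (use finF sub c2 in auto)
    hence kinv: "act k ` (W \<inter> F) = W \<inter> F" using eq1 kWF by simp
    have "W \<inter> F \<subseteq> X"
    proof
      fix x assume x: "x \<in> W \<inter> F"
      have xP: "x \<in> P" using x FP by auto
      have kx: "act k x \<in> W \<inter> F" using kinv x by blast
      have kkx: "act k (act k x) \<in> W \<inter> F" using kinv kx by blast
      show "x \<in> X"
      proof (cases "act k x = x")
        case True
        thus ?thesis unfolding X_def using pt.prime_order_fixed[OF S(1) p7 k xP] by simp
      next
        case False
        hence "{x, act k x} = W \<inter> F" by (intro card_subset_eq) (use x kx W2 finF in auto)
        moreover have "act k (act k x) \<noteq> act k x" using pt.act_inj[OF kG pt.act_closed[OF kG xP] xP] False by auto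
        ultimately have "act k (act k x) = x" using kkx by auto
        hence "act (k \<otimes> k) x = x" using pt.act_mult[OF kG kG xP] by simp
        moreover have "k \<otimes> k \<noteq> \<one>" using odd_subgroup_square[OF S(1) _ k(1)] k(2) S(2) by auto
        ultimately show ?thesis unfolding X_def
          using pt.prime_order_fixed[OF S(1) p7 subgroup.m_closed[OF S(1) k(1) k(1)] _ xP] by simp
      qed
    qed
    hence "W \<inter> F = X" by (intro card_subset_eq) (use W2 cX in \<open>auto simp: X_def\<close>)
    hence XW: "X \<subseteq> W" by auto
    obtain x x' where x: "X = {x, x'}" "x \<noteq> x'" using cX(1) by (auto simp: card_2_iff)
    obtain b b' where b: "XB = {b, b'}" "b \<noteq> b'" using cX(2) by (auto simp: card_2_iff)
    have xP: "x \<in> P" "x' \<in> P" using x(1) XF FP by auto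
    have bB: "b \<in> BB" "b' \<in> BB" using b(1) XFB FBB by auto
    have "{x, x'} \<subseteq> b" "{x, x'} \<subseteq> b'" "{x, x'} \<subseteq> W" using XB_sub b(1) XW x(1) by auto
    from three_blocks[OF xP x(2) bB WB this] show False using b W(2) by auto
  qed
  let ?dual = "\<lambda>Y. \<forall>b\<in>BB. even (card (b \<inter> Y))"
  \<comment> \<open>Blocks through p that g moves come in pairs meeting the invariant set Y equally
    often, so they cancel modulo 2.\<close>
  have parity: "even (half_sum Y p) \<longleftrightarrow> even (\<Sum>b\<in>{b \<in> FB. p \<in> b}. card (b \<inter> Y) div 2)"
    if Y: "Y \<subseteq> P" "act g ` Y = Y" and p: "p \<in> F" for Y p
  proof -
    let ?h = "\<lambda>b. card (b \<inter> Y) div 2" and ?A = "{b \<in> BB. p \<in> b \<and> b \<notin> FB}"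
    have gp: "act g p = p" using p by (simp add: F)
    have "\<exists>R. R \<inter> (`) (act g) ` R = {} \<and> R \<union> (`) (act g) ` R = ?A \<and> card ?A = 2 * card R"
    proof (rule involution_transversal)
      have inv: "act g ` act g ` b = b" if "b \<in> BB" for b
        by (rule pt.act_involution_image[OF g(1,2) block_subset[OF that]])
      show "act g ` act g ` b = b" if "b \<in> ?A" for b using inv that by simp
      show "act g ` b \<in> ?A" if b: "b \<in> ?A" for b
      proof -
        have "p \<in> act g ` b" using b gp by (metis (mono_tags, lifting) imageI mem_Collect_eq)
        moreover have "act g ` b \<in> BB" using b preserves[OF g(1)] by simp
        moreover have "act g ` b \<notin> FB" using b inv[of b] by (auto simp: FB)
        ultimately show ?thesis by simp
      qed
      show "act g ` b \<noteq> b" if "b \<in> ?A" for b using that by (simp add: FB)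
    qed simp
    then obtain R where R: "R \<inter> (`) (act g) ` R = {}" "R \<union> (`) (act g) ` R = ?A" by (elim exE conjE)
    have RB: "R \<subseteq> BB" using R(2) by auto
    have finR: "finite R" using RB finite_subset finite_blocks by blast
    have hg: "?h (act g ` b) = ?h b" if "b \<in> BB" for b
      using card_meet_act[OF g(1) block_subset[OF that] Y(1)] Y(2) by simp
    have "(\<Sum>b\<in>?A. ?h b) = (\<Sum>b\<in>R. ?h b) + (\<Sum>b\<in>(`) (act g) ` R. ?h b)"
      unfolding R(2)[symmetric] by (rule sum.union_disjoint) (use R(1) finR in auto)
    also have "(\<Sum>b\<in>(`) (act g) ` R. ?h b) = (\<Sum>b\<in>R. ?h (act g ` b))"
    proof (rule sum.reindex[unfolded o_def])
      show "inj_on ((`) (act g)) R"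
        by (rule inj_onI) (use bl.act_inj[OF g(1)] RB in blast)
    qed
    also have "\<dots> = (\<Sum>b\<in>R. ?h b)" by (rule sum.cong[OF refl]) (use hg RB in blast)
    finally have evA: "even (\<Sum>b\<in>?A. ?h b)" by simp
    have "{b \<in> BB. p \<in> b} = ?A \<union> {b \<in> FB. p \<in> b}" using FBB by auto
    hence "(\<Sum>b\<in>{b \<in> BB. p \<in> b}. ?h b) = (\<Sum>b\<in>?A. ?h b) + (\<Sum>b\<in>{b \<in> FB. p \<in> b}. ?h b)"
      by (simp only:) (rule sum.union_disjoint, use finite_subset[OF FBB] in auto)
    thus ?thesis using evA by (simp add: half_sum_def)
  qed
  \<comment> \<open>No fixed block of g passes through such a point, so the half sum is
    even.\<close>
  have const_O: "p \<in> Y \<longleftrightarrow> odd (card Y)" if Y: "Y \<subseteq> P" "act g ` Y = Y" "?dual Y" and p: "p \<in> F" "p \<notin> X" for Y p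
  proof -
    have "{b \<in> FB. p \<in> b} = {}" using meet_W meet_XB p by blast
    hence "even (half_sum Y p)" unfolding parity[OF Y(1,2) p(1)] by (simp only: sum.empty even_zero)
    thus ?thesis using half_sum_even_iff[OF Y(1), of p] Y(3) p FP by auto
  qed
  \<comment> \<open>The fixed blocks of g through either point of X are the two in XB, which gives
    equal parities.\<close>
  have const_X: "p \<in> Y \<longleftrightarrow> q \<in> Y" if Y: "Y \<subseteq> P" "act g ` Y = Y" "?dual Y" and pq: "p \<in> X" "q \<in> X" for Y p q
  proof -
    have "{b \<in> FB. z \<in> b} = XB" if "z \<in> X" for z using meet_W XB_sub XFB XF that by blast
    hence "even (half_sum Y p) \<longleftrightarrow> even (half_sum Y q)"
      using parity[OF Y(1,2), of p] parity[OF Y(1,2), of q] pq XF by auto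
    thus ?thesis using half_sum_even_iff[OF Y(1), of p] half_sum_even_iff[OF Y(1), of q] Y(3) pq XF FP by auto
  qed
  define E0 where "E0 = {Y \<in> Pow P. act g ` Y = Y}"
  have E0_sd: "sym_diff A B \<in> E0" if "A \<in> E0" "B \<in> E0" for A B
  proof -
    have AB: "A \<subseteq> P" "B \<subseteq> P" "act g ` A = A" "act g ` B = B" using that by (auto simp: E0_def)
    have inj: "inj_on (act g) P" using pt.act_bij[OF g(1)] by (simp add: bij_betw_def)
    have "A - B \<subseteq> P" "B - A \<subseteq> P" using AB by auto
    from inj_on_image_set_diff[OF inj this(1) AB(2)] inj_on_image_set_diff[OF inj this(2) AB(1)]
    have "act g ` (A - B) = A - B" "act g ` (B - A) = B - A" unfolding AB(3,4) .
    hence "act g ` sym_diff A B = sym_diff A B" by (simp only: image_Un)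
    thus ?thesis using AB by (auto simp: E0_def)
  qed
  have even_free: "even (card Y)" if Y: "Y \<in> E0" "Y \<inter> F = {}" for Y
  proof -
    have YP: "Y \<subseteq> P" "act g ` Y = Y" using Y by (auto simp: E0_def)
    have "\<exists>R. R \<inter> act g ` R = {} \<and> R \<union> act g ` R = Y \<and> card Y = 2 * card R"
    proof (rule involution_transversal)
      show "act g x \<in> Y" if "x \<in> Y" for x using YP(2) that by blast
      show "act g (act g x) = x" if "x \<in> Y" for x using pt.act_involution[OF g(1,2)] YP(1) that by blast
      show "act g x \<noteq> x" if "x \<in> Y" for x using that Y(2) YP(1) by (auto simp: F)
    qed (use YP(1) finite_subset finite_points in blast)
    thus ?thesis by auto
  qed
  \<comment> \<open>D consists of the code words orthogonal to all invariant sets, Q of the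
    invariant sets orthogonal to the code; \<open>code_duality\<close> relates their sizes.\<close>
  define D where "D = {c \<in> block_code. \<forall>Y\<in>E0. even (card (c \<inter> Y))}"
  define Q where "Q = {Y \<in> E0. \<forall>c\<in>block_code. even (card (c \<inter> Y))}"
  have finPow: "finite (Pow P)" by simp
  have finQ: "finite Q" by (rule finite_subset[OF _ finPow]) (auto simp: Q_def E0_def)
  have finD: "finite D" by (rule finite_subset[OF _ finPow]) (use block_code_sub in \<open>auto simp: D_def\<close>)
  have QI: "Y \<subseteq> P" "act g ` Y = Y" "?dual Y" if "Y \<in> Q" for Y
  proof -
    show YP: "Y \<subseteq> P" "act g ` Y = Y" using that by (auto simp: Q_def E0_def)
    show "?dual Y" using block_code_dual_iff[OF YP(1)] that by (simp add: Q_def)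
  qed
  \<comment> \<open>|Y| is even, so p lies in Y exactly when its half sum is odd: Y is the sum
    modulo 2 of the blocks b for which |b \<inter> Y| / 2 is odd. It is orthogonal to an invariant Z
    because their intersection is invariant without fixed points of g.\<close>
  have kernel: "Y \<in> D" if Y: "Y \<in> Q" "Y \<inter> F = {}" for Y
  proof -
    note q = QI[OF Y(1)]
    have YE: "Y \<in> E0" using Y(1) by (simp add: Q_def)
    have evY: "even (card Y)" by (rule even_free[OF YE Y(2)])
    let ?U = "{b \<in> BB. odd (card (b \<inter> Y) div 2)}"
    have "odd (card {b \<in> ?U. p \<in> b}) \<longleftrightarrow> p \<in> Y" if p: "p \<in> P" for p
    proof -
      have "{b \<in> ?U. p \<in> b} = {b \<in> {b \<in> BB. p \<in> b}. odd (card (b \<inter> Y) div 2)}" by auto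
      hence "even (half_sum Y p) \<longleftrightarrow> even (card {b \<in> ?U. p \<in> b})"
        using even_sum_iff[of "{b \<in> BB. p \<in> b}"] by (simp add: half_sum_def)
      thus ?thesis using half_sum_even_iff[OF q(1) _ p] q(3) evY by auto
    qed
    hence "{p \<in> P. odd (card {b \<in> ?U. p \<in> b})} = Y" using q(1) by auto
    moreover have "?U \<in> Pow BB" by auto
    ultimately have "Y \<in> block_code" unfolding block_code_def by blast
    moreover have "even (card (Y \<inter> Z))" if Z: "Z \<in> E0" for Z
    proof (rule even_free)
      have "Z \<subseteq> P" "act g ` Z = Z" using Z by (auto simp: E0_def)
      thus "Y \<inter> Z \<in> E0" using act_image_Int[OF g(1) q(1)] q(1,2) by (auto simp: E0_def)
    qed (use Y(2) in auto)
    ultimately show ?thesis by (simp add: D_def)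
  qed
  have Q_sd: "sym_diff A B \<in> Q" if "A \<in> Q" "B \<in> Q" for A B
  proof -
    have "even (card (c \<inter> sym_diff A B))" if c: "c \<in> block_code" for c
    proof -
      have "finite c" using c block_code_sub finite_subset finite_points by blast
      thus ?thesis using even_card_Int_sym_diff[of c A B] \<open>A \<in> Q\<close> \<open>B \<in> Q\<close> c by (simp add: Q_def)
    qed
    thus ?thesis using E0_sd that by (simp add: Q_def)
  qed
  obtain x0 where x0: "x0 \<in> X" using cX(1) by fastforce
  \<comment> \<open>The two bits are membership of one point of X and the parity of |Y|. Two members
    of Q with the same bits agree on F, so their difference lies in D.\<close>
  have "card Q \<le> card (UNIV :: (bool \<times> bool) set) * card D"
  proof (rule card_le_fibres[OF finQ])
    fix v :: "bool \<times> bool"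
    let ?Qv = "{Y \<in> Q. (x0 \<in> Y, odd (card Y)) = v}"
    show "card ?Qv \<le> card D"
    proof (cases "?Qv = {}")
      case False
      then obtain Z where Z: "Z \<in> ?Qv" by blast
      show ?thesis
      proof (rule card_inj_on_le[OF _ _ finD])
        show "inj_on (\<lambda>Y. sym_diff Y Z) ?Qv" by (rule inj_onI) blast
        show "(\<lambda>Y. sym_diff Y Z) ` ?Qv \<subseteq> D"
        proof (rule image_subsetI)
          fix Y assume Y: "Y \<in> ?Qv"
          have YZ: "Y \<in> Q" "Z \<in> Q" "x0 \<in> Y \<longleftrightarrow> x0 \<in> Z" "odd (card Y) \<longleftrightarrow> odd (card Z)" using Y Z by auto
          have same: "p \<in> Y \<longleftrightarrow> p \<in> Z" if "p \<in> F" for p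
          proof (cases "p \<in> X")
            case True
            thus ?thesis using const_X[OF QI[OF YZ(1)] True x0] const_X[OF QI[OF YZ(2)] True x0] YZ(3) by simp
          next
            case False
            thus ?thesis using const_O[OF QI[OF YZ(1)] that] const_O[OF QI[OF YZ(2)] that] YZ(4) by simp
          qed
          show "sym_diff Y Z \<in> D"
            by (rule kernel[OF Q_sd[OF YZ(1,2)]]) (use same in auto)
        qed
      qed
    qed (simp only: card.empty)
  qed simp_all
  moreover have "card (UNIV :: (bool \<times> bool) set) = 4"
    by (simp add: card_cartesian_product card_UNIV_bool flip: UNIV_Times_UNIV)
  ultimately have Q4: "card Q \<le> 4 * card D" by (simp only:)
  have duality: "card block_code * card Q = card E0 * card D"
    unfolding Q_def D_def
    by (rule code_duality[OF finite_points block_code_sub _ block_code_sym_diff E0_sd]) (auto simp: E0_def)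
  \<comment> \<open>An invariant set consists of any of the 9 fixed points and any of the (121 - 9)
    / 2 = 56 orbits of length 2.\<close>
  have cE0: "2 ^ 65 \<le> card E0"
  proof -
    let ?N = "P - F"
    have "\<exists>R. R \<inter> act g ` R = {} \<and> R \<union> act g ` R = ?N \<and> card ?N = 2 * card R"
    proof (rule involution_transversal)
      have inv: "act g (act g x) = x" if "x \<in> P" for x by (rule pt.act_involution[OF g(1,2) that])
      show "act g (act g x) = x" if "x \<in> ?N" for x using inv that by simp
      show "act g x \<in> ?N" if x: "x \<in> ?N" for x
      proof -
        have xP: "x \<in> P" "act g x \<noteq> x" using x by (auto simp: F)
        have "act g (act g x) \<noteq> act g x" unfolding inv[OF xP(1)] by (rule xP(2)[symmetric])
        thus ?thesis using pt.act_closed[OF g(1) xP(1)] by (simp add: F)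
      qed
      show "act g x \<noteq> x" if "x \<in> ?N" for x using that by (auto simp: F)
    qed simp
    then obtain R where R: "R \<inter> act g ` R = {}" "R \<union> act g ` R = ?N" "card ?N = 2 * card R" by blast
    have R56: "card R = 56" using R(3) f9 card_points FP finF by (simp add: card_Diff_subset)
    have RP: "R \<subseteq> P" "R \<inter> F = {}" "act g ` R \<inter> F = {}" using R(2) by auto
    have finR: "finite R" using RP(1) finite_subset finite_points by blast
    have "card (Pow F \<times> Pow R) \<le> card E0"
    proof (rule card_inj_on_le)
      show "inj_on (\<lambda>(A, B). A \<union> B \<union> act g ` B) (Pow F \<times> Pow R)"
      proof (rule inj_on_inverseI[where g = "\<lambda>Y. (Y \<inter> F, Y \<inter> R)"], clarify)
        fix A B assume AB: "A \<subseteq> F" "B \<subseteq> R"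
        have "act g ` B \<subseteq> act g ` R" using AB(2) by (rule image_mono)
        thus "(A \<union> B \<union> act g ` B) \<inter> F = A \<and> (A \<union> B \<union> act g ` B) \<inter> R = B"
          using AB RP(2,3) R(1) by blast
      qed
      show "(\<lambda>(A, B). A \<union> B \<union> act g ` B) ` (Pow F \<times> Pow R) \<subseteq> E0"
      proof clarify
        fix A B assume AB: "A \<subseteq> F" "B \<subseteq> R"
        have BP: "B \<subseteq> P" using AB(2) RP(1) by blast
        have "act g ` A = A" using AB(1) by (force simp: F)
        moreover have "act g ` act g ` B = B" by (rule pt.act_involution_image[OF g(1,2) BP])
        ultimately have "act g ` (A \<union> B \<union> act g ` B) = A \<union> B \<union> act g ` B" by (simp only: image_Un) blast
        moreover have "act g ` B \<subseteq> P" using pt.act_closed[OF g(1)] BP by blast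
        ultimately show "A \<union> B \<union> act g ` B \<in> E0" using AB(1) BP FP by (simp add: E0_def)
      qed
      show "finite E0" by (rule finite_subset[OF _ finPow]) (auto simp: E0_def)
    qed
    thus ?thesis using f9 R56 finF finR by (simp add: card_cartesian_product card_Pow)
  qed
  have "{} \<in> block_code" unfolding block_code_def by (rule image_eqI[of _ _ "{}"]) auto
  hence "{} \<in> D" by (simp add: D_def)
  hence Dpos: "0 < card D" using finD by (auto simp: card_gt_0_iff)
  \<comment> \<open>Cancelling |D|, which is positive, leaves at least 2 ^ 63 code words, while 126
    > 121.\<close>
  have "2 ^ 65 * card D \<le> card block_code * card Q" unfolding duality using cE0 by simp
  also have "\<dots> \<le> card block_code * (4 * card D)" using Q4 by simp
  finally have "2 ^ 65 * card D \<le> (4 * card block_code) * card D" by (simp add: mult_ac)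
  hence "2 ^ 65 \<le> 4 * card block_code" using Dpos by simp
  hence c63: "2 ^ 63 \<le> card block_code" by simp
  have "(2::nat) ^ 63 * 2 ^ 63 \<le> card block_code * card block_code" by (rule mult_le_mono[OF c63 c63])
  thus False using card_block_code by simp
qed

end

section \<open>Groups whose order is a product of two primes\<close>

lemma dvd_diff_less_eq:
  fixes x y m :: int
  assumes "m dvd x - y" "0 \<le> x" "x < m" "0 \<le> y" "y < m"
  shows "x = y"
  using assms by (metis mod_eq_dvd_iff mod_pos_pos_trivial)

context group
begin

lemma prime_ord:
  assumes S: "subgroup S G" "prime (card S)" and a: "a \<in> S" "a \<noteq> \<one>"
  shows "ord a = card S"
proof -
  have aG: "a \<in> carrier G" using subgroup.mem_carrier[OF S(1) a(1)] .
  have "ord a dvd card S" using subgroup_pow_card[OF S(1) a(1)] pow_eq_id[OF aG] by simp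
  moreover have "ord a \<noteq> 1" using pow_eq_id[OF aG, of 1] a(2) aG by auto
  ultimately show ?thesis using S(2) by (auto simp: prime_nat_iff)
qed

lemma subgroup_nat_pow: "subgroup S G \<Longrightarrow> a \<in> S \<Longrightarrow> a [^] (i::nat) \<in> S"
  by (induction i) (auto simp: subgroup.one_closed subgroup.m_closed)

lemma prime_subgroup_powers:
  assumes S: "subgroup S G" "prime (card S)" and a: "a \<in> S" "a \<noteq> \<one>" and x: "x \<in> S"
  obtains i :: nat where "x = a [^] i"
proof -
  have aG: "a \<in> carrier G" using subgroup.mem_carrier[OF S(1) a(1)] .
  have "finite S" using S(2) prime_gt_0_nat card_ge_0_finite by blast
  moreover have "(\<lambda>i. a [^] i) ` {..<card S} \<subseteq> S" using subgroup_nat_pow[OF S(1) a(1)] by auto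
  moreover have "inj_on (\<lambda>i. a [^] i) {..<card S}"
  proof (rule inj_onI)
    fix i j assume ij: "i \<in> {..<card S}" "j \<in> {..<card S}" "a [^] i = a [^] j"
    hence "a [^] int i = a [^] int j" by (simp add: int_pow_int)
    hence "int (card S) dvd int j - int i" using int_pow_eq[OF aG] prime_ord[OF S a] by simp
    hence "int j = int i" by (rule dvd_diff_less_eq) (use ij in auto)
    thus "i = j" by simp
  qed
  hence "card ((\<lambda>i. a [^] i) ` {..<card S}) = card S" by (simp add: card_image)
  ultimately have "(\<lambda>i. a [^] i) ` {..<card S} = S" by (intro card_subset_eq) auto
  thus thesis using x that by blast
qed

lemma conj_pow:
  assumes ab: "a \<in> carrier G" "b \<in> carrier G" and k: "b \<otimes> a = a [^] (k::int) \<otimes> b"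
  shows "b \<otimes> a [^] (n::nat) = a [^] (k * int n) \<otimes> b"
proof (induction n)
  case (Suc n)
  have "b \<otimes> a [^] Suc n = (b \<otimes> a [^] n) \<otimes> a" using ab by (simp add: m_assoc)
  also have "\<dots> = a [^] (k * int n) \<otimes> (b \<otimes> a)" using ab Suc.IH by (simp add: m_assoc)
  also have "\<dots> = (a [^] (k * int n) \<otimes> a [^] k) \<otimes> b" using ab k by (simp add: m_assoc)
  also have "a [^] (k * int n) \<otimes> a [^] k = a [^] (k * int n + k)" using ab by (simp add: int_pow_mult)
  finally show ?case by (simp add: algebra_simps)
qed (use ab in simp)

text \<open>The isomorphism sends (n, h) to a^n b^h; it is onto by comparison of orders. The
  exponent k is an integer so that inversion can be entered as k = -1.\<close>

lemma semidirect_product_iso: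
  fixes k :: int
  assumes ab: "a \<in> carrier G" "b \<in> carrier G" and ord: "ord a = m" "ord b = r"
    and m: "0 < m" and r: "0 < r" and cop: "coprime m r" and fin: "finite (carrier G)" and card: "order G = m * r"
    and k: "b \<otimes> a = a [^] k \<otimes> b"
    and grp: "group (semidirect_product (integer_mod_group m) (integer_mod_group r)
      (\<lambda>h. \<lambda>n \<in> carrier (integer_mod_group m). k ^ nat h * n mod int m))"
  shows "G \<cong> semidirect_product (integer_mod_group m) (integer_mod_group r)
      (\<lambda>h. \<lambda>n \<in> carrier (integer_mod_group m). k ^ nat h * n mod int m)" (is "_ \<cong> ?SD")
proof -
  have amod: "a [^] (x mod int m) = a [^] x" and bmod: "b [^] (x mod int r) = b [^] x" for x :: int
    using int_pow_eq[OF ab(1)] int_pow_eq[OF ab(2)] ord by (simp_all add: mod_eq_dvd_iff[symmetric])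
  \<comment> \<open>\<open>conj_pow\<close> covers natural exponents; reduction modulo the order of
    a extends it to all integers.\<close>
  have 1: "b \<otimes> a [^] (z::int) = a [^] (k * z) \<otimes> b" for z
  proof -
    have "b \<otimes> a [^] (z mod int m) = a [^] (k * (z mod int m)) \<otimes> b"
      using conj_pow[OF ab k, of "nat (z mod int m)"] m by (simp add: int_pow_int[symmetric])
    moreover have "a [^] (k * (z mod int m)) = a [^] (k * z)"
      using amod[of "k * (z mod int m)"] amod[of "k * z"] by (simp add: mod_mult_right_eq)
    ultimately show ?thesis by (simp add: amod)
  qed
  have 2: "b [^] (h::nat) \<otimes> a [^] (z::int) = a [^] (k ^ h * z) \<otimes> b [^] h" for h z
  proof (induction h arbitrary: z)
    case (Suc h)
    have "b [^] Suc h \<otimes> a [^] z = b [^] h \<otimes> (b \<otimes> a [^] z)" using ab by (simp add: m_assoc)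
    also have "\<dots> = (b [^] h \<otimes> a [^] (k * z)) \<otimes> b" unfolding 1 using ab by (simp add: m_assoc)
    also have "\<dots> = a [^] (k ^ h * (k * z)) \<otimes> (b [^] h \<otimes> b)" unfolding Suc.IH using ab by (simp add: m_assoc)
    finally show ?case by (simp add: mult_ac)
  qed (use ab in simp)
  define \<psi> where "\<psi> = (\<lambda>(n::int, h::int). a [^] n \<otimes> b [^] h)"
  have car: "carrier ?SD = {0..<int m} \<times> {0..<int r}"
    using m r by (simp add: semidirect_product_def carrier_integer_mod_group)
  have hom: "\<psi> \<in> hom ?SD G"
  proof (rule homI)
    fix x y assume xy: "x \<in> carrier ?SD" "y \<in> carrier ?SD"
    obtain n h n' h' where x: "x = (n, h)" and y: "y = (n', h')" by (metis surj_pair)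
    have h0: "0 \<le> h" and n': "n' \<in> carrier (integer_mod_group m)"
      using xy x y m unfolding car by (auto simp: carrier_integer_mod_group)
    have "\<psi> x \<otimes> \<psi> y = a [^] n \<otimes> (b [^] nat h \<otimes> a [^] n') \<otimes> b [^] h'"
      using ab h0 by (simp add: \<psi>_def x y m_assoc int_pow_int[symmetric])
    also have "\<dots> = (a [^] n \<otimes> a [^] (k ^ nat h * n')) \<otimes> (b [^] h \<otimes> b [^] h')"
      unfolding 2 using ab h0 by (simp add: m_assoc int_pow_int[symmetric])
    also have "\<dots> = a [^] (n + k ^ nat h * n') \<otimes> b [^] (h + h')" using ab by (simp add: int_pow_mult)
    also have "\<dots> = a [^] ((n + k ^ nat h * n' mod int m) mod int m) \<otimes> b [^] ((h + h') mod int r)"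
      unfolding bmod mod_add_right_eq amod ..
    also have "\<dots> = \<psi> (x \<otimes>\<^bsub>?SD\<^esub> y)" using n' by (simp add: \<psi>_def x y semidirect_product_def)
    finally show "\<psi> (x \<otimes>\<^bsub>?SD\<^esub> y) = \<psi> x \<otimes> \<psi> y" ..
  qed (use ab in \<open>auto simp: \<psi>_def\<close>)
  have inj: "inj_on \<psi> (carrier ?SD)"
  proof (rule inj_onI)
    fix x y assume xy: "x \<in> carrier ?SD" "y \<in> carrier ?SD" and eq: "\<psi> x = \<psi> y"
    obtain n h n' h' where x: "x = (n, h)" and y: "y = (n', h')" by (metis surj_pair)
    have ran: "0 \<le> n" "n < int m" "0 \<le> n'" "n' < int m" "0 \<le> h" "h < int r" "0 \<le> h'" "h' < int r"
      using xy unfolding car x y by auto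
    have "a [^] (n - n') = a [^] (- n') \<otimes> (a [^] n \<otimes> b [^] h) \<otimes> b [^] (- h)"
      using ab int_pow_mult[OF ab(1), of "- n'" n] int_pow_mult[OF ab(2), of h "- h"] by (simp add: m_assoc)
    also have "a [^] n \<otimes> b [^] h = a [^] n' \<otimes> b [^] h'" using eq by (simp add: \<psi>_def x y)
    also have "a [^] (- n') \<otimes> (a [^] n' \<otimes> b [^] h') \<otimes> b [^] (- h) = b [^] (h' - h)"
      using ab int_pow_mult[OF ab(1), of "- n'" n'] int_pow_mult[OF ab(2), of h' "- h"] by (simp flip: m_assoc)
    finally have e: "a [^] (n - n') = b [^] (h' - h)" .
    \<comment> \<open>Raising to the power r removes b, and m and r are coprime.\<close>
    hence "a [^] ((n - n') * int r) = b [^] ((h' - h) * int r)" using ab by (simp flip: int_pow_pow)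
    also have "\<dots> = \<one>" using int_pow_eq_id[OF ab(2)] ord by simp
    finally have "int m dvd (n - n') * int r" using int_pow_eq_id[OF ab(1)] ord by simp
    hence "int m dvd n - n'" using cop by (simp add: coprime_dvd_mult_left_iff)
    hence nn: "n = n'" by (rule dvd_diff_less_eq) (use ran in auto)
    hence "b [^] (h' - h) = \<one>" using e by simp
    hence "int r dvd h' - h" using int_pow_eq_id[OF ab(2)] ord by simp
    hence "h' = h" by (rule dvd_diff_less_eq) (use ran in auto)
    thus "x = y" using nn x y by simp
  qed
  have "\<psi> ` carrier ?SD = carrier G"
  proof (rule card_subset_eq[OF fin])
    show "\<psi> ` carrier ?SD \<subseteq> carrier G" using ab by (auto simp: \<psi>_def)
    show "card (\<psi> ` carrier ?SD) = card (carrier G)"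
      using card_image[OF inj] card unfolding car by (simp add: card_cartesian_product order_def)
  qed
  hence "\<psi> \<in> iso ?SD G" using hom inj by (simp add: iso_def bij_betw_def)
  hence "?SD \<cong> G" by (rule is_isoI)
  thus ?thesis by (rule group.iso_sym[OF grp])
qed

text \<open>Since p r < p^2, conjugation by b preserves S, so b a b^-1 = a^k; then b^r = 1 forces
  k^r = 1 modulo p.\<close>

lemma order_prime_product:
  assumes fin: "finite (carrier G)" and card: "order G = p * r" and p: "prime p" and r: "prime r" "r < p"
  obtains S T a b k where "subgroup S G" "card S = p" "subgroup T G" "card T = r"
    "a \<in> S" "a \<noteq> \<one>" "ord a = p" "b \<in> T" "b \<noteq> \<one>" "ord b = r"
    "k < p" "k ^ r mod p = 1 mod p" "b \<otimes> a = a [^] int k \<otimes> b"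
proof -
  have G: "subgroup (carrier G) G" by (rule subgroup_self)
  have cG: "card (carrier G) = p * r" using card by (simp add: order_def)
  obtain S where S: "subgroup S G" "S \<subseteq> carrier G" "card S = p ^ 1"
    using subgroup_of_prime_power_order[OF fin G p, of 1] cG by auto
  obtain T where T: "subgroup T G" "T \<subseteq> carrier G" "card T = r ^ 1"
    using subgroup_of_prime_power_order[OF fin G r(1), of 1] cG by auto
  have pS: "prime (card S)" and pT: "prime (card T)" using S(3) T(3) p r by simp_all
  obtain a where a: "a \<in> S" "a \<noteq> \<one>" "a \<in> carrier G" using prime_order_nontrivial[OF S(1) pS] .
  obtain b where b: "b \<in> T" "b \<noteq> \<one>" "b \<in> carrier G" using prime_order_nontrivial[OF T(1) pT] .
  have oa: "ord a = p" and ob: "ord b = r"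
    using prime_ord[OF S(1) pS a(1,2)] prime_ord[OF T(1) pT b(1,2)] S(3) T(3) by simp_all
  have "inv (inv b) \<otimes> a \<otimes> inv b \<in> S"
    by (rule normalizes_of_card_less_square[OF G fin S(1,2) pS _ _ a(1)])
      (use S(3) cG r(2) b(3) prime_gt_0_nat[OF p] in auto)
  then obtain i :: nat where i: "b \<otimes> a \<otimes> inv b = a [^] i"
    using prime_subgroup_powers[OF S(1) pS a(1,2)] b(3) by auto
  define k where "k = i mod p"
  have "a [^] k = a [^] i"
  proof -
    have "a [^] i = a [^] (p * (i div p) + k)" by (simp add: k_def)
    also have "\<dots> = (a [^] p) [^] (i div p) \<otimes> a [^] k" using a(3) by (simp add: nat_pow_mult nat_pow_pow)
    also have "a [^] p = \<one>" using pow_eq_id[OF a(3)] oa by simp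
    finally show ?thesis using a(3) by simp
  qed
  hence "b \<otimes> a \<otimes> inv b = a [^] k" using i by simp
  hence "b \<otimes> a \<otimes> inv b \<otimes> b = a [^] k \<otimes> b" by simp
  hence ba: "b \<otimes> a = a [^] int k \<otimes> b" using a(3) b(3) by (simp add: m_assoc int_pow_int)
  have pw: "b [^] (j::nat) \<otimes> a = a [^] (k ^ j) \<otimes> b [^] j" for j
  proof (induction j)
    case (Suc j)
    have "b [^] Suc j \<otimes> a = b \<otimes> (b [^] j \<otimes> a)"
      unfolding nat_pow_Suc2[OF b(3)] using a(3) b(3) by (simp add: m_assoc)
    also have "\<dots> = (b \<otimes> a [^] (k ^ j)) \<otimes> b [^] j" unfolding Suc.IH using a(3) b(3) by (simp add: m_assoc)
    also have "b \<otimes> a [^] (k ^ j) = a [^] (int k * int (k ^ j)) \<otimes> b" by (rule conj_pow[OF a(3) b(3) ba])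
    also have "int k * int (k ^ j) = int (k ^ Suc j)" by simp
    also have "a [^] int (k ^ Suc j) \<otimes> b \<otimes> b [^] j = a [^] (k ^ Suc j) \<otimes> b [^] Suc j"
      unfolding nat_pow_Suc2[OF b(3)] int_pow_int using a(3) b(3) by (simp add: m_assoc)
    finally show ?case .
  qed (use a(3) in simp)
  have "b [^] r = \<one>" using pow_eq_id[OF b(3)] ob by simp
  hence "a [^] (1::nat) = a [^] (k ^ r)" using pw[of r] a(3) by simp
  hence "a [^] int 1 = a [^] int (k ^ r)" by (simp only: int_pow_int)
  hence "int p dvd int (k ^ r) - int 1" unfolding int_pow_eq[OF a(3)] oa .
  hence "int (k ^ r) mod int p = int 1 mod int p" by (simp add: mod_eq_dvd_iff)
  hence kr: "k ^ r mod p = 1 mod p" by (simp only: of_nat_mod[symmetric] of_nat_eq_iff)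
  have "k < p" using prime_gt_0_nat[OF p] by (simp add: k_def)
  from that[OF S(1) _ T(1) _ a(1,2) oa b(1,2) ob this kr ba] S(3) T(3) show thesis by simp
qed

end

section \<open>The bound for the order, and groups of order 10, 14 and 21\<close>

context biplane_group
begin

text \<open>Sylow's theorem supplies subgroups of every order p^j with j up to k, so it is enough
  that 2^8, 3^3, 5^2, 7^2 and primes above 7 do not occur.\<close>

lemma prime_power_dvd_bound:
  assumes "prime p" "p ^ k dvd order G"
  shows "p ^ k dvd 2 ^ 7 * 3 ^ 2 * 5 * 7"
proof -
  have sub: "\<exists>K. subgroup K G \<and> card K = p ^ j" if "j \<le> k" for j
  proof -
    have "p ^ j dvd card (carrier G)"
      using assms(2) le_imp_power_dvd[OF that] dvd_trans by (auto simp: order_def)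
    from subgroup_of_prime_power_order[OF pt.finite_carrier subgroup_self assms(1) this] show ?thesis by metis
  qed
  show ?thesis
  proof (cases "k = 0")
    case False
    then obtain K where K: "subgroup K G" "card K = p ^ 1" using sub[of 1] by auto
    hence "p \<in> {2, 3, 5, 7}" using prime_order_le_7[of K] assms(1) by simp
    then consider "p = 2" | "p = 3" | "p = 5" | "p = 7" by auto
    thus ?thesis
    proof cases
      case 1
      have "\<not> 8 \<le> k" using sub[of 8] no_subgroup_256 1 by auto
      hence "(2::nat) ^ k dvd 2 ^ 7" by (intro le_imp_power_dvd) auto
      thus ?thesis unfolding 1 mult.assoc by (rule dvd_mult2)
    next
      case 2
      have "\<not> 3 \<le> k" using sub[of 3] no_subgroup_27 2 by auto
      hence "(3::nat) ^ k dvd 3 ^ 2" by (intro le_imp_power_dvd) auto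
      thus ?thesis unfolding 2 mult.assoc by (intro dvd_mult dvd_mult2)
    next
      case 3
      have "\<not> 2 \<le> k" using sub[of 2] no_subgroup_prime_square[of _ 5 1] 3 by auto
      hence "k = 1" using False by simp
      thus ?thesis using 3 by simp
    next
      case 4
      have "\<not> 2 \<le> k" using sub[of 2] no_subgroup_prime_square[of _ 7 2] 4 by auto
      hence "k = 1" using False by simp
      thus ?thesis using 4 by simp
    qed
  qed simp
qed

lemma order_dvd: "order G dvd 2 ^ 7 * 3 ^ 2 * 5 * 7"
proof (rule multiplicity_le_imp_dvd)
  show "order G \<noteq> 0" using pt.finite_carrier order_gt_0_iff_finite by simp
  show "multiplicity p (order G) \<le> multiplicity p (2 ^ 7 * 3 ^ 2 * 5 * 7)" if p: "prime p" for p
    by (rule multiplicity_geI[OF _ _ prime_power_dvd_bound[OF p multiplicity_dvd]]) (use p in auto)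
qed

text \<open>\<open>order_prime_product\<close> within H, with the subgroups moved to G, where the
  action lives. The orders of a and b stay relative to H, as the isomorphisms are built
  there.\<close>

lemma prime_product_subgroup:
  assumes H: "subgroup H G" "card H = p * r" and p: "prime p" and r: "prime r" "r < p"
  obtains S T a b k where "subgroup S G" "card S = p" "subgroup T G" "card T = r"
    "a \<in> S" "a \<noteq> \<one>" "b \<in> T" "b \<noteq> \<one>" "k < p" "k ^ r mod p = 1 mod p" "b \<otimes> a = a [^] int k \<otimes> b"
    "a \<in> H" "b \<in> H" "group.ord (G\<lparr>carrier := H\<rparr>) a = p" "group.ord (G\<lparr>carrier := H\<rparr>) b = r"
    "prime (card S)" "prime (card T)" "a \<in> carrier G" "b \<in> carrier G"
proof -
  let ?H = "G\<lparr>carrier := H\<rparr>"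
  interpret L: group ?H using H(1) by (rule subgroup_imp_group)
  have "finite (carrier ?H)" using pt.finite_subgroup[OF H(1)] by simp
  moreover have "order ?H = p * r" using H(2) by (simp add: order_def)
  ultimately obtain S T a b k where ST: "subgroup S ?H" "card S = p" "subgroup T ?H" "card T = r"
    "a \<in> S" "a \<noteq> \<one>\<^bsub>?H\<^esub>" "L.ord a = p" "b \<in> T" "b \<noteq> \<one>\<^bsub>?H\<^esub>" "L.ord b = r"
    "k < p" "k ^ r mod p = 1 mod p" "b \<otimes>\<^bsub>?H\<^esub> a = a [^]\<^bsub>?H\<^esub> int k \<otimes>\<^bsub>?H\<^esub> b"
    using L.order_prime_product[OF _ _ p r] by metis
  have aH: "a \<in> H" and bH: "b \<in> H"
    using subgroup.mem_carrier[OF ST(1,5)] subgroup.mem_carrier[OF ST(3,8)] by simp_all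
  show thesis
    by (rule that[OF incl_subgroup[OF H(1) ST(1)] ST(2) incl_subgroup[OF H(1) ST(3)] ST(4,5) _ ST(8) _ ST(11,12) _ aH bH ST(7,10)])
      (use ST(2,4,6,9,13) p r(1) subgroup.mem_carrier[OF H(1)] aH bH int_pow_consistent[OF H(1) aH] in auto)
qed

lemma commuting_generators:
  assumes S: "subgroup S G" "prime (card S)" "a \<in> S" "a \<noteq> \<one>"
    and T: "subgroup T G" "prime (card T)" "b \<in> T" "b \<noteq> \<one>"
    and ab: "b \<otimes> a = a \<otimes> b" and st: "s \<in> S" "t \<in> T"
  shows "s \<otimes> t = t \<otimes> s"
proof -
  have aG: "a \<in> carrier G" and bG: "b \<in> carrier G" using subgroup.mem_carrier[OF S(1,3)] subgroup.mem_carrier[OF T(1,3)] .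
  obtain i :: nat where i: "s = a [^] i" using prime_subgroup_powers[OF S st(1)] .
  obtain j :: nat where j: "t = b [^] j" using prime_subgroup_powers[OF T st(2)] .
  have "b \<otimes> a [^] i = a [^] i \<otimes> b"
    using conj_pow[OF aG bG, of 1 i] ab aG by (simp add: int_pow_int)
  hence "a [^] i \<otimes> b [^] j = b [^] j \<otimes> a [^] i"
    using conj_pow[OF bG nat_pow_closed[OF aG], of i 1 j] bG by (simp add: int_pow_int)
  thus ?thesis using i j by simp
qed

text \<open>The solutions of k^3 = 1 modulo 7 are 1, 2 and 4. The first makes the generators
  commute; for 4, replacing b by its square gives exponent 16, which is 2 modulo 7.\<close>

lemma subgroup_21_iso:
  assumes H: "subgroup H G" "card H = 21"
  shows "G\<lparr>carrier := H\<rparr> \<cong> Frob21"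
proof -
  let ?H = "G\<lparr>carrier := H\<rparr>"
  interpret L: group ?H using H(1) by (rule subgroup_imp_group)
  have "card H = 7 * 3" "prime (7::nat)" "prime (3::nat)" "(3::nat) < 7" using H(2) by simp_all
  then obtain S T a b k where ST: "subgroup S G" "card S = 7" "subgroup T G" "card T = 3"
    "a \<in> S" "a \<noteq> \<one>" "b \<in> T" "b \<noteq> \<one>" "k < 7" "k ^ 3 mod 7 = 1 mod 7" "b \<otimes> a = a [^] int k \<otimes> b"
    "a \<in> H" "b \<in> H" "L.ord a = 7" "L.ord b = 3" "prime (card S)" "prime (card T)"
    "a \<in> carrier G" "b \<in> carrier G"
    by (rule prime_product_subgroup[OF H(1)])
  note pST = ST(16,17) and aG = ST(18) and bG = ST(19)
  have "k \<noteq> 1"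
  proof
    assume "k = 1"
    hence "b \<otimes> a = a \<otimes> b" using ST(11) aG by simp
    from no_commuting_7_3[OF ST(1-4) commuting_generators[OF ST(1) pST(1) ST(5,6,3) pST(2) ST(7,8) this]]
    show False .
  qed
  moreover have "k \<in> {0,1,2,3,4,5,6}" using ST(9) by (simp, presburger)
  ultimately have k: "k = 2 \<or> k = 4" using ST(10) by auto
  obtain c where c: "c \<in> H" "L.ord c = 3" "c \<otimes> a = a [^] (2::int) \<otimes> c"
  proof (cases "k = 2")
    case True
    thus thesis using that[of b] ST by simp
  next
    case False
    hence k4: "k = 4" using k by simp
    have "b \<otimes> (b \<otimes> a) = a [^] (16::int) \<otimes> (b \<otimes> b)"
    proof -
      have "b \<otimes> (b \<otimes> a) = (b \<otimes> a [^] (4::nat)) \<otimes> b" using ST(11) k4 aG bG int_pow_int[of G a 4] by (simp add: m_assoc)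
      also have "b \<otimes> a [^] (4::nat) = a [^] (16::int) \<otimes> b" using conj_pow[OF aG bG ST(11), of 4] k4 by simp
      finally show ?thesis using aG bG by (simp add: m_assoc)
    qed
    moreover have "a [^] (16::int) = a [^] (2::int)"
      using L.int_pow_eq[of a 16 2] ST(12,14) int_pow_consistent[OF H(1) ST(12)] by simp
    ultimately have "(b \<otimes> b) \<otimes> a = a [^] (2::int) \<otimes> (b \<otimes> b)" using aG bG by (simp add: m_assoc)
    moreover have "L.ord (b \<otimes> b) = 3"
    proof -
      have bb: "b \<otimes> b \<in> T" using subgroup.m_closed[OF ST(3,7,7)] .
      have "b \<otimes> b \<noteq> \<one>" using odd_subgroup_square[OF ST(3) _ ST(7)] ST(4,8) by auto
      have "L.ord (b \<otimes> b) dvd 3"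
      proof -
        have "(b \<otimes> b) [^]\<^bsub>?H\<^esub> (3::nat) = \<one>"
          using subgroup_pow_card[OF ST(3) bb] ST(4) nat_pow_consistent[of "b \<otimes> b" 3 H] by simp
        thus ?thesis using L.pow_eq_id[of "b \<otimes> b" 3] ST(13) subgroup.m_closed[OF H(1)] by simp
      qed
      moreover have "L.ord (b \<otimes> b) \<noteq> 1"
        using L.pow_eq_id[of "b \<otimes> b" 1] ST(13) subgroup.m_closed[OF H(1)] \<open>b \<otimes> b \<noteq> \<one>\<close>
          nat_pow_consistent[of "b \<otimes> b" 1 H] bG by auto
      ultimately show ?thesis using prime_nat_iff[of 3] by auto
    qed
    ultimately show thesis using that[of "b \<otimes> b"] ST(13) subgroup.m_closed[OF H(1)] by simp
  qed
  have "coprime (7::nat) 3" by (intro primes_coprime) auto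
  show ?thesis unfolding Frob21_def
  proof (rule L.semidirect_product_iso[of a c 7 3 2, simplified])
    show "c \<otimes> a = a [^]\<^bsub>?H\<^esub> (2::int) \<otimes> c" using c(3) int_pow_consistent[OF H(1) ST(12)] by simp
  qed (use c ST(12,14) H \<open>coprime (7::nat) 3\<close> pt.finite_subgroup[OF H(1)] group_Frob21 in \<open>auto simp: order_def Frob21_def\<close>)
qed

text \<open>The solutions of k^2 = 1 modulo 5 are 1 and 4; the first is the commuting case, and the
  second is inversion.\<close>

lemma subgroup_10_iso:
  assumes H: "subgroup H G" "card H = 10"
  shows "G\<lparr>carrier := H\<rparr> \<cong> D10"
proof -
  let ?H = "G\<lparr>carrier := H\<rparr>"
  interpret L: group ?H using H(1) by (rule subgroup_imp_group)
  have "card H = 5 * 2" "prime (5::nat)" "prime (2::nat)" "(2::nat) < 5" using H(2) by simp_all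
  then obtain S T a b k where ST: "subgroup S G" "card S = 5" "subgroup T G" "card T = 2"
    "a \<in> S" "a \<noteq> \<one>" "b \<in> T" "b \<noteq> \<one>" "k < 5" "k ^ 2 mod 5 = 1 mod 5" "b \<otimes> a = a [^] int k \<otimes> b"
    "a \<in> H" "b \<in> H" "L.ord a = 5" "L.ord b = 2" "prime (card S)" "prime (card T)"
    "a \<in> carrier G" "b \<in> carrier G"
    by (rule prime_product_subgroup[OF H(1)])
  note pST = ST(16,17) and aG = ST(18) and bG = ST(19)
  have "k \<noteq> 1"
  proof
    assume "k = 1"
    hence "b \<otimes> a = a \<otimes> b" using ST(11) aG by simp
    from no_commuting_5_2[OF ST(1-4) commuting_generators[OF ST(1) pST(1) ST(5,6,3) pST(2) ST(7,8) this]]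
    show False .
  qed
  moreover have "k \<in> {0,1,2,3,4}" using ST(9) by (simp, presburger)
  ultimately have k: "k = 4" using ST(10) by auto
  have "a [^]\<^bsub>?H\<^esub> int 4 = a [^]\<^bsub>?H\<^esub> (- 1 :: int)"
    using L.int_pow_eq[of a "int 4" "- 1"] ST(12,14) by simp
  hence ba: "b \<otimes> a = a [^]\<^bsub>?H\<^esub> (- 1 :: int) \<otimes> b"
    using ST(11) int_pow_consistent[OF H(1) ST(12)] k by metis
  show ?thesis unfolding D10_def
  proof (rule L.semidirect_product_iso[of a b 5 2 "- 1", simplified])
    show "b \<otimes> a = a [^]\<^bsub>?H\<^esub> (- 1 :: int) \<otimes> b" by (rule ba)
  qed (use ST(12-15) H pt.finite_subgroup[OF H(1)] group_D10 in \<open>auto simp: order_def D10_def\<close>)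
qed

text \<open>The solutions of k^2 = 1 modulo 7 are 1 and 6, the cyclic and the dihedral case.\<close>

lemma no_subgroup_14:
  assumes H: "subgroup H G" shows "card H \<noteq> 14"
proof
  assume c: "card H = 14"
  have "card H = 7 * 2" "prime (7::nat)" "prime (2::nat)" "(2::nat) < 7" using c by simp_all
  then obtain S T a b k where ST: "subgroup S G" "card S = 7" "subgroup T G" "card T = 2"
    "a \<in> S" "a \<noteq> \<one>" "b \<in> T" "b \<noteq> \<one>" "k < 7" "k ^ 2 mod 7 = 1 mod 7" "b \<otimes> a = a [^] int k \<otimes> b"
    "prime (card S)" "prime (card T)" "a \<in> carrier G" "b \<in> carrier G"
    by (rule prime_product_subgroup[OF H])
  note pST = ST(12,13) and aG = ST(14) and bG = ST(15)
  have bb: "b \<otimes> b = \<one>" using subgroup_pow_card[OF ST(3,7)] ST(4) bG by (simp add: numeral_2_eq_2)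
  have "k \<in> {0,1,2,3,4,5,6}" using ST(9) by (simp, presburger)
  hence "k = 1 \<or> k = 6" using ST(10) by auto
  thus False
  proof
    assume "k = 1"
    hence ab: "b \<otimes> a = a \<otimes> b" using ST(11) aG by simp
    show False
      by (rule no_cyclic_14[OF ST(1,2) bG bb ST(8)])
        (rule commuting_generators[OF ST(1) pST(1) ST(5,6,3) pST(2) ST(7,8) ab _ ST(7), symmetric])
  next
    assume k: "k = 6"
    show False
    proof (rule no_dihedral_14[OF ST(1,2) bG bb ST(8)])
      fix s assume s: "s \<in> S"
      obtain i :: nat where i: "s = a [^] i" using prime_subgroup_powers[OF ST(1) pST(1) ST(5,6) s] .
      have o: "ord a = 7" using prime_ord[OF ST(1) pST(1) ST(5,6)] ST(2) by simp
      have "b \<otimes> s = a [^] (6 * int i) \<otimes> b" using conj_pow[OF aG bG ST(11), of i] i k by simp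
      also have "a [^] (6 * int i) = a [^] (- int i)"
        using int_pow_eq[OF aG, of "6 * int i" "- int i"] o by simp
      also have "\<dots> = inv s" using i aG by (simp add: int_pow_neg_int)
      finally show "b \<otimes> s = inv s \<otimes> b" .
    qed
  qed
qed

end

text \<open>Distinct blocks share 2 points and each has 16, so \<open>block_points\<close> is
  injective and blocks may be replaced by their point sets. The action is faithful because
  automorphisms are extensional functions.\<close>

lemma biplane_group_automorphisms:
  assumes D: "biplane 121 16 D"
  shows "biplane_group (points D) (block_points D ` blocks D) (automorphism_group D) (\<lambda>f. f)"
proof -
  let ?P = "points D" and ?BB = "block_points D ` blocks D" and ?G = "automorphism_group D"
  have sd: "t_design 2 121 16 2 D" and eq: "card (points D) = card (blocks D)"
    using D by (auto simp: biplane_def symmetric_design_def)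
  have finP: "finite ?P" and finB: "finite (blocks D)" and cP: "card ?P = 121"
    and c16: "\<And>b. b \<in> blocks D \<Longrightarrow> card (block_points D b) = 16"
    and two: "\<And>T. T \<subseteq> ?P \<Longrightarrow> card T = 2 \<Longrightarrow> card {b \<in> blocks D. \<forall>p\<in>T. (p, b) \<in> incidence D} = 2"
    using sd by (auto simp: t_design_def finite_incidence_structure_def)
  have cB: "card (blocks D) = 121" using eq cP by simp
  have sub: "block_points D b \<subseteq> ?P" for b by (auto simp: block_points_def)
  have two': "card {b \<in> blocks D. x \<in> block_points D b \<and> y \<in> block_points D b} = 2"
    if "x \<in> ?P" "y \<in> ?P" "x \<noteq> y" for x y
  proof -
    have "{b \<in> blocks D. x \<in> block_points D b \<and> y \<in> block_points D b} = {b \<in> blocks D. \<forall>p\<in>{x, y}. (p, b) \<in> incidence D}"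
      using that by (auto simp: block_points_def)
    thus ?thesis using two[of "{x, y}"] that by simp
  qed
  have dual1: "card {b \<in> blocks D. x \<in> block_points D b} = 16" if "x \<in> ?P" for x
    by (rule biplane_dual(1)[OF finP cP finB cB sub c16 two' that])
  have dual2: "card (block_points D b \<inter> block_points D c) = 2" if "b \<in> blocks D" "c \<in> blocks D" "b \<noteq> c" for b c
    by (rule biplane_dual(2)[OF finP cP finB cB sub c16 two' that])
  have inj: "inj_on (block_points D) (blocks D)"
  proof (rule inj_onI, rule ccontr)
    fix b c assume bc: "b \<in> blocks D" "c \<in> blocks D" "block_points D b = block_points D c" "b \<noteq> c"
    thus False using dual2[OF bc(1,2,4)] c16[OF bc(1)] by simp
  qed
  have tr: "card {b \<in> ?BB. R b} = card {b \<in> blocks D. R (block_points D b)}" for R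
  proof -
    have "{b \<in> ?BB. R b} = block_points D ` {b \<in> blocks D. R (block_points D b)}" by auto
    thus ?thesis using card_image[OF inj_on_subset[OF inj, of "{b \<in> blocks D. R (block_points D b)}"]] by auto
  qed
  interpret B: biplane121 ?P ?BB
  proof
    show "card ?BB = 121" using card_image[OF inj] cB by simp
    show "card {b \<in> ?BB. x \<in> b} = 16" if "x \<in> ?P" for x using tr[of "\<lambda>b. x \<in> b"] dual1[OF that] by simp
    show "card {b \<in> ?BB. x \<in> b \<and> y \<in> b} = 2" if "x \<in> ?P" "y \<in> ?P" "x \<noteq> y" for x y
      using tr[of "\<lambda>b. x \<in> b \<and> y \<in> b"] two'[OF that] by simp
    show "card (b \<inter> c) = 2" if "b \<in> ?BB" "c \<in> ?BB" "b \<noteq> c" for b c using that dual2 by auto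
  qed (use cP sub c16 in auto)
  have car: "carrier ?G = automorphisms D" by (simp add: automorphism_group_def)
  have bij: "f \<in> Bij ?P" "bij_betw f ?P ?P" if "f \<in> carrier ?G" for f
    using that by (auto simp: car automorphisms_def Bij_def)
  interpret G: group ?G by (rule group_automorphism_group[OF finP])
  have fin: "finite (carrier ?G)"
  proof (rule finite_subset)
    show "carrier ?G \<subseteq> (\<Pi>\<^sub>E x\<in>?P. ?P)"
      using bij by (force simp: Bij_def PiE_def bij_betw_def)
    show "finite (\<Pi>\<^sub>E x\<in>?P. ?P)" using finP by (simp add: finite_PiE)
  qed
  have one: "\<one>\<^bsub>?G\<^esub> = (\<lambda>x\<in>?P. x)" by (simp add: automorphism_group_def BijGroup_def)
  show ?thesis
  proof
    show "f x \<in> ?P" if "f \<in> carrier ?G" "x \<in> ?P" for f x using bij(2)[OF that(1)] that(2) by (auto simp: bij_betw_def)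
    show "\<one>\<^bsub>?G\<^esub> x = x" if "x \<in> ?P" for x using that by (simp add: one)
    show "(f \<otimes>\<^bsub>?G\<^esub> h) x = f (h x)" if "f \<in> carrier ?G" "h \<in> carrier ?G" "x \<in> ?P" for f h x
      using bij(1)[OF that(1)] bij(1)[OF that(2)] that(3)
      by (simp add: automorphism_group_def BijGroup_def compose_def)
    show "f ` b \<in> ?BB" if "f \<in> carrier ?G" "b \<in> ?BB" for f b using that by (auto simp: car automorphisms_def)
    show "f = \<one>\<^bsub>?G\<^esub>" if "f \<in> carrier ?G" "\<And>x. x \<in> ?P \<Longrightarrow> f x = x" for f
    proof -
      have "f \<in> extensional ?P" using bij(1)[OF that(1)] by (simp add: Bij_def)
      thus ?thesis unfolding one by (rule extensionalityI) (use that(2) in auto)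
    qed
  qed (use fin finP in auto)
qed

theorem theorem1p3:
  fixes D :: "('p, 'b) incidence_structure"
  assumes "biplane 121 16 D"
  shows "order (automorphism_group D) dvd 2 ^ 7 * 3 ^ 2 * 5 * 7 \<and>
    (\<forall>G. subgroup G (automorphism_group D) \<longrightarrow>
       card G \<notin> {14, 35} \<and>
       (card G = 21 \<longrightarrow> automorphism_group D \<lparr>carrier := G\<rparr> \<cong> Frob21) \<and>
       (card G = 10 \<longrightarrow> automorphism_group D \<lparr>carrier := G\<rparr> \<cong> D10))"
proof -
  interpret biplane_group "points D" "block_points D ` blocks D" "automorphism_group D" "\<lambda>f. f"
    by (rule biplane_group_automorphisms[OF assms])
  show ?thesis
    using order_dvd no_subgroup_14 no_subgroup_35 subgroup_21_iso subgroup_10_iso by blast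
qed

end
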